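(* Let $n\ge2$ and let $G_{ij}$ be the Green tensor of the stationary Stokes system in the half space $\mathbb R^n_+$. Let $x,y\in\mathbb R^n_+$ with $x\neq y$, $z=x-y^*$, $i,j\in\{1,\dots,n\}$, and let $\alpha,\beta$ be multi-indices with $|\alpha|+|\beta|=m>0$. Then, with constants $C_m$ independent of $x,y$: (1) $$|\nabla_x^\alpha\nabla_y^\beta G_{ij}(x,y)|\le\frac{C_m}{|x-y|^{n-2+m}}.$$ (2) If $\alpha_n=\beta_n=0$, then $$|\nabla_x^\alpha\nabla_y^\beta G_{ij}(x,y)|\le\frac{C_m\,x_ny_n}{|x-y|^{n-2+m}|z|^2},\qquad |\nabla_x^\alpha\nabla_y^\beta G_{in}(x,y)|\le\frac{C_m\,x_ny_n^2}{|x-y|^{n-2+m}|z|^3}.$$ (3) If $\alpha_n=0$, then $$|\nabla_x^\alpha\nabla_y^\beta G_{ij}(x,y)|\le\frac{C_m\,x_n}{|x-y|^{n-2+m}|z|}.$$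
   Context: $\mathbb R^n_+=\{x=(x',x_n):x'\in\mathbb R^{n-1},x_n>0\}$, $\Sigma=\partial\mathbb R^n_+$, $y^*=(y',-y_n)$ for $y=(y',y_n)$. $\alpha_n,\beta_n$ denote the $n$-th components of the multi-indices, i.e. the number of derivatives in $x_n$, $y_n$ respectively. $\omega_n=\frac{2\pi^{n/2}}{n\Gamma(n/2)}$ is the volume of the unit ball of $\mathbb R^n$. Set $E(x)=\frac{1}{n(n-2)\omega_n}|x|^{2-n}$ for $n\ge3$ and $E(x)=-\frac1{2\pi}\log|x|$ for $n=2$. The Lorentz tensor is $U_{ij}(x)=\frac12\delta_{ij}E(x)+\frac1{2n\omega_n}\frac{x_ix_j}{|x|^n}$. The Odqvist tensor (Poisson kernel of the Stokes system in $\mathbb R^n_+$) is $K_{ij}(x)=\frac{2x_nx_ix_j}{\omega_n|x|^{n+2}}$. Let $\epsilon_j=1-2\delta_{nj}$. The Green tensor of the Stokes system in $\mathbb R^n_+$ with zero Dirichlet boundary condition is, for $x\neq y$ in $\mathbb R^n_+$, $$G_{ij}(x,y)=U_{ij}(x-y)-\epsilon_jU_{ij}(x-y^* )-2\int_\Sigma K_{in}(x-\xi)U_{nj}(\xi-y)\,d\xi .$$ With a suitable pressure $g_j$ it satisfies $-\Delta_xG_{ij}+\partial_{x_i}g_j=\delta(x-y)\delta_{ij}$ and $\sum_i\partial_{x_i}G_{ij}=0$ for $x\in\mathbb R^n_+$, and $G_{ij}(x,y)=0$ for $x_n=0$. *)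

theory Defs
  imports "HOL-Analysis.Analysis"
begin

text \<open>
  \<^bold>\<open>Setting.\<close> The space \<open>R^n\<close>, \<open>n \<ge> 2\<close>, is \<open>'a \<times> real\<close> where \<open>'a\<close> is an arbitrary Euclidean space
  playing the role of \<open>R^(n-1)\<close>; a point is \<open>x = (x', x_n)\<close> and \<open>n = DIM('a) + 1\<close>.  Indices
  \<open>i, j \<in> {1..n}\<close> are rendered by the standard orthonormal basis vectors \<open>i, j \<in> Basis\<close>, the
  \<open>i\<close>-th component of \<open>x\<close> by \<open>x \<bullet> i\<close>, and the index \<open>n\<close> by \<open>e_n = (0, 1)\<close>, so that \<open>x \<bullet> e_n = snd x\<close>.
\<close>

definition e_n :: "'a::euclidean_space \<times> real" where
  "e_n = (0, 1)"

definition half_space :: "('a::euclidean_space \<times> real) set" where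
  "half_space = {x. snd x > 0}"

definition reflect :: "'a::euclidean_space \<times> real \<Rightarrow> 'a \<times> real" where
  "reflect y = (fst y, - snd y)"

lemma e_n_Basis: "(e_n :: 'a::euclidean_space \<times> real) \<in> Basis"
  by (simp add: e_n_def Basis_prod_def)

lemma inner_e_n: "x \<bullet> e_n = snd x"
  by (cases x) (simp add: e_n_def)

definition omega :: "nat \<Rightarrow> real" where
  "omega n = 2 * pi powr (real n / 2) / (real n * Gamma (real n / 2))"

lemma omega_eq_measure_ball:
  "omega DIM('v) = measure lborel (ball (0 :: 'v::euclidean_space) 1)"
proof -
  have "Gamma (real DIM('v) / 2 + 1) = real DIM('v) / 2 * Gamma (real DIM('v) / 2)"
    by (rule Gamma_plus1) (use nonpos_Ints_nonpos[of "real DIM('v) / 2"] DIM_positive[where 'a='v] in linarith)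
  hence "real DIM('v) * Gamma (real DIM('v) / 2) = 2 * Gamma (real DIM('v) / 2 + 1)"
    by simp
  thus ?thesis
    by (simp only: omega_def content_ball unit_ball_vol_def) simp
qed

definition fund_sol :: "'a::euclidean_space \<times> real \<Rightarrow> real" where
  "fund_sol x = (let n = DIM('a \<times> real) in
     if n = 2 then - (1 / (2 * pi)) * ln (norm x)
     else 1 / (real n * (real n - 2) * omega n) * norm x powr (2 - real n))"

definition lorentz ::
  "'a::euclidean_space \<times> real \<Rightarrow> 'a \<times> real \<Rightarrow> 'a \<times> real \<Rightarrow> real" where
  "lorentz i j x = (let n = DIM('a \<times> real) in
     1 / 2 * (if i = j then 1 else 0) * fund_sol x
     + 1 / (2 * real n * omega n) * ((x \<bullet> i) * (x \<bullet> j) / norm x ^ n))"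

definition odqvist ::
  "'a::euclidean_space \<times> real \<Rightarrow> 'a \<times> real \<Rightarrow> 'a \<times> real \<Rightarrow> real" where
  "odqvist i j x = (let n = DIM('a \<times> real) in
     2 * (x \<bullet> e_n) * (x \<bullet> i) * (x \<bullet> j) / (omega n * norm x ^ (n + 2)))"

text \<open>
  The boundary \<open>\<Sigma>\<close> is parametrised by \<open>\<xi>' \<mapsto> (\<xi>', 0)\<close>, an isometry from \<open>'a\<close>, so that surface
  measure on \<open>\<Sigma>\<close> is Lebesgue measure on \<open>'a\<close>.  The integral converges absolutely for \<open>x\<close>, \<open>y\<close> in
  the half space.
\<close>

definition green ::
  "'a::euclidean_space \<times> real \<Rightarrow> 'a \<times> real \<Rightarrow> 'a \<times> real \<Rightarrow> 'a \<times> real \<Rightarrow> real" where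
  "green i j x y =
     lorentz i j (x - y)
     - (1 - 2 * (if j = e_n then 1 else 0)) * lorentz i j (x - reflect y)
     - 2 * (\<integral>\<xi>. odqvist i e_n (x - (\<xi>, 0)) * lorentz e_n j ((\<xi>, 0) - y) \<partial>lborel)"

definition partial :: "'v::euclidean_space \<Rightarrow> ('v \<Rightarrow> real) \<Rightarrow> 'v \<Rightarrow> real" where
  "partial b f x = deriv (\<lambda>t. f (x + t *\<^sub>R b)) 0"

text \<open>
  \<open>C^\<infinity>\<close>-smoothness on an open set \<open>S\<close>: every iterated partial derivative, of any order and taken
  in any sequence of coordinate directions, is (totally) differentiable at every point of \<open>S\<close>.
\<close>

definition smooth_on :: "'v::euclidean_space set \<Rightarrow> ('v \<Rightarrow> real) \<Rightarrow> bool" where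
  "smooth_on S f \<longleftrightarrow> (\<forall>bs. set bs \<subseteq> Basis \<longrightarrow> foldr partial bs f differentiable_on S)"

text \<open>
  A multi-index assigns to each basis vector the number of derivatives in that direction; values
  outside \<open>Basis\<close> are irrelevant.  The derivatives are taken in the order of a fixed enumeration of
  \<open>Basis\<close>, which is immaterial for smooth functions.
\<close>

definition basis_enum :: "'v::euclidean_space list" where
  "basis_enum = (SOME bs. set bs = Basis \<and> distinct bs)"

lemma basis_enum:
  "set (basis_enum :: 'v::euclidean_space list) = Basis" "distinct (basis_enum :: 'v list)"
proof -
  have "\<exists>bs :: 'v list. set bs = Basis \<and> distinct bs"
    using finite_distinct_list[OF finite_Basis] by blast
  from someI_ex[OF this]
  show "set (basis_enum :: 'v list) = Basis" "distinct (basis_enum :: 'v list)"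
    by (simp_all add: basis_enum_def)
qed

definition multi_order :: "('v::euclidean_space \<Rightarrow> nat) \<Rightarrow> nat" where
  "multi_order \<alpha> = (\<Sum>b\<in>Basis. \<alpha> b)"

definition multi_deriv :: "('v::euclidean_space \<Rightarrow> nat) \<Rightarrow> ('v \<Rightarrow> real) \<Rightarrow> 'v \<Rightarrow> real" where
  "multi_deriv \<alpha> f = foldr (\<lambda>b. partial b ^^ \<alpha> b) basis_enum f"

definition green_deriv ::
  "('a::euclidean_space \<times> real \<Rightarrow> nat) \<Rightarrow> ('a \<times> real \<Rightarrow> nat) \<Rightarrow> 'a \<times> real \<Rightarrow> 'a \<times> real
     \<Rightarrow> 'a \<times> real \<Rightarrow> 'a \<times> real \<Rightarrow> real" where
  "green_deriv \<alpha> \<beta> i j x y = multi_deriv \<alpha> (\<lambda>x. multi_deriv \<beta> (\<lambda>y. green i j x y) y) x"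

end

theory Submission
  imports Defs "HOL-Probability.Probability" "HOL-Real_Asymp.Real_Asymp"
begin

text \<open>
  The proof rests on a closed form of the Green tensor.  The Odqvist kernel \<open>K\<^sub>i\<^sub>n\<close> equals
  \<open>\<delta>\<^sub>i\<^sub>n P - x\<^sub>n \<partial>\<^sub>i P\<close> with \<open>P\<close> the Poisson kernel of the half space, and on \<open>\<Sigma>\<close> the function
  \<open>U\<^sub>n\<^sub>j(\<xi> - y)\<close> is a combination of \<open>E(\<xi> - y\<^sup>*)\<close> and \<open>\<partial>\<^sub>j E(\<xi> - y\<^sup>*)\<close>, whose Poisson integrals are
  \<open>E(x - y\<^sup>*)\<close> and \<open>\<partial>\<^sub>j E(x - y\<^sup>*)\<close>.  This Poisson formula is derived from the semigroup property of
  \<open>P\<close>, which follows from writing \<open>P\<close> as a mixture of Gaussians with Levy weights.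

  The closed form shows that derivatives of order \<open>m > 0\<close> are sums of terms homogeneous of degree
  \<open>2 - n - m\<close> in \<open>x - y\<close> or in \<open>x - y\<^sup>*\<close>, which gives (1).  Since \<open>G\<^sub>i\<^sub>j\<close> vanishes for \<open>x\<^sub>n = 0\<close> and for
  \<open>y\<^sub>n = 0\<close>, and \<open>G\<^sub>i\<^sub>n\<close> vanishes to second order for \<open>y\<^sub>n = 0\<close>, (2) and (3) follow from (1) for
  derivatives of higher order by the mean value theorem in \<open>x\<^sub>n\<close> and \<open>y\<^sub>n\<close> when these are small
  compared to \<open>|z|\<close>, and directly from (1) otherwise.
\<close>

section \<open>Levy densities\<close>

text \<open>The dimension n = 2 shapes the argument: E is then a logarithm, which neither decays nor
  is homogeneous. So decay cannot fix the Poisson formula for E. Instead the pole is moved down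
  vertically: \<partial>_n E is a multiple of P, so by the semigroup property both sides have the
  same derivative in the depth b of the pole, and the constant left over is 0 because both sides
  differ from the same multiple of E(0, b) by O(b^(-1/2)). For the same reason only derivatives of E
  enter the homogeneous calculus, which is where m > 0 is used. The Levy weight is, up to sqrt (2
  pi), the density of the time when Brownian motion first reaches a given height, so the weights are
  closed under convolution just as the Gaussians are. All is nonnegative, and Tonelli suffices. Away
  from its poles the closed form is smooth across x_n = 0 and y_n = 0, so the mean value theorem can
  start on the boundary itself. The obstacle is that the segment to the boundary must stay away from
  the pole x = y; hence a height is lowered only when it is below |z| / 8.\<close>

lemma nn_integral_inverse_gamma:
  fixes q A :: real
  assumes "q > 0" "A > 0"
  shows "(\<integral>\<^sup>+s. ennreal (indicator {0<..} s * (s powr (- q - 1) * exp (- A / s))) \<partial>lborel)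
           = ennreal (Gamma q * A powr (- q))"
proof -
  let ?f = "\<lambda>t::real. t powr (q - 1) / exp t"
  have "(?f has_integral Gamma q) {0<..}"
    using Gamma_integral_real[OF assms(1)]
    by (subst has_integral_spike_set_eq[where T = "{0..}"])
       (auto intro: negligible_subset[of "{0}"])
  moreover from this have "?f absolutely_integrable_on {0<..}"
    by (intro nonnegative_absolutely_integrable_1) (auto simp: integrable_on_def)
  moreover have img: "(\<lambda>s. A / s) ` {0<..} = {0<..}"
  proof -
    have "x \<in> (\<lambda>s. A / s) ` {0<..}" if "x > 0" for x
      using that assms by (intro image_eqI[of _ _ "A / x"]) auto
    then show ?thesis using assms by auto
  qed
  ultimately have *: "(\<lambda>s. \<bar>- A / s\<^sup>2\<bar> * ?f (A / s)) absolutely_integrable_on {0<..} \<and>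
      integral {0<..} (\<lambda>s. \<bar>- A / s\<^sup>2\<bar> * ?f (A / s)) = Gamma q"
    using assms
    by (subst has_absolute_integral_change_of_variables_1')
       (auto intro!: derivative_eq_intros inj_onI integral_unique
             simp: power2_eq_square field_simps)
  have eq: "\<bar>- A / s\<^sup>2\<bar> * ?f (A / s) = A powr q * (s powr (- q - 1) * exp (- A / s))"
    if "s \<in> {0<..}" for s
    using that assms
    by (simp add: powr_divide powr_diff powr_minus exp_minus field_simps power2_eq_square)
  have "((\<lambda>s. \<bar>- A / s\<^sup>2\<bar> * ?f (A / s)) has_integral Gamma q) {0<..}"
    using integrable_integral[OF set_lebesgue_integral_eq_integral(1)[OF conjunct1[OF *]]]
    unfolding conjunct2[OF *] .
  then have "((\<lambda>s. A powr q * (s powr (- q - 1) * exp (- A / s))) has_integral Gamma q) {0<..}"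
    by (subst (asm) has_integral_cong[OF eq])
  then have "((\<lambda>s. A powr (- q) * (A powr q * (s powr (- q - 1) * exp (- A / s))))
      has_integral A powr (- q) * Gamma q) {0<..}"
    by (intro has_integral_mult_right)
  then have "((\<lambda>s. s powr (- q - 1) * exp (- A / s)) has_integral A powr (- q) * Gamma q) {0<..}"
    using assms by (simp add: powr_minus mult.assoc[symmetric])
  from nn_integral_has_integral_lebesgue[OF _ this] show ?thesis
    by (simp add: mult.commute)
qed

lemma cdf_normal_has_derivative:
  fixes \<sigma> x :: real
  assumes "\<sigma> > 0"
  shows "(cdf (density lborel (normal_density 0 \<sigma>)) has_real_derivative normal_density 0 \<sigma> x) (at x)"
proof -
  let ?N = "density lborel (\<lambda>x. ennreal (normal_density 0 \<sigma> x))"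
  interpret prob_space ?N by (rule prob_space_normal_density[OF assms])
  interpret real_distribution ?N by standard auto
  have cont: "continuous_on S (normal_density 0 \<sigma>)" for S
    unfolding normal_density_def using assms by (intro continuous_intros) auto
  \<comment> \<open>Splitting off the constant \<open>cdf ?N (x - 1)\<close> leaves an integral over
    a compact interval, to which the fundamental theorem of calculus applies.\<close>
  have cdf: "cdf ?N y = cdf ?N (x - 1) + integral {x - 1..y} (normal_density 0 \<sigma>)"
    if "y > x - 1" for y
  proof -
    have "cdf ?N y - cdf ?N (x - 1) = measure ?N {x - 1<..y}"
      using that by (rule cdf_diff_eq)
    moreover have "emeasure ?N {x - 1<..y} = ennreal (integral {x - 1..y} (normal_density 0 \<sigma>))"
    proof -
      have "emeasure ?N {x - 1<..y} = (\<integral>\<^sup>+t. indicator {x - 1<..y} t * normal_density 0 \<sigma> t \<partial>lborel)"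
        by (simp add: emeasure_density) (intro nn_integral_cong, auto split: split_indicator)
      also have "\<dots> = (\<integral>\<^sup>+t. ennreal (indicator {x - 1..y} t * normal_density 0 \<sigma> t) \<partial>lborel)"
        by (intro nn_integral_cong_AE AE_I[of _ _ "{x - 1}"]) (auto simp: indicator_def)
      also have "\<dots> = ennreal (integral {x - 1..y} (normal_density 0 \<sigma>))"
        by (intro nn_integral_has_integral_lebesgue integrable_integral
              integrable_continuous_interval cont) auto
      finally show ?thesis .
    qed
    ultimately show ?thesis
      by (simp add: measure_def integral_nonneg integrable_continuous_interval cont)
  qed
  have "((\<lambda>y. integral {x - 1..y} (normal_density 0 \<sigma>)) has_real_derivative normal_density 0 \<sigma> x)
      (at x within {x - 1..x + 1})"
    by (rule integral_has_real_derivative) (auto intro: cont)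
  moreover have "at x within {x - 1..x + 1} = at x"
    by (rule at_within_interior) auto
  ultimately have "((\<lambda>y. cdf ?N (x - 1) + integral {x - 1..y} (normal_density 0 \<sigma>))
      has_real_derivative normal_density 0 \<sigma> x) (at x)"
    by (auto intro!: derivative_eq_intros)
  then show ?thesis
  proof (rule DERIV_cong_ev[THEN iffD1, rotated 3])
    show "\<forall>\<^sub>F y in nhds x. cdf ?N (x - 1) + integral {x - 1..y} (normal_density 0 \<sigma>) = cdf ?N y"
      using eventually_nhds_in_open[of "{x - 1<..}" x] by (auto elim!: eventually_mono simp: cdf)
  qed auto
qed

text \<open>Up to the factor 1 / sqrt (2 * pi), the density of the first time at which Brownian
  motion reaches height a. The value 0 for s \<le> 0 lets all integrals run over the whole line and
  makes the meaningless values of \<open>gauss s\<close> there harmless.\<close>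

definition levy :: "real \<Rightarrow> real \<Rightarrow> real" where
  "levy a s = (if s > 0 then a / sqrt s ^ 3 * exp (- a\<^sup>2 / (2 * s)) else 0)"

lemma levy_measurable [measurable]: "levy a \<in> borel_measurable borel"
  unfolding levy_def by measurable

lemma levy_nonneg [simp]: "a \<ge> 0 \<Longrightarrow> levy a s \<ge> 0"
  by (simp add: levy_def)

text \<open>
  With \<open>w = a sqrt((T - s)/s) \<mp> b sqrt(s/(T - s))\<close> one has
  \<open>T (a\<^sup>2/s + b\<^sup>2/(T - s)) = (a \<plusminus> b)\<^sup>2 + w\<^sup>2\<close>, so \<open>levy a s * levy b (T - s)\<close> is a combination of the
  two expressions \<open>exp(-w\<^sup>2/(2T)) dw/ds\<close>.
\<close>

lemma levy_antiderivative:
  fixes a b T s :: real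
  assumes "a > 0" "b > 0" "0 < s" "s < T"
  defines "\<Phi> \<equiv> cdf (density lborel (normal_density 0 (sqrt T)))"
  shows "((\<lambda>s. - (sqrt (2 * pi * T) / T\<^sup>2) *
            ((a + b) * exp (- (a + b)\<^sup>2 / (2 * T)) * \<Phi> (a * (sqrt (T - s) / sqrt s) - b * (sqrt s / sqrt (T - s))) +
             (b - a) * exp (- (a - b)\<^sup>2 / (2 * T)) * \<Phi> (a * (sqrt (T - s) / sqrt s) + b * (sqrt s / sqrt (T - s)))))
         has_real_derivative levy a s * levy b (T - s)) (at s)"
proof -
  define \<alpha> \<beta> where "\<alpha> = sqrt s" and "\<beta> = sqrt (T - s)"
  have pos: "\<alpha> > 0" "\<beta> > 0" and sq: "\<alpha>\<^sup>2 = s" "\<beta>\<^sup>2 = T - s"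
    using assms by (auto simp: \<alpha>_def \<beta>_def)
  have T: "T = \<alpha>\<^sup>2 + \<beta>\<^sup>2" and T0: "T > 0" using sq assms by auto
  have \<Phi>: "(\<Phi> has_real_derivative exp (- x\<^sup>2 / (2 * T)) / sqrt (2 * pi * T)) (at x)" for x
    using cdf_normal_has_derivative[of "sqrt T" x] T0
    by (simp add: \<Phi>_def normal_density_def)
  have d1: "((\<lambda>s. sqrt (T - s) / sqrt s) has_real_derivative - T / (2 * \<alpha> ^ 3 * \<beta>)) (at s)"
    using assms(3,4) pos unfolding T[symmetric]
    by (auto intro!: derivative_eq_intros simp: \<alpha>_def[symmetric] \<beta>_def[symmetric])
       (use T in \<open>simp add: field_simps power2_eq_square power3_eq_cube\<close>)
  have d2: "((\<lambda>s. sqrt s / sqrt (T - s)) has_real_derivative T / (2 * \<alpha> * \<beta> ^ 3)) (at s)"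
    using assms(3,4) pos unfolding T[symmetric]
    by (auto intro!: derivative_eq_intros simp: \<alpha>_def[symmetric] \<beta>_def[symmetric])
       (use T in \<open>simp add: field_simps power2_eq_square power3_eq_cube\<close>)
  define X where "X = exp (- a\<^sup>2 / (2 * s)) * exp (- b\<^sup>2 / (2 * (T - s)))"
  have half: "x / (2 * T) + y / (2 * T) = u / (2 * s) + v / (2 * (T - s))"
    if "x + y = T * (u / s + v / (T - s))" for x y u v
  proof -
    have "x / (2 * T) + y / (2 * T) = (u / s + v / (T - s)) / 2"
      unfolding add_divide_distrib[symmetric] that using T0 by simp
    then show ?thesis by (simp add: add_divide_distrib mult.commute)
  qed
  have e1: "exp (- (a + b)\<^sup>2 / (2 * T)) * exp (- (a * (\<beta> / \<alpha>) - b * (\<alpha> / \<beta>))\<^sup>2 / (2 * T)) = X"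
  proof -
    have "(a + b)\<^sup>2 + (a * (\<beta> / \<alpha>) - b * (\<alpha> / \<beta>))\<^sup>2 = T * (a\<^sup>2 / s + b\<^sup>2 / (T - s))"
      using pos unfolding sq[symmetric] T by (simp add: field_simps power2_eq_square)
    then have "(a + b)\<^sup>2 / (2 * T) + (a * (\<beta> / \<alpha>) - b * (\<alpha> / \<beta>))\<^sup>2 / (2 * T) = a\<^sup>2 / (2 * s) + b\<^sup>2 / (2 * (T - s))"
      by (rule half)
    then show ?thesis unfolding X_def exp_add[symmetric] by simp
  qed
  have e2: "exp (- (a - b)\<^sup>2 / (2 * T)) * exp (- (a * (\<beta> / \<alpha>) + b * (\<alpha> / \<beta>))\<^sup>2 / (2 * T)) = X"
  proof -
    have "(a - b)\<^sup>2 + (a * (\<beta> / \<alpha>) + b * (\<alpha> / \<beta>))\<^sup>2 = T * (a\<^sup>2 / s + b\<^sup>2 / (T - s))"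
      using pos unfolding sq[symmetric] T by (simp add: field_simps power2_eq_square)
    then have "(a - b)\<^sup>2 / (2 * T) + (a * (\<beta> / \<alpha>) + b * (\<alpha> / \<beta>))\<^sup>2 / (2 * T) = a\<^sup>2 / (2 * s) + b\<^sup>2 / (2 * (T - s))"
      by (rule half)
    then show ?thesis unfolding X_def exp_add[symmetric] by simp
  qed
  define w1 where "w1 = a * (- T / (2 * \<alpha> ^ 3 * \<beta>)) - b * (T / (2 * \<alpha> * \<beta> ^ 3))"
  define w2 where "w2 = a * (- T / (2 * \<alpha> ^ 3 * \<beta>)) + b * (T / (2 * \<alpha> * \<beta> ^ 3))"
  have lev: "levy a s * levy b (T - s) = a * b / (\<alpha> ^ 3 * \<beta> ^ 3) * X"
    using assms by (simp add: levy_def X_def \<alpha>_def \<beta>_def)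
  have D1: "((\<lambda>s. \<Phi> (a * (sqrt (T - s) / sqrt s) - b * (sqrt s / sqrt (T - s)))) has_real_derivative
     exp (- (a * (\<beta> / \<alpha>) - b * (\<alpha> / \<beta>))\<^sup>2 / (2 * T)) / sqrt (2 * pi * T) * w1) (at s)"
    unfolding w1_def \<alpha>_def \<beta>_def
    by (rule DERIV_chain2[OF \<Phi>] DERIV_diff DERIV_cmult d1[unfolded \<alpha>_def \<beta>_def] d2[unfolded \<alpha>_def \<beta>_def])+
  have D2: "((\<lambda>s. \<Phi> (a * (sqrt (T - s) / sqrt s) + b * (sqrt s / sqrt (T - s)))) has_real_derivative
     exp (- (a * (\<beta> / \<alpha>) + b * (\<alpha> / \<beta>))\<^sup>2 / (2 * T)) / sqrt (2 * pi * T) * w2) (at s)"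
    unfolding w2_def \<alpha>_def \<beta>_def
    by (rule DERIV_chain2[OF \<Phi>] DERIV_add DERIV_cmult d1[unfolded \<alpha>_def \<beta>_def] d2[unfolded \<alpha>_def \<beta>_def])+
  have sT: "sqrt (2 * pi * T) > 0" using T0 by simp
  have fin: "- (R / T\<^sup>2) * ((a + b) * E1 * (F1 / R * w1) + (b - a) * E2 * (F2 / R * w2))
      = a * b / (\<alpha> ^ 3 * \<beta> ^ 3) * X" if "E1 * F1 = X" "E2 * F2 = X" "R > 0" for E1 E2 F1 F2 R
  proof -
    have fac: "- (R / T\<^sup>2) * Y = - (1 / T\<^sup>2) * (R * Y)" for Y
      by simp
    have "R * ((a + b) * E1 * (F1 / R * w1) + (b - a) * E2 * (F2 / R * w2))
        = (a + b) * (E1 * F1) * w1 + (b - a) * (E2 * F2) * w2"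
      using that(3) by (simp add: field_simps)
    then have "- (R / T\<^sup>2) * ((a + b) * E1 * (F1 / R * w1) + (b - a) * E2 * (F2 / R * w2))
        = - (1 / T\<^sup>2) * ((a + b) * (E1 * F1) * w1 + (b - a) * (E2 * F2) * w2)"
      unfolding fac by simp
    also have "\<dots> = - (1 / T\<^sup>2) * X * ((a + b) * w1 + (b - a) * w2)"
      unfolding that(1,2) by (simp add: algebra_simps add_divide_distrib)
    \<comment> \<open>The weights a + b and b - a are such that the terms in a^2 and b^2 cancel and
      only those in a * b remain.\<close>
    also have "(a + b) * w1 + (b - a) * w2 = - a * b * T * (1 / (\<alpha> ^ 3 * \<beta>) + 1 / (\<alpha> * \<beta> ^ 3))"
      unfolding w1_def w2_def using pos by (simp add: field_simps)
    also have "1 / (\<alpha> ^ 3 * \<beta>) + 1 / (\<alpha> * \<beta> ^ 3) = T / (\<alpha> ^ 3 * \<beta> ^ 3)"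
      using pos unfolding T by (simp add: field_simps power2_eq_square power3_eq_cube)
    finally show ?thesis using T0 by (simp add: power2_eq_square)
  qed
  show ?thesis
    unfolding lev fin[OF e1 e2 sT, symmetric]
    by (rule DERIV_cmult DERIV_add D1 D2)+
qed

text \<open>In the antiderivative, \<open>w1\<close> runs from +\<infinity> to -\<infinity> on (0,
  T), while \<open>w2\<close> tends to +\<infinity> at both ends. The term with \<open>w2\<close>
  therefore has the same limit at both ends and drops out, leaving the one with a + b.\<close>

lemma nn_integral_levy_convolution:
  fixes a b T :: real
  assumes "a > 0" "b > 0" "T > 0"
  shows "(\<integral>\<^sup>+s. ennreal (levy a s * levy b (T - s)) \<partial>lborel) = ennreal (sqrt (2 * pi) * levy (a + b) T)"
proof -
  define \<Phi> where "\<Phi> = cdf (density lborel (normal_density 0 (sqrt T)))"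
  interpret prob_space "density lborel (normal_density 0 (sqrt T))"
    by (rule prob_space_normal_density) (use assms in auto)
  interpret real_distribution "density lborel (normal_density 0 (sqrt T))" by standard auto
  define w1 w2 where "w1 = (\<lambda>s. a * (sqrt (T - s) / sqrt s) - b * (sqrt s / sqrt (T - s)))"
    and "w2 = (\<lambda>s. a * (sqrt (T - s) / sqrt s) + b * (sqrt s / sqrt (T - s)))"
  define c1 c2 where "c1 = (a + b) * exp (- (a + b)\<^sup>2 / (2 * T))"
    and "c2 = (b - a) * exp (- (a - b)\<^sup>2 / (2 * T))"
  define F where "F = (\<lambda>s. - (sqrt (2 * pi * T) / T\<^sup>2) * (c1 * \<Phi> (w1 s) + c2 * \<Phi> (w2 s)))"
  have F: "(F has_real_derivative levy a s * levy b (T - s)) (at s)" if "0 < s" "s < T" for s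
    using levy_antiderivative[OF assms(1,2) that]
    by (simp add: F_def \<Phi>_def w1_def w2_def c1_def c2_def)
  have top: "(\<Phi> \<longlongrightarrow> 1) at_top" and bot: "(\<Phi> \<longlongrightarrow> 0) at_bot"
    unfolding \<Phi>_def by (rule cdf_lim_at_top_prob cdf_lim_at_bot)+
  have w1_0: "filterlim w1 at_top (at_right 0)" and w2_0: "filterlim w2 at_top (at_right 0)"
    and w1_T: "filterlim w1 at_bot (at_left T)" and w2_T: "filterlim w2 at_top (at_left T)"
    using assms unfolding w1_def w2_def by real_asymp+
  have A: "((F \<circ> real_of_ereal) \<longlongrightarrow> - (sqrt (2 * pi * T) / T\<^sup>2) * (c1 * 1 + c2 * 1)) (at_right (ereal 0))"
    unfolding ereal_tendsto_simps F_def
    by (intro tendsto_intros filterlim_compose[OF top] w1_0 w2_0)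
  have B: "((F \<circ> real_of_ereal) \<longlongrightarrow> - (sqrt (2 * pi * T) / T\<^sup>2) * (c1 * 0 + c2 * 1)) (at_left (ereal T))"
    unfolding ereal_tendsto_simps F_def
    by (intro tendsto_intros filterlim_compose[OF top] filterlim_compose[OF bot] w1_T w2_T)
  have cont: "isCont (\<lambda>s. levy a s * levy b (T - s)) s" if "0 < s" "s < T" for s
  proof -
    have "isCont (\<lambda>s. (a / sqrt s ^ 3 * exp (- a\<^sup>2 / (2 * s))) *
        (b / sqrt (T - s) ^ 3 * exp (- b\<^sup>2 / (2 * (T - s))))) s"
      using that by (intro continuous_intros) auto
    moreover have "\<forall>\<^sub>F s in nhds s. (a / sqrt s ^ 3 * exp (- a\<^sup>2 / (2 * s))) *
        (b / sqrt (T - s) ^ 3 * exp (- b\<^sup>2 / (2 * (T - s)))) = levy a s * levy b (T - s)"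
      using eventually_nhds_in_open[of "{0<..<T}" s] that
      by (auto elim!: eventually_mono simp: levy_def)
    ultimately show ?thesis using isCont_cong by fastforce
  qed
  note FTC = interval_integral_FTC_nonneg[where a = "ereal 0" and b = "ereal T" and F = F
      and f = "\<lambda>s. levy a s * levy b (T - s)", OF _ _ _ _ A B]
  have int: "set_integrable lborel {0<..<T} (\<lambda>s. levy a s * levy b (T - s))"
    using FTC(1) assms F cont by simp
  have val: "(LBINT s:{0<..<T}. levy a s * levy b (T - s)) = sqrt (2 * pi * T) / T\<^sup>2 * c1"
    using FTC(2) assms F cont
    by (simp add: interval_lebesgue_integral_def algebra_simps add_divide_distrib)
  have "(\<integral>\<^sup>+s. ennreal (levy a s * levy b (T - s)) \<partial>lborel)
      = (\<integral>\<^sup>+s. ennreal (indicator {0<..<T} s *\<^sub>R (levy a s * levy b (T - s))) \<partial>lborel)"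
    by (intro nn_integral_cong) (auto simp: indicator_def levy_def)
  also have "\<dots> = ennreal (sqrt (2 * pi * T) / T\<^sup>2 * c1)"
    using int val assms
    by (subst nn_integral_eq_integral) (auto simp: set_integrable_def set_lebesgue_integral_def)
  also have "sqrt (2 * pi * T) / T\<^sup>2 * c1 = sqrt (2 * pi) * levy (a + b) T"
  proof -
    have "sqrt T / T\<^sup>2 = 1 / sqrt T ^ 3"
      using assms(3) by (simp add: field_simps power2_eq_square power3_eq_cube)
    then show ?thesis using assms
      by (simp add: levy_def c1_def real_sqrt_mult field_simps)
  qed
  finally show ?thesis .
qed

section \<open>Gaussian subordination of the Poisson kernel\<close>

lemma sqrt_power_eq_powr: "x > 0 \<Longrightarrow> sqrt x ^ k = x powr (real k / 2)"
  by (subst powr_half_sqrt[symmetric]) (auto simp: powr_power)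

definition gauss :: "real \<Rightarrow> 'a::euclidean_space \<Rightarrow> real" where
  "gauss s \<eta> = (2 * pi * s) powr (- (real DIM('a) / 2)) * exp (- (norm \<eta>)\<^sup>2 / (2 * s))"

lemma gauss_nonneg [simp]: "gauss s \<eta> \<ge> 0"
  by (simp add: gauss_def)

lemma gauss_measurable [measurable (raw)]:
  fixes g :: "'b \<Rightarrow> 'a::euclidean_space"
  assumes [measurable]: "f \<in> borel_measurable M" "g \<in> borel_measurable M"
  shows "(\<lambda>x. gauss (f x) (g x)) \<in> borel_measurable M"
  unfolding gauss_def by measurable

text \<open>Reduces convolution and total mass to the one-dimensional normal density, one coordinate
  at a time.\<close>

lemma gauss_eq_prod:
  fixes \<eta> :: "'a::euclidean_space"
  assumes "s > 0"
  shows "gauss s \<eta> = (\<Prod>b\<in>Basis. normal_density 0 (sqrt s) (\<eta> \<bullet> b))"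
proof -
  have "(\<Prod>b\<in>(Basis::'a set). normal_density 0 (sqrt s) (\<eta> \<bullet> b)) =
      (1 / sqrt (2 * pi * s)) ^ DIM('a) * exp (\<Sum>b\<in>Basis. - (\<eta> \<bullet> b)\<^sup>2 / (2 * s))"
    using assms
    by (simp add: normal_density_def prod.distrib exp_sum power_one_over prod_dividef del: times_divide_eq_left)
  also have "(\<Sum>b\<in>Basis. - (\<eta> \<bullet> b)\<^sup>2 / (2 * s)) = - (norm \<eta>)\<^sup>2 / (2 * s)"
    unfolding power2_norm_eq_inner
    by (subst euclidean_inner) (simp add: sum_negf[symmetric] sum_divide_distrib power2_eq_square)
  also have "(1 / sqrt (2 * pi * s)) ^ DIM('a) = (2 * pi * s) powr (- (real DIM('a) / 2))"
    using assms by (simp add: power_one_over sqrt_power_eq_powr powr_minus_divide)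
  finally show ?thesis by (simp add: gauss_def)
qed

lemma nn_integral_gauss_convolution:
  fixes v :: "'a::euclidean_space"
  assumes "s > 0" "t > 0"
  shows "(\<integral>\<^sup>+\<xi>. ennreal (gauss s (v - \<xi>) * gauss t \<xi>) \<partial>lborel) = ennreal (gauss (s + t) v)"
proof -
  have "(\<integral>\<^sup>+\<xi>. ennreal (gauss s (v - \<xi>) * gauss t \<xi>) \<partial>lborel)
      = (\<integral>\<^sup>+\<xi>. (\<Prod>b\<in>Basis. ennreal (normal_density 0 (sqrt s) (v \<bullet> b - \<xi> \<bullet> b) *
            normal_density 0 (sqrt t) (\<xi> \<bullet> b))) \<partial>lborel)"
    using assms
    by (simp add: gauss_eq_prod prod.distrib[symmetric] prod_ennreal inner_diff_left)
  also have "\<dots> = (\<Prod>b\<in>(Basis::'a set). \<integral>\<^sup>+x. ennreal (normal_density 0 (sqrt s) (v \<bullet> b - x) *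
            normal_density 0 (sqrt t) x) \<partial>lborel)"
    by (rule nn_integral_lborel_prod) auto
  also have "\<dots> = (\<Prod>b\<in>(Basis::'a set). ennreal (normal_density 0 (sqrt (s + t)) (v \<bullet> b)))"
    using conv_normal_density_zero_mean[of "sqrt s" "sqrt t"] assms
    by (intro prod.cong refl) (simp add: fun_eq_iff)
  also have "\<dots> = ennreal (gauss (s + t) v)"
    using assms by (simp add: gauss_eq_prod prod_ennreal)
  finally show ?thesis .
qed

lemma nn_integral_gauss:
  fixes v :: "'a::euclidean_space"
  assumes "s > 0"
  shows "(\<integral>\<^sup>+\<xi>. ennreal (gauss s (v - \<xi>)) \<partial>lborel) = 1"
proof -
  have "(\<integral>\<^sup>+\<xi>. ennreal (gauss s (v - \<xi>)) \<partial>lborel)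
      = (\<integral>\<^sup>+\<xi>. (\<Prod>b\<in>Basis. ennreal (normal_density (v \<bullet> b) (sqrt s) (\<xi> \<bullet> b))) \<partial>lborel)"
    using assms
    by (simp add: gauss_eq_prod prod_ennreal inner_diff_left normal_density_def power2_commute)
  also have "\<dots> = (\<Prod>b\<in>(Basis::'a set). \<integral>\<^sup>+x. ennreal (normal_density (v \<bullet> b) (sqrt s) x) \<partial>lborel)"
    by (rule nn_integral_lborel_prod) auto
  also have "\<dots> = 1"
    using assms by (simp add: nn_integral_eq_integral)
  finally show ?thesis .
qed

text \<open>Left unnormalised: the Poisson kernel of the half space is 2 / (n * omega n) times this.
  The mass is carried along as \<open>poisson_mass\<close>.\<close>

definition poisson :: "'a::euclidean_space \<times> real \<Rightarrow> real" where
  "poisson x = snd x / norm x ^ DIM('a \<times> real)"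

text \<open>The normalisation of \<open>gauss\<close> times the factor that
  \<open>nn_integral_inverse_gamma\<close> produces for q = n / 2. Its exact value is what makes the
  mass equal to n * omega n / 2.\<close>

definition subord_const :: "'a::euclidean_space itself \<Rightarrow> real" where
  "subord_const _ = (2 * pi) powr (- (real DIM('a) / 2)) *
     (Gamma (real DIM('a \<times> real) / 2) * 2 powr (real DIM('a \<times> real) / 2))"

lemma subord_const_pos: "subord_const TYPE('a::euclidean_space) > 0"
  by (simp add: subord_const_def Gamma_real_pos)

text \<open>The exponents of weight and Gaussian add up to - A / s with A = (|\<eta>|^2 + a^2) / 2,
  and the powers to s^(- n / 2 - 1) because n = DIM('a) + 1. So the integral is of inverse gamma
  type and equals a constant times a * A^(- n / 2).\<close>

lemma poisson_subordination:
  fixes \<eta> :: "'a::euclidean_space"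
  assumes "a > 0"
  shows "(\<integral>\<^sup>+s. ennreal (levy a s * gauss s \<eta>) \<partial>lborel) = ennreal (subord_const TYPE('a) * poisson (\<eta>, a))"
proof -
  let ?d = "real DIM('a)" and ?n = "real DIM('a \<times> real)"
  let ?A = "((norm \<eta>)\<^sup>2 + a\<^sup>2) / 2"
  have A: "?A > 0" using assms by (simp add: add_nonneg_pos)
  have pw: "a / sqrt s ^ 3 * (2 * pi * s) powr (- (?d / 2)) =
      a * (2 * pi) powr (- (?d / 2)) * s powr (- (?n / 2) - 1)" if "s > 0" for s
  proof -
    have h: "1 / sqrt s ^ 3 = s powr (- (3 / 2))"
      using that sqrt_power_eq_powr[of s 3] by (simp add: powr_minus_divide)
    have e: "- (3 / 2) + - (?d / 2) = - (?n / 2) - 1"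
      by (simp add: add_divide_distrib)
    have "a / sqrt s ^ 3 * (2 * pi * s) powr (- (?d / 2)) =
        a * (2 * pi) powr (- (?d / 2)) * (1 / sqrt s ^ 3 * s powr (- (?d / 2)))"
      using that by (simp add: powr_mult)
    also have "1 / sqrt s ^ 3 * s powr (- (?d / 2)) = s powr (- (?n / 2) - 1)"
      unfolding h powr_add[symmetric] e ..
    finally show ?thesis .
  qed
  have "(\<integral>\<^sup>+s. ennreal (levy a s * gauss s \<eta>) \<partial>lborel) =
      (\<integral>\<^sup>+s. ennreal (a * (2 * pi) powr (- (?d / 2))) *
         ennreal (indicator {0<..} s * (s powr (- (?n / 2) - 1) * exp (- ?A / s))) \<partial>lborel)"
  proof (intro nn_integral_cong)
    fix s :: real
    show "ennreal (levy a s * gauss s \<eta>) = ennreal (a * (2 * pi) powr (- (?d / 2))) *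
         ennreal (indicator {0<..} s * (s powr (- (?n / 2) - 1) * exp (- ?A / s)))"
    proof (cases "s > 0")
      case True
      have "levy a s * gauss s \<eta> = (a / sqrt s ^ 3 * (2 * pi * s) powr (- (?d / 2))) *
          (exp (- a\<^sup>2 / (2 * s)) * exp (- (norm \<eta>)\<^sup>2 / (2 * s)))"
        using True by (simp add: levy_def gauss_def)
      also have "exp (- a\<^sup>2 / (2 * s)) * exp (- (norm \<eta>)\<^sup>2 / (2 * s)) = exp (- ?A / s)"
        using True unfolding exp_add[symmetric] by (simp add: field_simps)
      also note pw[OF True]
      finally show ?thesis
        using True assms by (simp add: ennreal_mult'[symmetric] mult.assoc)
    qed (simp add: levy_def)
  qed
  also have "\<dots> = ennreal (a * (2 * pi) powr (- (?d / 2))) *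
      (\<integral>\<^sup>+s. ennreal (indicator {0<..} s * (s powr (- (?n / 2) - 1) * exp (- ?A / s))) \<partial>lborel)"
    by (rule nn_integral_cmult) measurable
  also have "(\<integral>\<^sup>+s. ennreal (indicator {0<..} s * (s powr (- (?n / 2) - 1) * exp (- ?A / s))) \<partial>lborel)
      = ennreal (Gamma (?n / 2) * ?A powr (- (?n / 2)))"
    by (rule nn_integral_inverse_gamma[OF _ A]) simp
  also have "ennreal (a * (2 * pi) powr (- (?d / 2))) * ennreal (Gamma (?n / 2) * ?A powr (- (?n / 2)))
      = ennreal (subord_const TYPE('a) * poisson (\<eta>, a))"
  proof -
    have "norm (\<eta>, a) ^ DIM('a \<times> real) = ((norm \<eta>)\<^sup>2 + a\<^sup>2) powr (?n / 2)"
      using A unfolding norm_Pair by (subst sqrt_power_eq_powr) auto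
    moreover have "?A powr (- (?n / 2)) = 2 powr (?n / 2) / ((norm \<eta>)\<^sup>2 + a\<^sup>2) powr (?n / 2)"
      by (simp only: powr_minus_divide powr_divide) simp
    ultimately have "a * (2 * pi) powr (- (?d / 2)) * (Gamma (?n / 2) * ?A powr (- (?n / 2)))
        = subord_const TYPE('a) * poisson (\<eta>, a)"
      by (simp add: subord_const_def poisson_def del: DIM_prod)
    then show ?thesis
      using assms by (metis ennreal_mult' mult_nonneg_nonneg less_imp_le powr_ge_zero)
  qed
  finally show ?thesis .
qed

lemma poisson_measurable [measurable]: "poisson \<in> borel_measurable borel"
proof -
  have [measurable]: "(snd :: 'a \<times> real \<Rightarrow> real) \<in> borel_measurable borel"
    by (intro borel_measurable_continuous_onI continuous_intros)
  show ?thesis unfolding poisson_def by measurable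
qed

lemma poisson_nonneg: "snd x \<ge> 0 \<Longrightarrow> poisson x \<ge> 0"
  by (simp add: poisson_def)

text \<open>Both kernels are written as mixtures over s and t. Tonelli brings the \<xi>-integral
  inside, where the Gaussians convolve to variance s + t; with T = s + t the remaining integral in s
  is a convolution of Levy weights. Two factors \<open>subord_const\<close> go in and one comes out,
  which explains the constant.\<close>

lemma nn_integral_poisson_semigroup:
  fixes v :: "'a::euclidean_space"
  assumes "a > 0" "b > 0"
  shows "(\<integral>\<^sup>+\<xi>. ennreal (poisson (v - \<xi>, a) * poisson (\<xi>, b)) \<partial>lborel)
    = ennreal (sqrt (2 * pi) / subord_const TYPE('a) * poisson (v, a + b))"
proof -
  let ?C = "subord_const TYPE('a)"
  have C: "?C > 0" by (rule subord_const_pos)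
  let ?G = "\<lambda>s (x::'a). ennreal (gauss s x)" and ?L = "\<lambda>a s. ennreal (levy a s)"
  have sub: "ennreal (?C * poisson (x, c)) = (\<integral>\<^sup>+s. ?L c s * ?G s x \<partial>lborel)" if "c > 0" for c and x :: 'a
    using poisson_subordination[OF that, of x] that by (simp add: ennreal_mult')
  have "ennreal (?C\<^sup>2) * (\<integral>\<^sup>+\<xi>. ennreal (poisson (v - \<xi>, a) * poisson (\<xi>, b)) \<partial>lborel)
      = (\<integral>\<^sup>+\<xi>. ennreal (?C * poisson (v - \<xi>, a)) * ennreal (?C * poisson (\<xi>, b)) \<partial>lborel)"
    using C assms
    by (subst nn_integral_cmult[symmetric])
       (auto intro!: nn_integral_cong simp: ennreal_mult'[symmetric] poisson_nonneg power2_eq_square mult_ac)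
  also have "\<dots> = (\<integral>\<^sup>+\<xi>. \<integral>\<^sup>+s. \<integral>\<^sup>+t. (?L a s * ?G s (v - \<xi>)) * (?L b t * ?G t \<xi>) \<partial>lborel \<partial>lborel \<partial>lborel)"
    unfolding sub[OF assms(1)] sub[OF assms(2)]
    by (intro nn_integral_cong, subst nn_integral_multc[symmetric], simp)
       (intro nn_integral_cong, subst nn_integral_cmult[symmetric], auto)
  also have "\<dots> = (\<integral>\<^sup>+s. \<integral>\<^sup>+\<xi>. \<integral>\<^sup>+t. (?L a s * ?G s (v - \<xi>)) * (?L b t * ?G t \<xi>) \<partial>lborel \<partial>lborel \<partial>lborel)"
    by (rule lborel_pair.Fubini') measurable
  also have "\<dots> = (\<integral>\<^sup>+s. \<integral>\<^sup>+t. \<integral>\<^sup>+\<xi>. (?L a s * ?G s (v - \<xi>)) * (?L b t * ?G t \<xi>) \<partial>lborel \<partial>lborel \<partial>lborel)"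
    by (intro nn_integral_cong lborel_pair.Fubini') measurable
  also have "\<dots> = (\<integral>\<^sup>+s. \<integral>\<^sup>+t. ?L a s * ?L b t * ?G (s + t) v \<partial>lborel \<partial>lborel)"
  proof (intro nn_integral_cong)
    fix s t :: real
    show "(\<integral>\<^sup>+\<xi>. (?L a s * ?G s (v - \<xi>)) * (?L b t * ?G t \<xi>) \<partial>lborel) = ?L a s * ?L b t * ?G (s + t) v"
    proof (cases "s > 0 \<and> t > 0")
      case True
      have "(\<integral>\<^sup>+\<xi>. (?L a s * ?G s (v - \<xi>)) * (?L b t * ?G t \<xi>) \<partial>lborel)
          = (\<integral>\<^sup>+\<xi>. (?L a s * ?L b t) * ennreal (gauss s (v - \<xi>) * gauss t \<xi>) \<partial>lborel)"
        by (intro nn_integral_cong) (simp add: ennreal_mult' mult_ac)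
      then show ?thesis
        using True by (simp add: nn_integral_cmult nn_integral_gauss_convolution)
    qed (auto simp: levy_def)
  qed
  also have "\<dots> = (\<integral>\<^sup>+s. \<integral>\<^sup>+T. ?L a s * ?L b (T - s) * ?G T v \<partial>lborel \<partial>lborel)"
  proof (rule nn_integral_cong)
    fix s :: real
    show "(\<integral>\<^sup>+t. ?L a s * ?L b t * ?G (s + t) v \<partial>lborel) = (\<integral>\<^sup>+T. ?L a s * ?L b (T - s) * ?G T v \<partial>lborel)"
      by (subst nn_integral_real_affine[where c = 1 and t = s]) auto
  qed
  also have "\<dots> = (\<integral>\<^sup>+T. \<integral>\<^sup>+s. ?L a s * ?L b (T - s) * ?G T v \<partial>lborel \<partial>lborel)"
    by (rule lborel_pair.Fubini') measurable
  also have "\<dots> = (\<integral>\<^sup>+T. ennreal (sqrt (2 * pi)) * (?L (a + b) T * ?G T v) \<partial>lborel)"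
  proof (intro nn_integral_cong)
    fix T :: real
    have *: "(\<integral>\<^sup>+s. ?L a s * ?L b (T - s) * ?G T v \<partial>lborel) =
        (\<integral>\<^sup>+s. ennreal (levy a s * levy b (T - s)) \<partial>lborel) * ?G T v"
      using assms by (subst nn_integral_multc[symmetric]) (auto simp: ennreal_mult')
    show "(\<integral>\<^sup>+s. ?L a s * ?L b (T - s) * ?G T v \<partial>lborel) = ennreal (sqrt (2 * pi)) * (?L (a + b) T * ?G T v)"
    proof (cases "T > 0")
      case True
      have "(\<integral>\<^sup>+s. ennreal (levy a s * levy b (T - s)) \<partial>lborel)
          = ennreal (sqrt (2 * pi)) * ennreal (levy (a + b) T)"
        unfolding nn_integral_levy_convolution[OF assms True] by (rule ennreal_mult') simp
      then show ?thesis
        unfolding * by (simp add: mult.assoc)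
    next
      case False
      then have z: "(\<lambda>s. ennreal (levy a s * levy b (T - s))) = (\<lambda>_. 0)"
        by (auto simp: levy_def)
      moreover have "levy (a + b) T = 0" using False by (simp add: levy_def)
      ultimately show ?thesis unfolding * z by simp
    qed
  qed
  also have "\<dots> = ennreal (sqrt (2 * pi)) * ennreal (?C * poisson (v, a + b))"
    using assms by (simp add: nn_integral_cmult sub)
  also have "\<dots> = ennreal (?C\<^sup>2) * ennreal (sqrt (2 * pi) / ?C * poisson (v, a + b))"
    using C by (simp add: ennreal_mult'[symmetric] power2_eq_square mult.left_commute)
  finally show ?thesis
    using C by (simp add: ennreal_mult_cancel_left)
qed

text \<open>The Gaussians have mass one, so only the Levy weight is integrated: an inverse gamma
  integral with q = 1 / 2 and A = a^2 / 2, in which a cancels.\<close>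

lemma nn_integral_poisson:
  fixes v :: "'a::euclidean_space"
  assumes "a > 0"
  shows "(\<integral>\<^sup>+\<xi>. ennreal (poisson (v - \<xi>, a)) \<partial>lborel) = ennreal (sqrt (2 * pi) / subord_const TYPE('a))"
proof -
  let ?C = "subord_const TYPE('a)"
  have C: "?C > 0" by (rule subord_const_pos)
  have "ennreal ?C * (\<integral>\<^sup>+\<xi>. ennreal (poisson (v - \<xi>, a)) \<partial>lborel)
      = (\<integral>\<^sup>+\<xi>. \<integral>\<^sup>+s. ennreal (levy a s) * ennreal (gauss s (v - \<xi>)) \<partial>lborel \<partial>lborel)"
    using C assms
    by (subst nn_integral_cmult[symmetric])
       (auto intro!: nn_integral_cong simp: ennreal_mult'[symmetric] poisson_subordination)
  also have "\<dots> = (\<integral>\<^sup>+s. \<integral>\<^sup>+\<xi>. ennreal (levy a s) * ennreal (gauss s (v - \<xi>)) \<partial>lborel \<partial>lborel)"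
    by (rule lborel_pair.Fubini') measurable
  also have "\<dots> = (\<integral>\<^sup>+s. ennreal a * ennreal (indicator {0<..} s * (s powr (- (1 / 2) - 1) * exp (- (a\<^sup>2 / 2) / s))) \<partial>lborel)"
  proof (intro nn_integral_cong)
    fix s :: real
    show "(\<integral>\<^sup>+\<xi>. ennreal (levy a s) * ennreal (gauss s (v - \<xi>)) \<partial>lborel) =
        ennreal a * ennreal (indicator {0<..} s * (s powr (- (1 / 2) - 1) * exp (- (a\<^sup>2 / 2) / s)))"
    proof (cases "s > 0")
      case True
      have "levy a s = a * (s powr (- (1 / 2) - 1) * exp (- (a\<^sup>2 / 2) / s))"
        using True sqrt_power_eq_powr[of s 3] by (simp add: levy_def powr_minus_divide)
      then have "ennreal (levy a s) = ennreal a * ennreal (s powr (- (1 / 2) - 1) * exp (- (a\<^sup>2 / 2) / s))"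
        using assms by (simp only: ennreal_mult')
      moreover have "(\<integral>\<^sup>+\<xi>. ennreal (levy a s) * ennreal (gauss s (v - \<xi>)) \<partial>lborel) = ennreal (levy a s)"
        using True by (simp add: nn_integral_cmult nn_integral_gauss)
      ultimately show ?thesis
        using True by simp
    qed (simp add: levy_def)
  qed
  also have "\<dots> = ennreal a *
      (\<integral>\<^sup>+s. ennreal (indicator {0<..} s * (s powr (- (1 / 2) - 1) * exp (- (a\<^sup>2 / 2) / s))) \<partial>lborel)"
    by (rule nn_integral_cmult) measurable
  also have "(\<integral>\<^sup>+s. ennreal (indicator {0<..} s * (s powr (- (1 / 2) - 1) * exp (- (a\<^sup>2 / 2) / s))) \<partial>lborel)
      = ennreal (Gamma (1 / 2) * (a\<^sup>2 / 2) powr (- (1 / 2)))"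
    using assms by (intro nn_integral_inverse_gamma) auto
  also have "ennreal a * ennreal (Gamma (1 / 2) * (a\<^sup>2 / 2) powr (- (1 / 2))) = ennreal (sqrt (2 * pi))"
  proof -
    have "(a\<^sup>2 / 2) powr (- (1 / 2)) = sqrt 2 / a"
      using assms by (simp add: powr_minus_divide powr_half_sqrt real_sqrt_divide)
    then show ?thesis
      using assms by (simp add: ennreal_mult'[symmetric] Gamma_one_half_real real_sqrt_mult mult.commute)
  qed
  also have "\<dots> = ennreal ?C * ennreal (sqrt (2 * pi) / ?C)"
    using C by (simp add: ennreal_mult'[symmetric])
  finally show ?thesis
    using C by (simp add: ennreal_mult_cancel_left)
qed

text \<open>
  The Poisson kernel decays like \<open>|\<xi>|\<^sup>-\<^sup>n\<close>; the extra \<open>1/2\<close> makes room for boundary data of size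
  \<open>sqrt |\<xi>|\<close>, hence for the logarithm when \<open>n = 2\<close>.
\<close>

definition weight :: "'a::euclidean_space \<Rightarrow> real" where
  "weight \<xi> = (1 + norm \<xi>) powr (1 / 2 - real DIM('a \<times> real))"

text \<open>Subordination again, with a different weight: s^(- 1 / 4 - 1) * exp (- 1 / (2 * s)) is
  integrable on s > 0 and mixes Gaussians of mass one to a multiple of (1 + |\<xi>|^2)^(- q), q = 1
  / 4 + DIM('a) / 2. Since 2 * q = n - 1 / 2, this function dominates \<open>weight\<close>.\<close>

lemma integrable_weight: "integrable lborel (weight :: 'a::euclidean_space \<Rightarrow> real)"
proof -
  let ?d = "real DIM('a)"
  let ?q = "1 / 4 + ?d / 2"
  let ?h = "\<lambda>s::real. indicator {0<..} s * (s powr (- (1 / 4) - 1) * exp (- (1 / 2) / s))"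
  define c where "c = (2 * pi) powr (- (?d / 2)) * Gamma ?q * 2 powr ?q"
  have "?q > 0" by (simp add: add_pos_nonneg)
  then have "c > 0" by (simp add: c_def Gamma_real_pos)
  have sub: "(\<integral>\<^sup>+s. ennreal (?h s) * ennreal (gauss s \<xi>) \<partial>lborel) = ennreal (c * (1 + (norm \<xi>)\<^sup>2) powr (- ?q))" for \<xi> :: 'a
  proof -
    let ?A = "(1 + (norm \<xi>)\<^sup>2) / 2"
    have A: "?A > 0" by (simp add: add_pos_nonneg)
    have "(\<integral>\<^sup>+s. ennreal (?h s) * ennreal (gauss s \<xi>) \<partial>lborel) =
        (\<integral>\<^sup>+s. ennreal ((2 * pi) powr (- (?d / 2))) *
           ennreal (indicator {0<..} s * (s powr (- ?q - 1) * exp (- ?A / s))) \<partial>lborel)"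
    proof (intro nn_integral_cong)
      fix s :: real
      show "ennreal (?h s) * ennreal (gauss s \<xi>) = ennreal ((2 * pi) powr (- (?d / 2))) *
           ennreal (indicator {0<..} s * (s powr (- ?q - 1) * exp (- ?A / s)))"
      proof (cases "s > 0")
        case True
        have "?h s * gauss s \<xi> = (2 * pi) powr (- (?d / 2)) * (s powr (- (1 / 4) - 1) * s powr (- (?d / 2))) *
            (exp (- (1 / 2) / s) * exp (- (norm \<xi>)\<^sup>2 / (2 * s)))"
          using True by (simp add: gauss_def powr_mult)
        also have "s powr (- (1 / 4) - 1) * s powr (- (?d / 2)) = s powr (- ?q - 1)"
          unfolding powr_add[symmetric] by (rule arg_cong[of _ _ "(powr) s"]) simp
        also have "exp (- (1 / 2) / s) * exp (- (norm \<xi>)\<^sup>2 / (2 * s)) = exp (- ?A / s)"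
          using True unfolding exp_add[symmetric] by (simp add: field_simps)
        finally show ?thesis
          using True by (simp add: ennreal_mult'[symmetric] mult.assoc)
      qed simp
    qed
    also have "\<dots> = ennreal ((2 * pi) powr (- (?d / 2))) *
        (\<integral>\<^sup>+s. ennreal (indicator {0<..} s * (s powr (- ?q - 1) * exp (- ?A / s))) \<partial>lborel)"
      by (rule nn_integral_cmult) measurable
    also have "(\<integral>\<^sup>+s. ennreal (indicator {0<..} s * (s powr (- ?q - 1) * exp (- ?A / s))) \<partial>lborel)
        = ennreal (Gamma ?q * ?A powr (- ?q))"
      by (rule nn_integral_inverse_gamma[OF \<open>?q > 0\<close> A])
    also have "ennreal ((2 * pi) powr (- (?d / 2))) * ennreal (Gamma ?q * ?A powr (- ?q))
        = ennreal (c * (1 + (norm \<xi>)\<^sup>2) powr (- ?q))"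
    proof -
      have "?A powr (- ?q) = 2 powr ?q * (1 + (norm \<xi>)\<^sup>2) powr (- ?q)"
        by (simp only: powr_minus_divide powr_divide) simp
      then show ?thesis
        unfolding c_def by (subst ennreal_mult'[symmetric]) (auto simp: mult_ac)
    qed
    finally show ?thesis .
  qed
  have "ennreal c * (\<integral>\<^sup>+\<xi>. ennreal ((1 + (norm \<xi>)\<^sup>2) powr (- ?q)) \<partial>(lborel :: 'a measure))
      = (\<integral>\<^sup>+\<xi>. \<integral>\<^sup>+s. ennreal (?h s) * ennreal (gauss s \<xi>) \<partial>lborel \<partial>(lborel :: 'a measure))"
    unfolding sub ennreal_mult'[OF less_imp_le[OF \<open>c > 0\<close>]]
    by (rule nn_integral_cmult[symmetric]) measurable
  also have "\<dots> = (\<integral>\<^sup>+s. \<integral>\<^sup>+\<xi>. ennreal (?h s) * ennreal (gauss s \<xi>) \<partial>(lborel :: 'a measure) \<partial>lborel)"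
    by (rule lborel_pair.Fubini') measurable
  also have "\<dots> = (\<integral>\<^sup>+s. ennreal (?h s) \<partial>lborel)"
  proof (intro nn_integral_cong)
    fix s :: real
    have "gauss s (- \<xi>) = gauss s \<xi>" for \<xi> :: 'a by (simp add: gauss_def)
    then show "(\<integral>\<^sup>+\<xi>. ennreal (?h s) * ennreal (gauss s \<xi>) \<partial>(lborel :: 'a measure)) = ennreal (?h s)"
      using nn_integral_gauss[of s "0 :: 'a"]
      by (cases "s > 0") (simp_all add: nn_integral_cmult)
  qed
  also have "\<dots> < \<infinity>"
    by (subst nn_integral_inverse_gamma) auto
  finally have fin: "(\<integral>\<^sup>+\<xi>. ennreal ((1 + (norm \<xi>)\<^sup>2) powr (- ?q)) \<partial>(lborel :: 'a measure)) < \<infinity>"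
    using \<open>c > 0\<close> by (auto simp: ennreal_mult_less_top)
  show ?thesis
  proof (rule Bochner_Integration.integrable_bound)
    show "integrable lborel (\<lambda>\<xi>::'a. (1 + (norm \<xi>)\<^sup>2) powr (- ?q))"
      using fin by (intro integrableI_nonneg) auto
    show "AE \<xi> in lborel. norm (weight \<xi> :: real) \<le> norm ((1 + (norm (\<xi> :: 'a))\<^sup>2) powr (- ?q))"
    proof (rule AE_I2)
      fix \<xi> :: 'a
      have "weight \<xi> = (1 + norm \<xi>) powr (2 * (- ?q))"
        by (simp add: weight_def add_divide_distrib)
      also have "\<dots> = ((1 + norm \<xi>)\<^sup>2) powr (- ?q)"
        using powr_numeral[of "1 + norm \<xi>" "num.Bit0 num.One"]
        by (subst powr_powr[symmetric]) (simp add: add_pos_nonneg)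
      also have "\<dots> \<le> (1 + (norm \<xi>)\<^sup>2) powr (- ?q)"
        by (rule powr_mono2') (auto simp: power2_sum add_pos_nonneg)
      finally show "norm (weight \<xi> :: real) \<le> norm ((1 + (norm \<xi>)\<^sup>2) powr (- ?q))"
        by (simp add: weight_def)
    qed
  qed (simp add: weight_def[abs_def])
qed

text \<open>Dominated convergence for the difference quotients, which the mean value theorem bounds
  by \<open>g\<close>. It is run along arbitrary sequences tending to 0, and \<open>f' 0\<close> is
  measurable as a pointwise limit.\<close>

lemma has_real_derivative_integral:
  fixes f f' :: "real \<Rightarrow> 'b \<Rightarrow> real"
  assumes "e > 0"
    and int: "\<And>t. \<bar>t\<bar> < e \<Longrightarrow> integrable M (f t)"
    and der: "\<And>t \<xi>. \<bar>t\<bar> < e \<Longrightarrow> ((\<lambda>t. f t \<xi>) has_real_derivative f' t \<xi>) (at t)"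
    and bnd: "\<And>t \<xi>. \<bar>t\<bar> < e \<Longrightarrow> \<bar>f' t \<xi>\<bar> \<le> g \<xi>"
    and g: "integrable M g"
  shows "integrable M (f' 0)" "((\<lambda>t. \<integral>\<xi>. f t \<xi> \<partial>M) has_real_derivative (\<integral>\<xi>. f' 0 \<xi> \<partial>M)) (at 0)"
proof -
  have lip: "\<bar>f t \<xi> - f 0 \<xi>\<bar> \<le> g \<xi> * \<bar>t\<bar>" if "\<bar>t\<bar> < e" for t \<xi>
  proof -
    have "norm (f t \<xi> - f 0 \<xi>) \<le> g \<xi> * norm (t - 0)"
    proof (rule field_differentiable_bound[where S = "{-e<..<e}"])
      show "((\<lambda>t. f t \<xi>) has_real_derivative f' z \<xi>) (at z within {-e<..<e})"
        if "z \<in> {-e<..<e}" for z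
        using that der by (intro DERIV_subset[OF der]) auto
    qed (use that bnd \<open>e > 0\<close> in auto)
    then show ?thesis by simp
  qed
  have quot: "(\<lambda>t. (f t \<xi> - f 0 \<xi>) / t) \<midarrow>0\<rightarrow> f' 0 \<xi>" for \<xi>
    using der[of 0 \<xi>] \<open>e > 0\<close> by (simp add: DERIV_def)
  have dc: "integrable M (f' 0) \<and> (\<lambda>k. \<integral>\<xi>. (f (X k) \<xi> - f 0 \<xi>) / X k \<partial>M) \<longlonglongrightarrow> (\<integral>\<xi>. f' 0 \<xi> \<partial>M)"
    if X: "\<And>k. X k \<in> {-e<..<e} - {0}" "X \<longlonglongrightarrow> 0" for X :: "nat \<Rightarrow> real"
  proof -
    have X': "\<bar>X k\<bar> < e" "X k \<noteq> 0" for k using X(1)[of k] by auto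
    have fX[measurable]: "f (X k) \<in> borel_measurable M" for k using int[OF X'(1)] by simp
    have f0[measurable]: "f 0 \<in> borel_measurable M" using int[of 0] \<open>e > 0\<close> by simp
    have lim: "(\<lambda>k. (f (X k) \<xi> - f 0 \<xi>) / X k) \<longlonglongrightarrow> f' 0 \<xi>" for \<xi>
      using quot[of \<xi>] X unfolding tendsto_at_iff_sequentially comp_def by auto
    have meas: "f' 0 \<in> borel_measurable M"
      by (rule borel_measurable_LIMSEQ_metric[where f = "\<lambda>k \<xi>. (f (X k) \<xi> - f 0 \<xi>) / X k"])
         (use lim in auto)
    have b: "norm ((f (X k) \<xi> - f 0 \<xi>) / X k) \<le> g \<xi>" for k \<xi>
      using lip[OF X'(1), of k \<xi>] X'[of k] by (simp add: divide_le_eq)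
    show ?thesis
    proof
      show "integrable M (f' 0)"
        by (rule Bochner_Integration.integrable_dominated_convergence[OF meas _ g,
              of "\<lambda>k \<xi>. (f (X k) \<xi> - f 0 \<xi>) / X k"]) (use lim b in auto)
      show "(\<lambda>k. \<integral>\<xi>. (f (X k) \<xi> - f 0 \<xi>) / X k \<partial>M) \<longlonglongrightarrow> (\<integral>\<xi>. f' 0 \<xi> \<partial>M)"
        by (rule integral_dominated_convergence[OF meas _ g]) (use lim b in auto)
    qed
  qed
  \<comment> \<open>Some null sequence is needed to extract integrability of \<open>f' 0\<close>;
    the shift by 2 keeps even its first term strictly below e.\<close>
  have "(\<lambda>k. e / real (k + 2)) \<longlonglongrightarrow> 0"
    by real_asymp
  moreover have "e / real (k + 2) \<in> {-e<..<e} - {0}" for k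
  proof -
    have *: "v \<in> {-e<..<e} - {0}" if "0 < v" "v < e" for v
      using that by auto
    show ?thesis using \<open>e > 0\<close> by (intro *) (auto simp: divide_less_eq)
  qed
  ultimately show "integrable M (f' 0)"
    using dc[of "\<lambda>k. e / real (k + 2)"] by blast
  have "((\<lambda>t. ((\<integral>\<xi>. f t \<xi> \<partial>M) - (\<integral>\<xi>. f 0 \<xi> \<partial>M)) / t) \<longlongrightarrow> (\<integral>\<xi>. f' 0 \<xi> \<partial>M)) (at 0 within {-e<..<e})"
    unfolding tendsto_at_iff_sequentially
  proof (intro allI impI)
    fix X :: "nat \<Rightarrow> real"
    assume X: "\<forall>i. X i \<in> {-e<..<e} - {0}" "X \<longlonglongrightarrow> 0"
    have "integrable M (f (X k))" for k using X(1)[rule_format, of k] by (intro int) auto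
    moreover have "integrable M (f 0)" using int[of 0] \<open>e > 0\<close> by simp
    ultimately show "((\<lambda>t. ((\<integral>\<xi>. f t \<xi> \<partial>M) - (\<integral>\<xi>. f 0 \<xi> \<partial>M)) / t) \<circ> X) \<longlonglongrightarrow> (\<integral>\<xi>. f' 0 \<xi> \<partial>M)"
      using dc[of X] X by (simp add: comp_def)
  qed
  moreover have "at (0::real) within {-e<..<e} = at 0"
    using \<open>e > 0\<close> by (intro at_within_open) auto
  ultimately show "((\<lambda>t. \<integral>\<xi>. f t \<xi> \<partial>M) has_real_derivative (\<integral>\<xi>. f' 0 \<xi> \<partial>M)) (at 0)"
    by (simp add: DERIV_def)
qed

section \<open>The fundamental solution: gradient and growth\<close>

definition kap :: "nat \<Rightarrow> real" where
  "kap n = 1 / (2 * real n * omega n)"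

lemma omega_pos: "n > 0 \<Longrightarrow> omega n > 0"
  by (auto simp: omega_def intro!: divide_pos_pos mult_pos_pos Gamma_real_pos)

lemma kap_pos: "n > 0 \<Longrightarrow> kap n > 0"
  by (simp add: kap_def omega_pos)

lemma omega_2: "omega 2 = pi"
  by (simp add: omega_def Gamma_numeral)

lemma DIM_prod_real_ge_2: "DIM('a::euclidean_space \<times> real) \<ge> 2"
  by (simp add: Suc_le_eq)

definition radial :: "nat \<Rightarrow> real \<Rightarrow> real" where
  "radial n r = (if n = 2 then - (1 / (2 * pi)) * ln r
     else 1 / (real n * (real n - 2) * omega n) * r powr (2 - real n))"

lemma fund_sol_radial: "fund_sol (x :: 'a::euclidean_space \<times> real) = radial DIM('a \<times> real) (norm x)"
  by (simp add: fund_sol_def radial_def Let_def del: DIM_prod)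

text \<open>Written with \<open>kap\<close>, the logarithm for n = 2 and the power for n > 2 have
  the same derivative, so that both cases can be treated alike afterwards.\<close>

lemma DERIV_radial:
  assumes "n \<ge> 2" "r > 0"
  shows "(radial n has_real_derivative - 2 * kap n / r ^ (n - 1)) (at r)"
proof (cases "n = 2")
  case True
  then show ?thesis
    using assms unfolding radial_def kap_def
    by (auto intro!: derivative_eq_intros simp: omega_2 field_simps)
next
  case False
  have om: "omega n > 0" using assms by (simp add: omega_pos)
  have n: "real n > 2" using False assms by simp
  have A: "r powr (1 - real n) = 1 / r ^ (n - 1)"
    using assms powr_realpow[of r "n - 1"] powr_minus_divide[of r "real (n - 1)"]
    by (simp add: of_nat_diff)
  have "1 / (real n * c * omega n) * (- c * p) = - 2 * kap n * p" if "c \<noteq> 0" for c p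
    using that n om by (simp add: kap_def field_simps)
  from this[of "real n - 2" "r powr (1 - real n)"] n
  have B: "1 / (real n * (real n - 2) * omega n) * ((2 - real n) * r powr (1 - real n)) = - 2 * kap n * r powr (1 - real n)"
    by simp
  have "1 / (real n * (real n - 2) * omega n) * ((2 - real n) * r powr (1 - real n)) = - 2 * kap n / r ^ (n - 1)"
    using B unfolding A by simp
  moreover have "((\<lambda>r. 1 / (real n * (real n - 2) * omega n) * r powr (2 - real n)) has_real_derivative
      1 / (real n * (real n - 2) * omega n) * ((2 - real n) * r powr (1 - real n))) (at r)"
    using assms by (intro DERIV_cmult) (auto intro!: derivative_eq_intros)
  ultimately show ?thesis
    using False unfolding radial_def by simp
qed

text \<open>For t \<ge> r the modulus 2 * kap n / t^(n - 1) of the derivative is at most 2 * kap n /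
  (r^(n - 2) * t), the derivative of a multiple of \<open>ln\<close>. Hence both signs c = 1 and c =
  - 1 give a nondecreasing function.\<close>

lemma radial_diff_le:
  assumes "n \<ge> 2" "0 < r" "r \<le> s"
  shows "\<bar>radial n s - radial n r\<bar> \<le> 2 * kap n / r ^ (n - 2) * (ln s - ln r)"
proof -
  let ?g = "\<lambda>c t. c * radial n t + 2 * kap n / r ^ (n - 2) * ln t"
  have "?g c r \<le> ?g c s" if "\<bar>c\<bar> = 1" for c
  proof (rule DERIV_nonneg_imp_nondecreasing[OF assms(3)])
    fix t assume t: "r \<le> t" "t \<le> s"
    have "(?g c has_real_derivative c * (- 2 * kap n / t ^ (n - 1)) + 2 * kap n / r ^ (n - 2) * (1 / t)) (at t)"
      using t assms by (intro derivative_intros DERIV_cmult DERIV_radial DERIV_ln_divide) auto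
    moreover have "\<bar>c * (- 2 * kap n / t ^ (n - 1))\<bar> \<le> 2 * kap n / r ^ (n - 2) * (1 / t)"
    proof -
      have "n - 1 = Suc (n - 2)" using assms(1) by simp
      then have "\<bar>c * (- 2 * kap n / t ^ (n - 1))\<bar> = 2 * kap n / (t ^ (n - 2) * t)"
        using that t assms kap_pos[of n] by (simp add: abs_mult mult.commute)
      also have "\<dots> \<le> 2 * kap n / (r ^ (n - 2) * t)"
        using t assms kap_pos[of n]
        by (intro divide_left_mono mult_right_mono power_mono mult_pos_pos) auto
      finally show ?thesis by simp
    qed
    ultimately show "\<exists>y. (?g c has_real_derivative y) (at t) \<and> 0 \<le> y"
      by (auto intro!: exI[of _ "c * (- 2 * kap n / t ^ (n - 1)) + 2 * kap n / r ^ (n - 2) * (1 / t)"]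
          simp only: abs_le_iff)
  qed
  from this[of 1] this[of "-1"]
  have "radial n r + 2 * kap n / r ^ (n - 2) * ln r \<le> radial n s + 2 * kap n / r ^ (n - 2) * ln s"
    "- radial n r + 2 * kap n / r ^ (n - 2) * ln r \<le> - radial n s + 2 * kap n / r ^ (n - 2) * ln s"
    by simp_all
  then show ?thesis
    unfolding right_diff_distrib by linarith
qed

text \<open>Uses ln (1 + u) \<le> 2 * sqrt u, obtained from ln v \<le> v - 1 at v = sqrt (1 + u).
  The square root is a growth that \<open>weight\<close> can absorb, and for fixed L the bound tends
  to 0 as |x| grows, even when n = 2.\<close>

lemma fund_sol_diff_le:
  fixes x y :: "'a::euclidean_space \<times> real"
  assumes "0 < norm x" "norm x \<le> norm y" "norm y \<le> norm x + L"
  shows "\<bar>fund_sol y - fund_sol x\<bar>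
     \<le> 4 * kap DIM('a \<times> real) / norm x ^ (DIM('a \<times> real) - 2) * sqrt (L / norm x)"
proof -
  let ?n = "DIM('a \<times> real)"
  have L: "L \<ge> 0" using assms by linarith
  have "ln (norm y) - ln (norm x) = ln (norm y / norm x)"
    using assms by (subst ln_div) auto
  also have "\<dots> \<le> ln (1 + L / norm x)"
    using assms L by (subst ln_le_cancel_iff) (auto simp: field_simps intro: add_pos_nonneg add_nonneg_pos)
  also have "\<dots> = 2 * ln (sqrt (1 + L / norm x))"
    using L assms by (subst ln_sqrt) (auto simp: add_pos_nonneg)
  also have "\<dots> \<le> 2 * (sqrt (1 + L / norm x) - 1)"
    using L assms by (intro mult_left_mono ln_le_minus_one) (auto simp: add_pos_nonneg)
  also have "\<dots> \<le> 2 * sqrt (L / norm x)"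
    using sqrt_add_le_add_sqrt[of 1 "L / norm x"] L assms by simp
  finally have ln: "ln (norm y) - ln (norm x) \<le> 2 * sqrt (L / norm x)" .
  have "\<bar>fund_sol y - fund_sol x\<bar> \<le> 2 * kap ?n / norm x ^ (?n - 2) * (ln (norm y) - ln (norm x))"
    unfolding fund_sol_radial using assms DIM_prod_real_ge_2[where 'a='a]
    by (intro radial_diff_le) auto
  also have "\<dots> \<le> 2 * kap ?n / norm x ^ (?n - 2) * (2 * sqrt (L / norm x))"
    using ln kap_pos[of ?n] by (intro mult_left_mono) auto
  finally show ?thesis by simp
qed

text \<open>Up to the factor - 2 * kap n, the derivative of E in direction j. For j =
  \<open>e_n\<close> it is \<open>poisson\<close>, which links E to the semigroup.\<close>

definition riesz :: "'v::euclidean_space \<Rightarrow> 'v \<Rightarrow> real" where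
  "riesz j x = (x \<bullet> j) / norm x ^ DIM('v)"

lemma poisson_eq_riesz: "poisson x = riesz e_n x"
  by (simp add: poisson_def riesz_def inner_e_n del: DIM_prod)

lemma has_derivative_fund_sol:
  fixes x :: "'a::euclidean_space \<times> real"
  assumes "x \<noteq> 0"
  shows "(fund_sol has_derivative (\<lambda>h. - 2 * kap DIM('a \<times> real) * riesz h x)) (at x)"
proof -
  let ?n = "DIM('a \<times> real)"
  have n: "?n = Suc (?n - 1)" by simp
  have "(radial ?n has_derivative (\<lambda>h. (- 2 * kap ?n / norm x ^ (?n - 1)) * h)) (at (norm x))"
    using DERIV_radial[OF DIM_prod_real_ge_2[where 'a='a], of "norm x", unfolded has_field_derivative_def]
      assms by (simp only: zero_less_norm_iff not_False_eq_True simp_thms)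
  from has_derivative_compose[OF has_derivative_norm[OF assms] this]
  have "((\<lambda>x. radial ?n (norm x)) has_derivative (\<lambda>h. (- 2 * kap ?n / norm x ^ (?n - 1)) * (h \<bullet> sgn x))) (at x)" .
  moreover have "(- 2 * kap ?n / norm x ^ (?n - 1)) * (h \<bullet> sgn x) = - 2 * kap ?n * riesz h x" for h
  proof -
    have "norm x ^ ?n = norm x * norm x ^ (?n - 1)" by (subst n) simp
    then show ?thesis
      by (simp add: riesz_def sgn_div_norm inner_commute divide_inverse del: DIM_prod)
  qed
  moreover have "fund_sol = (\<lambda>x::'a \<times> real. radial ?n (norm x))"
    by (rule ext) (rule fund_sol_radial)
  ultimately show ?thesis by (simp del: DIM_prod)
qed

section \<open>Poisson integrals of the fundamental solution\<close>

definition poisson_mass :: "'a::euclidean_space itself \<Rightarrow> real" where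
  "poisson_mass T = sqrt (2 * pi) / subord_const T"

lemma poisson_mass_eq:
  "poisson_mass TYPE('a::euclidean_space) = real DIM('a \<times> real) * omega DIM('a \<times> real) / 2"
proof -
  let ?n = "real DIM('a \<times> real)"
  have G: "Gamma (?n / 2) > 0" by (rule Gamma_real_pos) simp
  have "sqrt (2 * pi) = (2 * pi) powr (1 / 2)" by (simp add: powr_half_sqrt)
  then have "poisson_mass TYPE('a) = (2 * pi) powr (1 / 2) * (2 * pi) powr (real DIM('a) / 2)
      / (Gamma (?n / 2) * 2 powr (?n / 2))"
    by (simp add: poisson_mass_def subord_const_def powr_minus_divide del: DIM_prod)
  also have "(2 * pi) powr (1 / 2) * (2 * pi) powr (real DIM('a) / 2) = (2 * pi) powr (?n / 2)"
    by (simp add: powr_add[symmetric] add_divide_distrib[symmetric])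
  also have "\<dots> = 2 powr (?n / 2) * pi powr (?n / 2)" by (rule powr_mult)
  finally show ?thesis using G by (simp add: omega_def)
qed

lemma poisson_mass_pos: "poisson_mass TYPE('a::euclidean_space) > 0"
  by (simp add: poisson_mass_def subord_const_pos)

lemma nn_integral_lborel_minus:
  fixes c :: "'a::euclidean_space"
  assumes [measurable]: "f \<in> borel_measurable borel"
  shows "(\<integral>\<^sup>+x. f (x - c) \<partial>lborel) = (\<integral>\<^sup>+x. f x \<partial>lborel)"
proof -
  have "(\<integral>\<^sup>+x. f x \<partial>lborel) = (\<integral>\<^sup>+x. f x \<partial>(distr lborel borel ((+) (- c))))"
    by (simp add: lborel_distr_plus)
  also have "\<dots> = (\<integral>\<^sup>+x. f (x - c) \<partial>lborel)"
    by (subst nn_integral_distr) auto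
  finally show ?thesis ..
qed

lemma has_bochner_integral_poisson:
  fixes x :: "'a::euclidean_space \<times> real"
  assumes "snd x > 0"
  shows "has_bochner_integral lborel (\<lambda>\<xi>. poisson (x - (\<xi>, 0))) (poisson_mass TYPE('a))"
proof (rule has_bochner_integral_nn_integral)
  have "x - (\<xi>, 0) = (fst x - \<xi>, snd x)" for \<xi> by (simp add: prod_eq_iff)
  then show "(\<integral>\<^sup>+\<xi>. ennreal (poisson (x - (\<xi>, 0))) \<partial>lborel) = ennreal (poisson_mass TYPE('a))"
    using nn_integral_poisson[OF assms, of "fst x"] by (simp add: poisson_mass_def)
qed (use assms poisson_mass_pos[where 'a='a] in \<open>auto intro!: poisson_nonneg\<close>)

lemma has_bochner_integral_poisson_semigroup:
  fixes x q :: "'a::euclidean_space \<times> real"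
  assumes "snd x > 0" "snd q < 0"
  shows "has_bochner_integral lborel (\<lambda>\<xi>. poisson (x - (\<xi>, 0)) * poisson ((\<xi>, 0) - q))
     (poisson_mass TYPE('a) * poisson (x - q))"
proof (rule has_bochner_integral_nn_integral)
  have 1: "x - (\<xi>, 0) = (fst x - fst q - (\<xi> - fst q), snd x)"
    and 2: "(\<xi>, 0) - q = (\<xi> - fst q, - snd q)" and 3: "x - q = (fst x - fst q, snd x + - snd q)"
    for \<xi> by (simp_all add: prod_eq_iff)
  have "(\<integral>\<^sup>+\<xi>. ennreal (poisson (x - (\<xi>, 0)) * poisson ((\<xi>, 0) - q)) \<partial>lborel)
      = (\<integral>\<^sup>+\<xi>. ennreal (poisson (fst x - fst q - \<xi>, snd x) * poisson (\<xi>, - snd q)) \<partial>lborel)"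
    unfolding 1 2 by (rule nn_integral_lborel_minus) measurable
  also have "\<dots> = ennreal (poisson_mass TYPE('a) * poisson (x - q))"
    using assms unfolding 3 poisson_mass_def by (intro nn_integral_poisson_semigroup) auto
  finally show "(\<integral>\<^sup>+\<xi>. ennreal (poisson (x - (\<xi>, 0)) * poisson ((\<xi>, 0) - q)) \<partial>lborel)
      = ennreal (poisson_mass TYPE('a) * poisson (x - q))" .
qed (use assms poisson_mass_pos[where 'a='a] in \<open>auto intro!: poisson_nonneg mult_nonneg_nonneg\<close>)

text \<open>The distance to (\<xi>, 0) is at least \<delta> = x_n / 2 and at least |\<xi>| - |x| -
  \<delta>. That this holds for all small h alike provides a single dominating function near x when
  boundary integrals are differentiated in x.\<close>

lemma half_space_norm_lower:
  fixes x :: "'a::euclidean_space \<times> real"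
  assumes "snd x > 0"
  obtains c where "c > 0"
    "\<And>h \<xi>. norm h \<le> snd x / 2 \<Longrightarrow> c * (1 + norm \<xi>) \<le> norm (x + h - (\<xi>, 0))"
proof
  define \<delta> where "\<delta> = snd x / 2"
  define A where "A = (1 + norm x + \<delta>) / \<delta> + 1"
  have \<delta>: "\<delta> > 0" using assms by (simp add: \<delta>_def)
  then have A: "A > 0" by (simp add: A_def add_pos_nonneg)
  then show "1 / A > 0" by simp
  fix h :: "'a \<times> real" and \<xi> :: 'a
  assume h: "norm h \<le> snd x / 2"
  let ?\<rho> = "norm (x + h - (\<xi>, 0))"
  have "snd x - norm h \<le> ?\<rho>"
  proof -
    have "x + h - (\<xi>, 0) = (fst x + fst h - \<xi>, snd x + snd h)" by (simp add: prod_eq_iff)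
    then show ?thesis
      using norm_snd_le[of "snd x + snd h" "fst x + fst h - \<xi>"] norm_snd_le[of "snd h" "fst h"]
      by simp
  qed
  then have 1: "\<delta> \<le> ?\<rho>" using h by (simp add: \<delta>_def)
  have "norm \<xi> = norm (x + h - (x + h - (\<xi>, 0)))" by (simp add: norm_Pair)
  also have "\<dots> \<le> norm (x + h) + ?\<rho>" by (rule norm_triangle_ineq4)
  also have "norm (x + h) \<le> norm x + \<delta>" using norm_triangle_ineq[of x h] h by (simp add: \<delta>_def)
  finally have "1 + norm \<xi> \<le> (1 + norm x + \<delta>) + ?\<rho>" by simp
  also have "1 + norm x + \<delta> \<le> (1 + norm x + \<delta>) / \<delta> * ?\<rho>"
  proof -
    have "1 \<le> ?\<rho> / \<delta>" using 1 \<delta> by simp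
    then show ?thesis
      using mult_left_mono[of 1 "?\<rho> / \<delta>" "1 + norm x + \<delta>"] \<delta> by simp
  qed
  finally have "1 + norm \<xi> \<le> A * ?\<rho>" by (simp add: A_def algebra_simps)
  then show "1 / A * (1 + norm \<xi>) \<le> ?\<rho>" using A by (simp add: field_simps)
qed

lemma weight_bound:
  fixes \<xi> :: "'a::euclidean_space"
  assumes "c > 0" "c * (1 + norm \<xi>) \<le> r" "\<bar>F\<bar> \<le> K * sqrt (1 + norm \<xi>)"
  shows "\<bar>F\<bar> / r ^ DIM('a \<times> real) \<le> K / c ^ DIM('a \<times> real) * weight \<xi>"
proof -
  let ?n = "DIM('a \<times> real)"
  have p: "1 + norm \<xi> > 0" by (simp add: add_pos_nonneg)
  have K: "0 \<le> K * sqrt (1 + norm \<xi>)" using assms(3) by linarith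
  have "\<bar>F\<bar> / r ^ ?n \<le> K * sqrt (1 + norm \<xi>) / (c * (1 + norm \<xi>)) ^ ?n"
    using assms p K by (intro frac_le power_mono zero_less_power mult_pos_pos) auto
  also have "\<dots> = K / c ^ ?n * (sqrt (1 + norm \<xi>) / (1 + norm \<xi>) ^ ?n)"
    by (simp add: power_mult_distrib del: DIM_prod)
  also have "sqrt (1 + norm \<xi>) / (1 + norm \<xi>) ^ ?n = weight \<xi>"
    using p by (simp add: weight_def powr_diff powr_half_sqrt powr_realpow del: DIM_prod)
  finally show ?thesis .
qed

lemma integrable_poisson_mult:
  fixes x :: "'a::euclidean_space \<times> real"
  assumes "snd x > 0" and [measurable]: "F \<in> borel_measurable borel"
    and F: "\<And>\<xi>. \<bar>F \<xi>\<bar> \<le> K * sqrt (1 + norm \<xi>)"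
  shows "integrable lborel (\<lambda>\<xi>. poisson (x - (\<xi>, 0)) * F \<xi>)"
proof -
  let ?n = "DIM('a \<times> real)"
  obtain c where c: "c > 0" "\<And>h \<xi>. norm h \<le> snd x / 2 \<Longrightarrow> c * (1 + norm \<xi>) \<le> norm (x + h - (\<xi>, 0))"
    using half_space_norm_lower[OF assms(1)] by blast
  show ?thesis
  proof (rule Bochner_Integration.integrable_bound)
    show "integrable lborel (\<lambda>\<xi>::'a. snd x * (K / c ^ ?n * weight \<xi>))"
      using integrable_weight by (intro integrable_mult_right) auto
    show "AE \<xi> in lborel. norm (poisson (x - (\<xi>, 0)) * F \<xi>) \<le> norm (snd x * (K / c ^ ?n * weight \<xi>))"
    proof (rule AE_I2)
      fix \<xi> :: 'a
      have "norm (poisson (x - (\<xi>, 0)) * F \<xi>) = snd x * (\<bar>F \<xi>\<bar> / norm (x - (\<xi>, 0)) ^ ?n)"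
        using assms(1) by (simp add: poisson_def abs_mult)
      also have "\<dots> \<le> snd x * (K / c ^ ?n * weight \<xi>)"
        using assms(1) c(2)[of 0 \<xi>] F by (intro mult_left_mono weight_bound c(1)) auto
      finally show "norm (poisson (x - (\<xi>, 0)) * F \<xi>) \<le> norm (snd x * (K / c ^ ?n * weight \<xi>))"
        by (metis abs_ge_self order_trans real_norm_def)
    qed
  qed measurable
qed

lemma fund_sol_measurable [measurable]: "fund_sol \<in> borel_measurable borel"
  unfolding fund_sol_def Let_def by measurable

lemma norm_diff_le_mult: "norm (a - b :: 'v::real_normed_vector) \<le> (1 + norm b) * (1 + norm a)"
proof -
  have "(1 + norm b) * (1 + norm a) = 1 + norm a + norm b + norm b * norm a"
    by (simp add: algebra_simps)
  moreover have "0 \<le> norm b * norm a" by simp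
  ultimately show ?thesis using norm_triangle_ineq4[of a b] by linarith
qed

text \<open>Comparison with the value at (0, b), b being the depth of q: among the points (\<xi>, 0)
  - q with varying \<xi>, this is the one nearest to the origin.\<close>

lemma fund_sol_growth:
  fixes q :: "'a::euclidean_space \<times> real"
  assumes "snd q < 0"
  obtains K where "\<And>\<xi>. \<bar>fund_sol ((\<xi>, 0) - q)\<bar> \<le> K * sqrt (1 + norm \<xi>)"
proof
  let ?n = "DIM('a \<times> real)"
  define b where "b = - snd q"
  have b: "b > 0" using assms by (simp add: b_def)
  let ?A = "4 * kap ?n / b ^ (?n - 2)"
  have kp: "kap ?n > 0" by (rule kap_pos) simp
  fix \<xi> :: 'a
  have s: "1 \<le> sqrt (1 + norm \<xi>)" by simp
  have "\<bar>fund_sol ((\<xi>, 0) - q) - fund_sol (0 :: 'a, b)\<bar> \<le> 4 * kap ?n / norm (0 :: 'a, b) ^ (?n - 2) *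
      sqrt (norm (\<xi> - fst q) / norm (0 :: 'a, b))"
  proof (rule fund_sol_diff_le)
    have e: "(\<xi>, 0) - q = (\<xi> - fst q, b)" by (simp add: prod_eq_iff b_def)
    show "norm (0 :: 'a, b) \<le> norm ((\<xi>, 0) - q)"
      unfolding e using norm_snd_le[of b "\<xi> - fst q"] by (simp add: norm_Pair)
    show "norm ((\<xi>, 0) - q) \<le> norm (0 :: 'a, b) + norm (\<xi> - fst q)"
      unfolding e using norm_Pair_le[of "\<xi> - fst q" b] by (simp add: norm_Pair)
  qed (use b in \<open>simp add: norm_Pair\<close>)
  also have "\<dots> = ?A * sqrt (norm (\<xi> - fst q) / b)"
    using b by (simp add: norm_Pair)
  also have "\<dots> \<le> ?A * (sqrt ((1 + norm (fst q)) / b) * sqrt (1 + norm \<xi>))"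
  proof (intro mult_left_mono)
    note norm_diff_le_mult[of \<xi> "fst q"]
    then show "sqrt (norm (\<xi> - fst q) / b) \<le> sqrt ((1 + norm (fst q)) / b) * sqrt (1 + norm \<xi>)"
      using b unfolding real_sqrt_mult[symmetric] by (intro real_sqrt_le_mono) (simp add: divide_right_mono)
  qed (use b kp in auto)
  finally have "\<bar>fund_sol ((\<xi>, 0) - q)\<bar> \<le> \<bar>fund_sol (0 :: 'a, b)\<bar> + ?A * (sqrt ((1 + norm (fst q)) / b) * sqrt (1 + norm \<xi>))"
    by linarith
  also have "\<bar>fund_sol (0 :: 'a, b)\<bar> \<le> \<bar>fund_sol (0 :: 'a, b)\<bar> * sqrt (1 + norm \<xi>)"
    using s mult_left_mono[OF s, of "\<bar>fund_sol (0 :: 'a, b)\<bar>"] by simp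
  finally show "\<bar>fund_sol ((\<xi>, 0) - q)\<bar> \<le> (\<bar>fund_sol (0 :: 'a, b)\<bar> + ?A * sqrt ((1 + norm (fst q)) / b)) * sqrt (1 + norm \<xi>)"
    by (simp add: algebra_simps)
qed

lemma riesz_measurable [measurable]: "riesz j \<in> borel_measurable borel"
  unfolding riesz_def by measurable

lemma riesz_scaleR_left: "riesz (c *\<^sub>R h) x = c * riesz h x"
  by (simp add: riesz_def)

lemma abs_riesz_le:
  fixes x :: "'v::euclidean_space"
  assumes "0 < d" "d \<le> norm x"
  shows "\<bar>riesz j x\<bar> \<le> norm j / d ^ (DIM('v) - 1)"
proof -
  obtain m where m: "DIM('v) = Suc m"
    using DIM_positive[where 'a='v] gr0_implies_Suc by blast
  have "0 < norm x" using assms by linarith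
  then have "\<bar>riesz j x\<bar> \<le> norm x * norm j / norm x ^ Suc m"
    unfolding riesz_def m abs_divide by (intro frac_le Cauchy_Schwarz_ineq2) auto
  also have "\<dots> = norm j / norm x ^ m" using assms by auto
  also have "\<dots> \<le> norm j / d ^ m"
    using assms \<open>0 < norm x\<close>
    by (intro divide_left_mono power_mono mult_pos_pos zero_less_power) auto
  finally show ?thesis by (simp add: m)
qed

lemma DERIV_fund_sol_line:
  fixes x b :: "'a::euclidean_space \<times> real"
  assumes "x + t *\<^sub>R b \<noteq> 0"
  shows "((\<lambda>t. fund_sol (x + t *\<^sub>R b)) has_real_derivative - 2 * kap DIM('a \<times> real) * riesz b (x + t *\<^sub>R b)) (at t)"
proof -
  have "((\<lambda>t. x + t *\<^sub>R b) has_derivative (\<lambda>h. h *\<^sub>R b)) (at t)"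
    by (auto intro!: derivative_eq_intros)
  from has_derivative_compose[OF this has_derivative_fund_sol[OF assms]]
  show ?thesis
    by (rule has_derivative_imp_has_field_derivative) (simp add: riesz_scaleR_left)
qed

lemma abs_add_scaled_Basis_less:
  fixes q j :: "'a::euclidean_space \<times> real"
  assumes "j \<in> Basis" "\<bar>t\<bar> < d"
  shows "\<bar>snd (t *\<^sub>R j)\<bar> < d"
proof -
  have "\<bar>snd j\<bar> \<le> 1"
    using assms norm_snd_le[of "snd j" "fst j"] by simp
  then have "\<bar>snd (t *\<^sub>R j)\<bar> \<le> \<bar>t\<bar>"
    using mult_left_mono[of "\<bar>snd j\<bar>" 1 "\<bar>t\<bar>"] by (simp add: abs_mult)
  then show ?thesis using assms by linarith
qed

text \<open>Only the pole of E moves. For |t| < - q_n / 2 it stays at depth at least - q_n / 2, so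
  the gradient of E on the boundary is bounded, and a multiple of the Poisson kernel
  dominates.\<close>

lemma poisson_fund_sol_derivative:
  fixes x q j :: "'a::euclidean_space \<times> real"
  assumes "snd x > 0" "snd q < 0" "j \<in> Basis"
  shows "integrable lborel (\<lambda>\<xi>. poisson (x - (\<xi>, 0)) * riesz j ((\<xi>, 0) - q))"
    and "((\<lambda>t. \<integral>\<xi>. poisson (x - (\<xi>, 0)) * fund_sol ((\<xi>, 0) - q + t *\<^sub>R j) \<partial>lborel) has_real_derivative
       - 2 * kap DIM('a \<times> real) * (\<integral>\<xi>. poisson (x - (\<xi>, 0)) * riesz j ((\<xi>, 0) - q) \<partial>lborel)) (at 0)"
proof -
  let ?n = "DIM('a \<times> real)"
  define d where "d = - snd q / 2"
  have d: "d > 0" using assms by (simp add: d_def)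
  have kp: "kap ?n > 0" by (rule kap_pos) simp
  have low: "d \<le> norm ((\<xi>, 0) - q + t *\<^sub>R j)" if "\<bar>t\<bar> < d" for t and \<xi> :: 'a
  proof -
    have "snd ((\<xi>, 0) - q + t *\<^sub>R j) \<ge> d"
      using abs_add_scaled_Basis_less[OF assms(3) that] unfolding d_def by simp
    then show ?thesis
      using norm_snd_le[of "snd ((\<xi>, 0) - q + t *\<^sub>R j)" "fst ((\<xi>, 0) - q + t *\<^sub>R j)"]
      unfolding prod.collapse real_norm_def by linarith
  qed
  have int: "integrable lborel (\<lambda>\<xi>. poisson (x - (\<xi>, 0)) * fund_sol ((\<xi>, 0) - q + t *\<^sub>R j))"
    if "\<bar>t\<bar> < d" for t
  proof -
    have "snd (q - t *\<^sub>R j) < 0"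
      using abs_add_scaled_Basis_less[OF assms(3) that] unfolding d_def by simp
    then obtain K where "\<And>\<xi>::'a. \<bar>fund_sol ((\<xi>, 0) - (q - t *\<^sub>R j))\<bar> \<le> K * sqrt (1 + norm \<xi>)"
      using fund_sol_growth by blast
    then have "integrable lborel (\<lambda>\<xi>. poisson (x - (\<xi>, 0)) * fund_sol ((\<xi>, 0) - (q - t *\<^sub>R j)))"
      by (intro integrable_poisson_mult assms(1)) auto
    then show ?thesis by (simp add: algebra_simps)
  qed
  have der: "((\<lambda>t. poisson (x - (\<xi>, 0)) * fund_sol ((\<xi>, 0) - q + t *\<^sub>R j)) has_real_derivative
      poisson (x - (\<xi>, 0)) * (- 2 * kap ?n * riesz j ((\<xi>, 0) - q + t *\<^sub>R j))) (at t)"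
    if "\<bar>t\<bar> < d" for t and \<xi> :: 'a
    using low[OF that, of \<xi>] d by (intro DERIV_cmult DERIV_fund_sol_line) auto
  have bnd: "\<bar>poisson (x - (\<xi>, 0)) * (- 2 * kap ?n * riesz j ((\<xi>, 0) - q + t *\<^sub>R j))\<bar>
      \<le> 2 * kap ?n * (1 / d ^ (?n - 1)) * poisson (x - (\<xi>, 0))" if "\<bar>t\<bar> < d" for t and \<xi> :: 'a
  proof -
    have P: "poisson (x - (\<xi>, 0)) \<ge> 0" using assms(1) by (intro poisson_nonneg) simp
    have "\<bar>poisson (x - (\<xi>, 0)) * (- 2 * kap ?n * riesz j ((\<xi>, 0) - q + t *\<^sub>R j))\<bar>
        = poisson (x - (\<xi>, 0)) * (2 * kap ?n * \<bar>riesz j ((\<xi>, 0) - q + t *\<^sub>R j)\<bar>)"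
      using P kp by (simp add: abs_mult del: DIM_prod)
    also have "\<dots> \<le> poisson (x - (\<xi>, 0)) * (2 * kap ?n * (norm j / d ^ (?n - 1)))"
      using P kp low[OF that] d by (intro mult_left_mono abs_riesz_le) auto
    finally show ?thesis using assms(3) by (simp add: mult_ac del: DIM_prod)
  qed
  have g: "integrable lborel (\<lambda>\<xi>. 2 * kap ?n * (1 / d ^ (?n - 1)) * poisson (x - (\<xi>, 0)))"
    using has_bochner_integral_poisson[OF assms(1)] by (intro integrable_mult_right) (rule integrable.intros)
  note D = has_real_derivative_integral[OF d int der bnd g]
  have "integrable lborel (\<lambda>\<xi>. (- 1 / (2 * kap ?n)) * (poisson (x - (\<xi>, 0)) * (- 2 * kap ?n * riesz j ((\<xi>, 0) - q + 0 *\<^sub>R j))))"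
    by (intro integrable_mult_right D(1))
  moreover have "(- 1 / (2 * kap ?n)) * (P * (- 2 * kap ?n * R)) = P * R" for P R
    using kp by (simp del: DIM_prod)
  ultimately show "integrable lborel (\<lambda>\<xi>. poisson (x - (\<xi>, 0)) * riesz j ((\<xi>, 0) - q))"
    by (simp only: scaleR_zero_left add_0_right)
  have "(\<integral>\<xi>. poisson (x - (\<xi>, 0)) * (- 2 * kap ?n * riesz j ((\<xi>, 0) - q + 0 *\<^sub>R j)) \<partial>lborel)
      = (\<integral>\<xi>. - 2 * kap ?n * (poisson (x - (\<xi>, 0)) * riesz j ((\<xi>, 0) - q)) \<partial>lborel)"
    by (intro Bochner_Integration.integral_cong refl) (simp add: mult_ac del: DIM_prod)
  also have "\<dots> = - 2 * kap ?n * (\<integral>\<xi>. poisson (x - (\<xi>, 0)) * riesz j ((\<xi>, 0) - q) \<partial>lborel)"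
    by (rule integral_mult_right_zero)
  finally show "((\<lambda>t. \<integral>\<xi>. poisson (x - (\<xi>, 0)) * fund_sol ((\<xi>, 0) - q + t *\<^sub>R j) \<partial>lborel) has_real_derivative
       - 2 * kap ?n * (\<integral>\<xi>. poisson (x - (\<xi>, 0)) * riesz j ((\<xi>, 0) - q) \<partial>lborel)) (at 0)"
    using D(2) by (simp only:)
qed

lemma poisson_integral_fund_sol:
  fixes x q :: "'a::euclidean_space \<times> real"
  assumes "snd x > 0" "snd q < 0"
  shows "(\<integral>\<xi>. poisson (x - (\<xi>, 0)) * fund_sol ((\<xi>, 0) - q) \<partial>lborel) = poisson_mass TYPE('a) * fund_sol (x - q)"
proof -
  let ?n = "DIM('a \<times> real)" and ?N = "poisson_mass TYPE('a)"
  define p where "p = fst q"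
  \<comment> \<open>The defect of the claimed identity as a function of the depth b of a pole below
    the boundary point p.\<close>
  define \<Psi> where "\<Psi> = (\<lambda>b. (\<integral>\<xi>. poisson (x - (\<xi>, 0)) * fund_sol ((\<xi>, 0) - (p, - b)) \<partial>lborel) - ?N * fund_sol (x - (p, - b)))"
  have kp: "kap ?n > 0" by (rule kap_pos) simp
  have der: "(\<Psi> has_real_derivative 0) (at b)" if b: "b > 0" for b
  proof -
    have "((\<lambda>t. (\<integral>\<xi>. poisson (x - (\<xi>, 0)) * fund_sol ((\<xi>, 0) - (p, - b) + t *\<^sub>R e_n) \<partial>lborel)
          - ?N * fund_sol (x - (p, - b) + t *\<^sub>R e_n)) has_real_derivative
        - 2 * kap ?n * (\<integral>\<xi>. poisson (x - (\<xi>, 0)) * riesz e_n ((\<xi>, 0) - (p, - b)) \<partial>lborel)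
          - ?N * (- 2 * kap ?n * riesz e_n (x - (p, - b) + 0 *\<^sub>R e_n))) (at 0)"
      using assms b
      by (intro DERIV_diff DERIV_cmult poisson_fund_sol_derivative DERIV_fund_sol_line e_n_Basis)
         (auto simp: prod_eq_iff)
    \<comment> \<open>As \<open>riesz e_n\<close> is \<open>poisson\<close>, this is the semigroup
      property, and it makes the two derivatives cancel.\<close>
    moreover have "(\<integral>\<xi>. poisson (x - (\<xi>, 0)) * riesz e_n ((\<xi>, 0) - (p, - b)) \<partial>lborel) = ?N * riesz e_n (x - (p, - b))"
      using has_bochner_integral_poisson_semigroup[of x "(p, - b)"] assms b
      by (simp add: poisson_eq_riesz has_bochner_integral_iff)
    moreover have "u - (p, - b) + t *\<^sub>R e_n = u - (p, - (b + t))" for u t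
      by (simp add: e_n_def prod_eq_iff)
    then have "(\<lambda>t. (\<integral>\<xi>. poisson (x - (\<xi>, 0)) * fund_sol ((\<xi>, 0) - (p, - b) + t *\<^sub>R e_n) \<partial>lborel)
          - ?N * fund_sol (x - (p, - b) + t *\<^sub>R e_n)) = (\<lambda>t. \<Psi> (b + t))"
      by (simp only: \<Psi>_def)
    ultimately have "((\<lambda>t. \<Psi> (b + t)) has_real_derivative 0) (at 0)"
      by (simp del: DIM_prod)
    then show ?thesis
      using DERIV_shift[of \<Psi> 0 0 b] by (simp add: add.commute)
  qed
  obtain c where c: "\<And>b. b > 0 \<Longrightarrow> \<Psi> b = c"
    using has_field_derivative_zero_constant[of "{0<..}" \<Psi>] der
    by (auto intro: has_field_derivative_at_within)
  let ?J = "\<integral>\<xi>. poisson (x - (\<xi>, 0)) * sqrt (norm (\<xi> - p)) \<partial>lborel"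
  have intJ: "integrable lborel (\<lambda>\<xi>. poisson (x - (\<xi>, 0)) * sqrt (norm (\<xi> - p)))"
  proof (rule integrable_poisson_mult[OF assms(1)])
    fix \<xi> :: 'a
    note norm_diff_le_mult[of \<xi> p]
    then show "\<bar>sqrt (norm (\<xi> - p))\<bar> \<le> sqrt (1 + norm p) * sqrt (1 + norm \<xi>)"
      unfolding real_sqrt_mult[symmetric] by simp
  qed measurable
  \<comment> \<open>Both terms of \<Psi> are compared with \<open>?N * E0\<close>. The subtraction
    is essential for n = 2, where E(0, b) tends to -\<infinity>; it fits both terms because the
    Poisson kernel has mass \<open>?N\<close>.\<close>
  have bound: "\<bar>c\<bar> \<le> (4 * kap ?n * ?J + ?N * (4 * kap ?n * sqrt (norm (x - (p, 0))))) / sqrt b" if b: "b \<ge> 1" for b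
  proof -
    define E0 where "E0 = fund_sol (0 :: 'a, b)"
    have b0: "b > 0" using b by simp
    have dist: "\<bar>fund_sol w - E0\<bar> \<le> 4 * kap ?n / sqrt b * sqrt L"
      if "b \<le> norm w" "norm w \<le> b + L" for w :: "'a \<times> real" and L
    proof -
      have "\<bar>fund_sol w - E0\<bar> \<le> 4 * kap ?n / norm (0 :: 'a, b) ^ (?n - 2) * sqrt (L / norm (0 :: 'a, b))"
        unfolding E0_def using that b0 by (intro fund_sol_diff_le) (auto simp: norm_Pair)
      also have "\<dots> = (4 * kap ?n * sqrt (L / b)) / b ^ (?n - 2)" using b0 by (simp add: norm_Pair)
      also have "\<dots> \<le> (4 * kap ?n * sqrt (L / b)) / 1"
        using b kp that by (intro divide_left_mono) auto
      finally show ?thesis by (simp add: real_sqrt_divide del: DIM_prod)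
    qed
    have e: "(\<xi>, 0) - (p, - b) = (\<xi> - p, b)" for \<xi> by simp
    have d1: "\<bar>fund_sol ((\<xi>, 0) - (p, - b)) - E0\<bar> \<le> 4 * kap ?n / sqrt b * sqrt (norm (\<xi> - p))" for \<xi>
      using norm_snd_le[of b "\<xi> - p"] norm_Pair_le[of "\<xi> - p" b] b0
      unfolding e by (intro dist) auto
    have d2: "\<bar>fund_sol (x - (p, - b)) - E0\<bar> \<le> 4 * kap ?n / sqrt b * sqrt (norm (x - (p, 0)))"
    proof (rule dist)
      have e: "x - (p, - b) = (fst x - p, snd x + b)" by (simp add: prod_eq_iff)
      show "b \<le> norm (x - (p, - b))"
        using norm_snd_le[of "snd x + b" "fst x - p"] assms b0 unfolding e by simp
      have e: "(0, b) + (x - (p, 0)) = x - (p, - b)" by (simp add: prod_eq_iff)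
      show "norm (x - (p, - b)) \<le> b + norm (x - (p, 0))"
        using norm_triangle_ineq[of "(0, b)" "x - (p, 0)"] b0 unfolding e by (simp add: norm_Pair)
    qed
    have P: "integrable lborel (\<lambda>\<xi>. poisson (x - (\<xi>, 0)))" "(\<integral>\<xi>. poisson (x - (\<xi>, 0)) \<partial>lborel) = ?N"
      using has_bochner_integral_poisson[OF assms(1)] by (auto simp: has_bochner_integral_iff)
    obtain K where "\<And>\<xi>::'a. \<bar>fund_sol ((\<xi>, 0) - (p, - b))\<bar> \<le> K * sqrt (1 + norm \<xi>)"
      using fund_sol_growth[of "(p, - b)"] b0 by auto
    then have PE: "integrable lborel (\<lambda>\<xi>. poisson (x - (\<xi>, 0)) * fund_sol ((\<xi>, 0) - (p, - b)))"
      by (intro integrable_poisson_mult assms(1)) auto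
    have "(\<integral>\<xi>. poisson (x - (\<xi>, 0)) * fund_sol ((\<xi>, 0) - (p, - b)) \<partial>lborel) - ?N * E0
        = (\<integral>\<xi>. poisson (x - (\<xi>, 0)) * (fund_sol ((\<xi>, 0) - (p, - b)) - E0) \<partial>lborel)"
      using P PE by (simp add: right_diff_distrib)
    also have "\<bar>\<dots>\<bar> \<le> (\<integral>\<xi>. 4 * kap ?n / sqrt b * (poisson (x - (\<xi>, 0)) * sqrt (norm (\<xi> - p))) \<partial>lborel)"
    proof (rule integral_abs_bound_integral)
      show "integrable lborel (\<lambda>\<xi>. poisson (x - (\<xi>, 0)) * (fund_sol ((\<xi>, 0) - (p, - b)) - E0))"
        using P PE by (simp add: right_diff_distrib)
      show "integrable lborel (\<lambda>\<xi>. 4 * kap ?n / sqrt b * (poisson (x - (\<xi>, 0)) * sqrt (norm (\<xi> - p))))"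
        by (rule integrable_mult_right[OF intJ])
      show "\<bar>poisson (x - (\<xi>, 0)) * (fund_sol ((\<xi>, 0) - (p, - b)) - E0)\<bar>
          \<le> 4 * kap ?n / sqrt b * (poisson (x - (\<xi>, 0)) * sqrt (norm (\<xi> - p)))" for \<xi>
        using mult_left_mono[OF d1[of \<xi>], of "poisson (x - (\<xi>, 0))"] poisson_nonneg[of "x - (\<xi>, 0)"] assms(1)
        by (simp add: abs_mult mult_ac del: DIM_prod)
    qed
    also have "\<dots> = 4 * kap ?n / sqrt b * ?J" by (rule integral_mult_right_zero)
    finally have 1: "\<bar>(\<integral>\<xi>. poisson (x - (\<xi>, 0)) * fund_sol ((\<xi>, 0) - (p, - b)) \<partial>lborel) - ?N * E0\<bar> \<le> 4 * kap ?n / sqrt b * ?J" .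
    have 2: "\<bar>?N * (fund_sol (x - (p, - b)) - E0)\<bar> \<le> ?N * (4 * kap ?n / sqrt b * sqrt (norm (x - (p, 0))))"
      using mult_left_mono[OF d2, of ?N] poisson_mass_pos[where 'a='a]
      by (simp add: abs_mult del: DIM_prod)
    have "c = ((\<integral>\<xi>. poisson (x - (\<xi>, 0)) * fund_sol ((\<xi>, 0) - (p, - b)) \<partial>lborel) - ?N * E0) - ?N * (fund_sol (x - (p, - b)) - E0)"
      using c[OF b0] by (simp add: \<Psi>_def right_diff_distrib)
    then have "\<bar>c\<bar> \<le> 4 * kap ?n / sqrt b * ?J + ?N * (4 * kap ?n / sqrt b * sqrt (norm (x - (p, 0))))"
      using 1 2 by linarith
    then show ?thesis by (simp add: add_divide_distrib mult_ac del: DIM_prod)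
  qed
  have "((\<lambda>b. K / sqrt b) \<longlongrightarrow> 0) at_top" for K :: real
    by real_asymp
  from tendsto_lowerbound[OF this eventually_mono[OF eventually_ge_at_top[of 1] bound]]
  have "\<bar>c\<bar> \<le> 0" by simp
  moreover have "\<Psi> (- snd q) = c" using assms by (intro c) simp
  ultimately have "\<Psi> (- snd q) = 0" by simp
  moreover have q: "(p, - (- snd q)) = q" by (simp add: p_def)
  ultimately show ?thesis unfolding \<Psi>_def q by linarith
qed

text \<open>The formula for E is differentiated in the position of the pole, once under the integral
  and once explicitly; the two results agree by uniqueness of derivatives.\<close>

lemma poisson_integral_riesz:
  fixes x q j :: "'a::euclidean_space \<times> real"
  assumes "snd x > 0" "snd q < 0" "j \<in> Basis"
  shows "(\<integral>\<xi>. poisson (x - (\<xi>, 0)) * riesz j ((\<xi>, 0) - q) \<partial>lborel) = poisson_mass TYPE('a) * riesz j (x - q)"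
proof -
  let ?n = "DIM('a \<times> real)" and ?N = "poisson_mass TYPE('a)"
  let ?I = "\<lambda>t. \<integral>\<xi>. poisson (x - (\<xi>, 0)) * fund_sol ((\<xi>, 0) - q + t *\<^sub>R j) \<partial>lborel"
  have kp: "kap ?n > 0" by (rule kap_pos) simp
  have "x - q \<noteq> 0" using assms by (auto simp: prod_eq_iff)
  then have "((\<lambda>t. ?N * fund_sol (x - q + t *\<^sub>R j)) has_real_derivative
      ?N * (- 2 * kap ?n * riesz j (x - q + 0 *\<^sub>R j))) (at 0)"
    by (intro DERIV_cmult DERIV_fund_sol_line) simp
  moreover have "?I t = ?N * fund_sol (x - q + t *\<^sub>R j)" if "t \<in> {- (- snd q)<..<- snd q}" for t
  proof -
    have "\<bar>snd (t *\<^sub>R j)\<bar> < - snd q"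
      using that by (intro abs_add_scaled_Basis_less assms(3)) auto
    then have "snd (q - t *\<^sub>R j) < 0" by (simp add: abs_less_iff)
    from poisson_integral_fund_sol[OF assms(1) this] show ?thesis by (simp add: algebra_simps)
  qed
  then have "\<forall>\<^sub>F t in nhds 0. ?I t = ?N * fund_sol (x - q + t *\<^sub>R j)"
    using assms(2) by (intro eventually_mono[OF eventually_nhds_in_open[of "{- (- snd q)<..<- snd q}"]]) auto
  ultimately have "(?I has_real_derivative ?N * (- 2 * kap ?n * riesz j (x - q))) (at 0)"
    by (subst DERIV_cong_ev[OF refl _ refl]) simp_all
  from DERIV_unique[OF this poisson_fund_sol_derivative(2)[OF assms]]
  show ?thesis using kp by (simp del: DIM_prod)
qed

section \<open>From the Poisson kernel to the Odqvist kernel\<close>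

lemma DERIV_norm_line:
  fixes x b :: "'v::euclidean_space"
  assumes "x + t *\<^sub>R b \<noteq> 0"
  shows "((\<lambda>t. norm (x + t *\<^sub>R b)) has_real_derivative ((x + t *\<^sub>R b) \<bullet> b) / norm (x + t *\<^sub>R b)) (at t)"
proof -
  have "((\<lambda>t. x + t *\<^sub>R b) has_derivative (\<lambda>h. h *\<^sub>R b)) (at t)"
    by (auto intro!: derivative_eq_intros)
  from has_derivative_compose[OF this has_derivative_norm[OF assms]]
  show ?thesis
    by (rule has_derivative_imp_has_field_derivative)
       (simp add: sgn_div_norm inner_commute divide_inverse)
qed

definition poisson_deriv :: "'a::euclidean_space \<times> real \<Rightarrow> 'a \<times> real \<Rightarrow> real" where
  "poisson_deriv i x = snd i / norm x ^ DIM('a \<times> real)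
     - real DIM('a \<times> real) * snd x * (x \<bullet> i) / norm x ^ (DIM('a \<times> real) + 2)"

lemma DERIV_poisson_line:
  fixes x i :: "'a::euclidean_space \<times> real"
  assumes "x + t *\<^sub>R i \<noteq> 0"
  shows "((\<lambda>t. poisson (x + t *\<^sub>R i)) has_real_derivative poisson_deriv i (x + t *\<^sub>R i)) (at t)"
proof -
  define n where "n = DIM('a \<times> real)"
  obtain m where m: "n = Suc m" by (auto simp: n_def)
  define y where "y = x + t *\<^sub>R i"
  have y: "norm y > 0" using assms by (simp add: y_def)
  have "((\<lambda>t. (snd x + t * snd i) / norm (x + t *\<^sub>R i) ^ n) has_real_derivative
      (snd i * norm y ^ n - snd y * (real n * ((y \<bullet> i) / norm y) * norm y ^ (n - 1))) / (norm y ^ n * norm y ^ n)) (at t)"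
    using y by (auto intro!: derivative_eq_intros DERIV_norm_line[THEN DERIV_cong] assms simp: y_def)
  also have "(snd i * norm y ^ n - snd y * (real n * ((y \<bullet> i) / norm y) * norm y ^ (n - 1))) / (norm y ^ n * norm y ^ n)
      = poisson_deriv i y"
    unfolding poisson_deriv_def n_def[symmetric] m using y
    by (simp add: field_simps power2_eq_square)
  finally show ?thesis
    by (simp add: poisson_def y_def n_def del: DIM_prod)
qed

lemma poisson_deriv_measurable [measurable]: "poisson_deriv i \<in> borel_measurable borel"
proof -
  have [measurable]: "(snd :: 'a \<times> real \<Rightarrow> real) \<in> borel_measurable borel"
    by (intro borel_measurable_continuous_onI continuous_intros)
  show ?thesis unfolding poisson_deriv_def by measurable
qed

lemma abs_poisson_deriv_le:
  fixes x i :: "'a::euclidean_space \<times> real"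
  assumes "x \<noteq> 0" "i \<in> Basis"
  shows "\<bar>poisson_deriv i x\<bar> \<le> (1 + real DIM('a \<times> real)) / norm x ^ DIM('a \<times> real)"
proof -
  define n where "n = DIM('a \<times> real)"
  have x: "norm x > 0" using assms by simp
  have i: "\<bar>snd i\<bar> \<le> 1" using assms norm_snd_le[of "snd i" "fst i"] by simp
  have "\<bar>snd x * (x \<bullet> i)\<bar> \<le> norm x * norm x"
    using norm_snd_le[of "snd x" "fst x"] Basis_le_norm[OF assms(2), of x]
    unfolding abs_mult by (intro mult_mono) auto
  then have "\<bar>real n * snd x * (x \<bullet> i) / norm x ^ (n + 2)\<bar> \<le> real n * (norm x * norm x) / norm x ^ (n + 2)"
    unfolding abs_divide mult.assoc abs_mult[of "real n"]
    by (intro frac_le mult_mono) (use x in auto)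
  also have "\<dots> = real n / norm x ^ n" using x by (simp add: power2_eq_square)
  finally have "\<bar>real n * snd x * (x \<bullet> i) / norm x ^ (n + 2)\<bar> \<le> real n / norm x ^ n" .
  moreover have "\<bar>snd i / norm x ^ n\<bar> \<le> 1 / norm x ^ n"
    using i by (simp add: divide_right_mono)
  ultimately show ?thesis
    unfolding poisson_deriv_def n_def[symmetric] add_divide_distrib by linarith
qed

text \<open>The terms \<open>snd i\<close> * x_n / |x|^n cancel, which leaves n * x_n^2 * x_i /
  |x|^(n + 2). Dividing by the mass n * omega n / 2 gives the factor 2 / omega n of K.\<close>

lemma odqvist_eq_poisson:
  fixes x i :: "'a::euclidean_space \<times> real"
  assumes "x \<noteq> 0"
  shows "poisson_mass TYPE('a) * odqvist i e_n x = snd i * poisson x - snd x * poisson_deriv i x"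
proof -
  define n where "n = DIM('a \<times> real)"
  have "n > 0" by (simp add: n_def)
  then have "omega n > 0" "real n > 0" by (simp_all add: omega_pos)
  moreover have "norm x > 0" using assms by simp
  ultimately show ?thesis
    unfolding poisson_mass_eq odqvist_def poisson_def poisson_deriv_def n_def[symmetric] Let_def inner_e_n
    by (simp add: field_simps power2_eq_square)
qed

text \<open>By \<open>odqvist_eq_poisson\<close> it suffices to integrate F against P and against a
  derivative of P. The latter is the derivative of the Poisson integral of F, for which the growth
  condition on F supplies a dominating multiple of \<open>weight\<close>. Knowing h on the whole
  half space is what allows the differentiation.\<close>

lemma odqvist_integral:
  fixes x i :: "'a::euclidean_space \<times> real"
  assumes "snd x > 0" "i \<in> Basis" and [measurable]: "F \<in> borel_measurable borel"
    and F: "\<And>\<xi>. \<bar>F \<xi>\<bar> \<le> K * sqrt (1 + norm \<xi>)"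
    and repr: "\<And>x. snd x > 0 \<Longrightarrow> (\<integral>\<xi>. poisson (x - (\<xi>, 0)) * F \<xi> \<partial>lborel) = poisson_mass TYPE('a) * h x"
    and h: "((\<lambda>t. h (x + t *\<^sub>R i)) has_real_derivative h') (at 0)"
  shows "(\<integral>\<xi>. odqvist i e_n (x - (\<xi>, 0)) * F \<xi> \<partial>lborel) = snd i * h x - snd x * h'"
proof -
  let ?n = "DIM('a \<times> real)" and ?N = "poisson_mass TYPE('a)"
  have N: "?N > 0" by (rule poisson_mass_pos)
  define d where "d = snd x / 2"
  have d: "d > 0" using assms by (simp add: d_def)
  have up: "snd (x + t *\<^sub>R i) > 0" if "\<bar>t\<bar> < d" for t
    using abs_add_scaled_Basis_less[OF assms(2) that] d unfolding d_def by simp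
  obtain c where c: "c > 0" "\<And>k \<xi>. norm k \<le> snd x / 2 \<Longrightarrow> c * (1 + norm \<xi>) \<le> norm (x + k - (\<xi>, 0))"
    using half_space_norm_lower[OF assms(1)] by blast
  have low: "c * (1 + norm \<xi>) \<le> norm (x - (\<xi>, 0) + t *\<^sub>R i)" if "\<bar>t\<bar> < d" for t \<xi>
    using c(2)[of "t *\<^sub>R i" \<xi>] that assms(2) by (simp add: d_def algebra_simps)
  have nz: "x - (\<xi>, 0) + t *\<^sub>R i \<noteq> 0" if "\<bar>t\<bar> < d" for t \<xi>
  proof -
    have "0 < 1 + norm \<xi>" by (simp add: add_pos_nonneg)
    from less_le_trans[OF mult_pos_pos[OF c(1) this] low[OF that]] show ?thesis by simp
  qed
  have int: "integrable lborel (\<lambda>\<xi>. poisson (x - (\<xi>, 0) + t *\<^sub>R i) * F \<xi>)" if "\<bar>t\<bar> < d" for t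
    using integrable_poisson_mult[OF up[OF that] _ F] by (simp add: algebra_simps)
  have der: "((\<lambda>t. poisson (x - (\<xi>, 0) + t *\<^sub>R i) * F \<xi>) has_real_derivative
      poisson_deriv i (x - (\<xi>, 0) + t *\<^sub>R i) * F \<xi>) (at t)" if "\<bar>t\<bar> < d" for t \<xi>
    using nz[OF that] by (intro DERIV_cmult_right DERIV_poisson_line)
  have bnd: "\<bar>poisson_deriv i (x - (\<xi>, 0) + t *\<^sub>R i) * F \<xi>\<bar> \<le> (1 + real ?n) * (K / c ^ ?n * weight \<xi>)"
    if "\<bar>t\<bar> < d" for t \<xi>
  proof -
    have "\<bar>poisson_deriv i (x - (\<xi>, 0) + t *\<^sub>R i) * F \<xi>\<bar>
        \<le> (1 + real ?n) / norm (x - (\<xi>, 0) + t *\<^sub>R i) ^ ?n * \<bar>F \<xi>\<bar>"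
      unfolding abs_mult by (intro mult_right_mono abs_poisson_deriv_le nz that assms(2)) auto
    also have "\<dots> = (1 + real ?n) * (\<bar>F \<xi>\<bar> / norm (x - (\<xi>, 0) + t *\<^sub>R i) ^ ?n)" by simp
    also have "\<dots> \<le> (1 + real ?n) * (K / c ^ ?n * weight \<xi>)"
      by (intro mult_left_mono weight_bound[OF c(1) low[OF that] F]) simp
    finally show ?thesis .
  qed
  have g: "integrable lborel (\<lambda>\<xi>::'a. (1 + real ?n) * (K / c ^ ?n * weight \<xi>))"
    using integrable_weight by (intro integrable_mult_right)
  note D = has_real_derivative_integral[OF d int der bnd g]
  have "\<forall>\<^sub>F t in nhds 0. (\<integral>\<xi>. poisson (x - (\<xi>, 0) + t *\<^sub>R i) * F \<xi> \<partial>lborel) = ?N * h (x + t *\<^sub>R i)"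
  proof (rule eventually_mono[OF eventually_nhds_in_open[of "{- d<..<d}"]])
    fix t assume "t \<in> {- d<..<d}"
    then have "\<bar>t\<bar> < d" by auto
    from repr[OF up[OF this]]
    show "(\<integral>\<xi>. poisson (x - (\<xi>, 0) + t *\<^sub>R i) * F \<xi> \<partial>lborel) = ?N * h (x + t *\<^sub>R i)"
      by (simp add: algebra_simps)
  qed (use d in auto)
  then have "((\<lambda>t. \<integral>\<xi>. poisson (x - (\<xi>, 0) + t *\<^sub>R i) * F \<xi> \<partial>lborel) has_real_derivative ?N * h') (at 0)"
    by (subst DERIV_cong_ev[OF refl _ refl]) (auto intro!: DERIV_cmult h)
  from DERIV_unique[OF D(2) this]
  have D0: "(\<integral>\<xi>. poisson_deriv i (x - (\<xi>, 0)) * F \<xi> \<partial>lborel) = ?N * h'" by simp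
  have Dint: "integrable lborel (\<lambda>\<xi>. poisson_deriv i (x - (\<xi>, 0)) * F \<xi>)" using D(1) by simp
  have Pint: "integrable lborel (\<lambda>\<xi>. poisson (x - (\<xi>, 0)) * F \<xi>)" using int[of 0] d by simp
  have eq: "odqvist i e_n (x - (\<xi>, 0)) * F \<xi> = (1 / ?N) *
      (snd i * (poisson (x - (\<xi>, 0)) * F \<xi>) - snd x * (poisson_deriv i (x - (\<xi>, 0)) * F \<xi>))" for \<xi>
  proof -
    have "x - (\<xi>, 0) \<noteq> 0" using nz[of 0 \<xi>] d by simp
    from odqvist_eq_poisson[OF this, of i]
    have "odqvist i e_n (x - (\<xi>, 0)) = (snd i * poisson (x - (\<xi>, 0)) - snd x * poisson_deriv i (x - (\<xi>, 0))) / ?N"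
      using N by (simp add: field_simps)
    then show ?thesis by (simp only:) (simp add: algebra_simps diff_divide_distrib)
  qed
  have "(\<integral>\<xi>. odqvist i e_n (x - (\<xi>, 0)) * F \<xi> \<partial>lborel) = (1 / ?N) *
      (snd i * (\<integral>\<xi>. poisson (x - (\<xi>, 0)) * F \<xi> \<partial>lborel) - snd x * (\<integral>\<xi>. poisson_deriv i (x - (\<xi>, 0)) * F \<xi> \<partial>lborel))"
    unfolding eq using Dint Pint by simp
  also have "\<dots> = snd i * h x - snd x * h'"
    using N repr[OF assms(1)] D0 by (simp add: field_simps)
  finally show ?thesis .
qed

section \<open>Closed form of the Green tensor\<close>

text \<open>Lets \<open>snd j\<close> stand for the Kronecker symbol \<delta>_jn and 1 - 2 * snd j
  for \<epsilon>_j, so that both enter the formulas as numbers.\<close>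

lemma Basis_prod_real_cases:
  fixes j :: "'a::euclidean_space \<times> real"
  assumes "j \<in> Basis"
  shows "j = e_n \<or> snd j = 0"
  using assms by (auto simp: Basis_prod_def e_n_def)

lemma e_n_simps [simp]: "fst e_n = 0" "snd e_n = 1"
  by (simp_all add: e_n_def)

lemma reflect_simps [simp]: "fst (reflect y) = fst y" "snd (reflect y) = - snd y"
  by (simp_all add: reflect_def)

text \<open>Boundary points are equidistant from y and its reflection. This moves the pole into the
  lower half space, where the Poisson formulas apply.\<close>

lemma norm_minus_reflect:
  fixes y :: "'a::euclidean_space \<times> real"
  shows "norm ((\<xi>, 0) - y) = norm ((\<xi>, 0) - reflect y)"
  by (simp add: norm_prod_def)

lemma DERIV_riesz_line:
  fixes x i j :: "'v::euclidean_space"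
  assumes "x \<noteq> 0"
  shows "((\<lambda>t. riesz j (x + t *\<^sub>R i)) has_real_derivative
     (i \<bullet> j) / norm x ^ DIM('v) - real DIM('v) * (x \<bullet> i) * (x \<bullet> j) / norm x ^ (DIM('v) + 2)) (at 0)"
proof -
  define n where "n = DIM('v)"
  obtain m where m: "n = Suc m"
    using DIM_positive[where 'a='v] gr0_implies_Suc unfolding n_def by blast
  have x: "norm x > 0" using assms by simp
  have N: "((\<lambda>t. norm (x + t *\<^sub>R i)) has_real_derivative (x \<bullet> i) / norm x) (at 0)"
    using DERIV_norm_line[of x 0 i] assms by simp
  have "((\<lambda>t. ((x + t *\<^sub>R i) \<bullet> j) / norm (x + t *\<^sub>R i) ^ n) has_real_derivative
      ((i \<bullet> j) * norm x ^ n - (x \<bullet> j) * (real n * ((x \<bullet> i) / norm x) * norm x ^ (n - 1))) / (norm x ^ n * norm x ^ n)) (at 0)"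
    using x unfolding inner_add_left inner_scaleR_left
    by (auto intro!: derivative_eq_intros N[THEN DERIV_cong])
  also have "((i \<bullet> j) * norm x ^ n - (x \<bullet> j) * (real n * ((x \<bullet> i) / norm x) * norm x ^ (n - 1))) / (norm x ^ n * norm x ^ n)
      = (i \<bullet> j) / norm x ^ n - real n * (x \<bullet> i) * (x \<bullet> j) / norm x ^ (n + 2)"
    unfolding m using x by (simp add: field_simps power2_eq_square)
  finally show ?thesis by (simp add: riesz_def n_def)
qed

text \<open>Arranged so that the zero boundary values are visible: each term contains the factor x_n
  * y_n or a difference that vanishes when |w| = |z|. For this reason the numerator w_i w_j is kept
  over |z|^n too.\<close>

definition green_explicit ::
  "'a::euclidean_space \<times> real \<Rightarrow> 'a \<times> real \<Rightarrow> 'a \<times> real \<Rightarrow> 'a \<times> real \<Rightarrow> real" where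
  "green_explicit i j x y = (let n = DIM('a \<times> real); w = x - y; z = x - reflect y; q = snd x * snd y in
     (i \<bullet> j) / 2 * (fund_sol w - fund_sol z)
     + kap n * (w \<bullet> i) * (w \<bullet> j) * (1 / norm w ^ n - 1 / norm z ^ n)
     - 2 * kap n * q * (i \<bullet> j) / norm z ^ n
     + 2 * kap n * real n * (1 - 2 * snd j) * q * (z \<bullet> i) * (z \<bullet> j) / norm z ^ (n + 2))"

lemma green_eq_explicit:
  fixes x y i j :: "'a::euclidean_space \<times> real"
  assumes "x \<in> half_space" "y \<in> half_space" "i \<in> Basis" "j \<in> Basis"
  shows "green i j x y = green_explicit i j x y"
proof -
  define n where "n = DIM('a \<times> real)"
  define k where "k = kap n"
  define w z q where "w = x - y" and "z = x - reflect y" and "q = reflect y"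
  define \<epsilon> where "\<epsilon> = 1 - 2 * snd j"
  have x: "snd x > 0" and y: "snd y > 0" using assms by (auto simp: half_space_def)
  have q: "snd q < 0" using y by (simp add: q_def)
  have lor: "lorentz i j u = (i \<bullet> j) / 2 * fund_sol u + k * ((u \<bullet> i) * (u \<bullet> j) / norm u ^ n)"
    if "i \<in> Basis" "j \<in> Basis" for i j u :: "'a \<times> real"
    using that inner_Basis[OF that]
    by (simp add: lorentz_def Let_def n_def k_def kap_def del: DIM_prod)
  have eps: "1 - 2 * (if j = e_n then 1 else 0) = \<epsilon>" and en: "e_n \<bullet> j = snd j"
    using Basis_prod_real_cases[OF assms(4)]
    by (auto simp: \<epsilon>_def inner_e_n inner_commute[of e_n])
  define F where "F = (\<lambda>\<xi>::'a. lorentz e_n j ((\<xi>, 0) - y))"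
  \<comment> \<open>On the boundary the normal component of (\<xi>, 0) - y is the constant - y_n, so
    the quadratic term of U_nj reduces to \<open>riesz j\<close>; \<epsilon>_j corrects the
    component of index j for the change of pole.\<close>
  have F: "F \<xi> = snd j / 2 * fund_sol ((\<xi>, 0) - q) - k * snd y * \<epsilon> * riesz j ((\<xi>, 0) - q)" for \<xi>
  proof -
    have e: "((\<xi>, 0) - y) \<bullet> j = \<epsilon> * (((\<xi>, 0) - q) \<bullet> j)"
      using Basis_prod_real_cases[OF assms(4)]
      by (auto simp: \<epsilon>_def q_def inner_prod_def)
    show ?thesis
      unfolding F_def lor[OF e_n_Basis assms(4)] en e
      by (simp add: fund_sol_radial riesz_def n_def q_def norm_minus_reflect[of \<xi> y] inner_e_n del: DIM_prod)
  qed
  \<comment> \<open>\<open>h\<close> extends the boundary data F to the half space by the two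
    Poisson formulas; \<open>h'\<close> is its derivative at x in direction i.\<close>
  define h where "h = (\<lambda>x. snd j / 2 * fund_sol (x - q) - k * snd y * \<epsilon> * riesz j (x - q))"
  define h' where "h' = snd j / 2 * (- 2 * k * riesz i z) - k * snd y * \<epsilon> *
      ((i \<bullet> j) / norm z ^ n - real n * (z \<bullet> i) * (z \<bullet> j) / norm z ^ (n + 2))"
  have z0: "z \<noteq> 0" using x y by (auto simp: z_def prod_eq_iff)
  obtain K where K: "\<And>\<xi>::'a. \<bar>fund_sol ((\<xi>, 0) - q)\<bar> \<le> K * sqrt (1 + norm \<xi>)"
    using fund_sol_growth[OF q] by blast
  define R where "R = norm j / snd y ^ (n - 1)"
  have R: "\<bar>riesz j ((\<xi>, 0) - q)\<bar> \<le> R" for \<xi>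
    unfolding R_def n_def using y norm_snd_le[of "snd y" "\<xi> - fst y"]
    by (intro abs_riesz_le) (auto simp: norm_prod_def q_def)
  have RR: "\<bar>riesz j ((\<xi>, 0) - q)\<bar> \<le> R * sqrt (1 + norm \<xi>)" for \<xi>
  proof -
    have "R * 1 \<le> R * sqrt (1 + norm \<xi>)" using R[of \<xi>] by (intro mult_left_mono) auto
    then show ?thesis using R[of \<xi>] by simp
  qed
  have "(\<integral>\<xi>. odqvist i e_n (x - (\<xi>, 0)) * F \<xi> \<partial>lborel) = snd i * h x - snd x * h'"
  proof (rule odqvist_integral)
    show "F \<in> borel_measurable borel" unfolding F by measurable
    show "\<bar>F \<xi>\<bar> \<le> (\<bar>snd j / 2\<bar> * K + \<bar>k * snd y * \<epsilon>\<bar> * R) * sqrt (1 + norm \<xi>)" for \<xi>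
    proof -
      have "\<bar>F \<xi>\<bar> \<le> \<bar>snd j / 2\<bar> * \<bar>fund_sol ((\<xi>, 0) - q)\<bar> + \<bar>k * snd y * \<epsilon>\<bar> * \<bar>riesz j ((\<xi>, 0) - q)\<bar>"
        unfolding F abs_mult[symmetric] by (rule abs_triangle_ineq4)
      also have "\<dots> \<le> \<bar>snd j / 2\<bar> * (K * sqrt (1 + norm \<xi>)) + \<bar>k * snd y * \<epsilon>\<bar> * (R * sqrt (1 + norm \<xi>))"
        by (intro add_mono mult_left_mono K RR) auto
      finally show ?thesis by (simp add: algebra_simps)
    qed
    show "(\<integral>\<xi>. poisson (x - (\<xi>, 0)) * F \<xi> \<partial>lborel) = poisson_mass TYPE('a) * h x" if x: "snd x > 0" for x
    proof -
      have i1: "integrable lborel (\<lambda>\<xi>. poisson (x - (\<xi>, 0)) * fund_sol ((\<xi>, 0) - q))"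
        by (rule integrable_poisson_mult[OF x _ K]) measurable
      have i2: "integrable lborel (\<lambda>\<xi>. poisson (x - (\<xi>, 0)) * riesz j ((\<xi>, 0) - q))"
        by (rule integrable_poisson_mult[OF x _ RR]) measurable
      have "(\<integral>\<xi>. poisson (x - (\<xi>, 0)) * F \<xi> \<partial>lborel)
          = (\<integral>\<xi>. snd j / 2 * (poisson (x - (\<xi>, 0)) * fund_sol ((\<xi>, 0) - q))
             - k * snd y * \<epsilon> * (poisson (x - (\<xi>, 0)) * riesz j ((\<xi>, 0) - q)) \<partial>lborel)"
        unfolding F by (intro Bochner_Integration.integral_cong refl) (simp add: algebra_simps)
      also have "\<dots> = snd j / 2 * (\<integral>\<xi>. poisson (x - (\<xi>, 0)) * fund_sol ((\<xi>, 0) - q) \<partial>lborel)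
          - k * snd y * \<epsilon> * (\<integral>\<xi>. poisson (x - (\<xi>, 0)) * riesz j ((\<xi>, 0) - q) \<partial>lborel)"
        by (subst Bochner_Integration.integral_diff[OF integrable_mult_right[OF i1] integrable_mult_right[OF i2]])
           (simp only: integral_mult_right_zero)
      also have "\<dots> = poisson_mass TYPE('a) * h x"
        unfolding poisson_integral_fund_sol[OF x q] poisson_integral_riesz[OF x q assms(4)] h_def
        by (simp add: algebra_simps)
      finally show ?thesis .
    qed
    have e: "x + t *\<^sub>R i - q = z + t *\<^sub>R i" for t by (simp add: z_def q_def)
    have "z + 0 *\<^sub>R i \<noteq> 0" using z0 by simp
    from DERIV_fund_sol_line[OF this]
    have E': "((\<lambda>t. fund_sol (z + t *\<^sub>R i)) has_real_derivative - 2 * k * riesz i z) (at 0)"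
      by (simp add: k_def n_def del: DIM_prod)
    show "((\<lambda>t. h (x + t *\<^sub>R i)) has_real_derivative h') (at 0)"
      unfolding h_def h'_def e n_def
      by (intro DERIV_diff DERIV_cmult E' DERIV_riesz_line z0)
  qed (use assms x in auto)
  then have "green i j x y = lorentz i j w - \<epsilon> * lorentz i j z - 2 * (snd i * h x - snd x * h')"
    by (simp add: green_def eps F_def w_def z_def)
  also have "\<dots> = green_explicit i j x y"
  proof -
    \<comment> \<open>With the inverse powers replaced by atoms and the values of E left alone, the
      identity becomes polynomial. It is checked for i and j each normal or tangential, since w and
      z differ in the normal component only.\<close>
    define A B C where "A = 1 / norm w ^ n" and "B = 1 / norm z ^ n" and "C = 1 / norm z ^ (n + 2)"
    have div: "u / norm w ^ n = u * A" "u / norm z ^ n = u * B" "u / norm z ^ (n + 2) = u * C" for u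
      by (simp_all add: A_def B_def C_def)
    have h: "h x = snd j / 2 * fund_sol z - k * snd y * \<epsilon> * ((z \<bullet> j) * B)"
      by (simp add: h_def z_def q_def riesz_def B_def n_def del: DIM_prod)
    have h': "h' = snd j / 2 * (- 2 * k * ((z \<bullet> i) * B)) - k * snd y * \<epsilon> *
        ((i \<bullet> j) * B - real n * (z \<bullet> i) * (z \<bullet> j) * C)"
      unfolding h'_def div riesz_def n_def[symmetric] ..
    have w1: "w \<bullet> b = z \<bullet> b" if "snd b = 0" for b
      using that by (simp add: w_def z_def inner_prod_def)
    have w3: "snd w = snd x - snd y" "snd z = snd x + snd y"
      by (simp_all add: w_def z_def)
    have ii: "i \<bullet> j = (if i = j then 1 else 0)" using assms by (simp add: inner_Basis)
    show ?thesis
      unfolding green_explicit_def Let_def n_def[symmetric] k_def[symmetric] w_def[symmetric] z_def[symmetric]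
        lor[OF assms(3,4)] h h' div \<epsilon>_def[symmetric]
      using Basis_prod_real_cases[OF assms(3)] Basis_prod_real_cases[OF assms(4)]
      by (elim disjE) (auto simp: w1 w3 ii en inner_e_n \<epsilon>_def algebra_simps add_divide_distrib diff_divide_distrib)
  qed
  finally show ?thesis .
qed

section \<open>Homogeneous functions and their derivatives\<close>

text \<open>
  The set \<open>D\<close> only serves to bound the linear forms: \<open>x\<^sub>n\<close> and \<open>y\<^sub>n\<close> are controlled by \<open>|x - y\<^sup>*|\<close> on
  \<open>x\<^sub>n, y\<^sub>n \<ge> 0\<close>, but not everywhere.
\<close>

inductive homog :: "('v::euclidean_space \<Rightarrow> 'w::euclidean_space) \<Rightarrow> 'v set \<Rightarrow> int \<Rightarrow> ('v \<Rightarrow> real) \<Rightarrow> bool"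
  for L D where
  const: "homog L D 0 (\<lambda>_. c)"
| lin: "linear l \<Longrightarrow> (\<And>p. p \<in> D \<Longrightarrow> \<bar>l p\<bar> \<le> C * norm (L p)) \<Longrightarrow> homog L D 1 l"
| power: "homog L D k (\<lambda>p. norm (L p) powi k)"
| add: "homog L D k f \<Longrightarrow> homog L D k g \<Longrightarrow> homog L D k (\<lambda>p. f p + g p)"
| mult: "homog L D k f \<Longrightarrow> homog L D m g \<Longrightarrow> homog L D (k + m) (\<lambda>p. f p * g p)"

lemma homog_mult':
  "homog L D k f \<Longrightarrow> homog L D m g \<Longrightarrow> l = k + m \<Longrightarrow> homog L D l (\<lambda>p. f p * g p)"
  using homog.mult by blast

lemma homog_cmult: "homog L D k f \<Longrightarrow> homog L D k (\<lambda>p. c * f p)"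
  using homog.mult[OF homog.const] by simp

lemma homog_inner:
  assumes "linear L"
  shows "homog L D 1 (\<lambda>p. L p \<bullet> u)"
proof (rule homog.lin)
  show "linear (\<lambda>p. L p \<bullet> u)"
    using linear_compose[OF assms, of "\<lambda>x. x \<bullet> u"]
    by (simp add: o_def bounded_linear_inner_left bounded_linear.linear)
  show "\<bar>L p \<bullet> u\<bar> \<le> norm u * norm (L p)" for p
    using Cauchy_Schwarz_ineq2[of "L p" u] by (simp add: mult.commute)
qed

lemma homog_bound:
  assumes "homog L D k f"
  shows "\<exists>C\<ge>0. \<forall>p\<in>D. L p \<noteq> 0 \<longrightarrow> \<bar>f p\<bar> \<le> C * norm (L p) powi k"
  using assms
proof induction
  case (const c)
  then show ?case by (intro exI[of _ "\<bar>c\<bar>"]) auto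
next
  case (lin l C)
  have "\<bar>l p\<bar> \<le> max C 0 * norm (L p) powi 1" if "p \<in> D" for p
    using order_trans[OF lin(2)[OF that] mult_right_mono[of C "max C 0" "norm (L p)"]] by simp
  then show ?case by (intro exI[of _ "max C 0"]) auto
next
  case (power k)
  then show ?case by (intro exI[of _ 1]) auto
next
  case (add k f g)
  then obtain A B where "A \<ge> 0" "\<forall>p\<in>D. L p \<noteq> 0 \<longrightarrow> \<bar>f p\<bar> \<le> A * norm (L p) powi k"
    "B \<ge> 0" "\<forall>p\<in>D. L p \<noteq> 0 \<longrightarrow> \<bar>g p\<bar> \<le> B * norm (L p) powi k" by blast
  then show ?case
    by (intro exI[of _ "A + B"]) (force simp: distrib_right intro: order_trans[OF abs_triangle_ineq] add_mono)
next
  case (mult k f m g)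
  then obtain A B where AB: "A \<ge> 0" "\<forall>p\<in>D. L p \<noteq> 0 \<longrightarrow> \<bar>f p\<bar> \<le> A * norm (L p) powi k"
    "B \<ge> 0" "\<forall>p\<in>D. L p \<noteq> 0 \<longrightarrow> \<bar>g p\<bar> \<le> B * norm (L p) powi m" by blast
  have "\<bar>f p * g p\<bar> \<le> A * B * norm (L p) powi (k + m)" if "p \<in> D" "L p \<noteq> 0" for p
  proof -
    have "\<bar>f p * g p\<bar> \<le> (A * norm (L p) powi k) * (B * norm (L p) powi m)"
      unfolding abs_mult using AB that by (intro mult_mono) (auto intro!: mult_nonneg_nonneg)
    then show ?thesis using that by (simp add: power_int_add mult_ac)
  qed
  then show ?case using AB by (intro exI[of _ "A * B"]) auto
qed

lemma has_derivative_norm_powi: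
  assumes "bounded_linear L" "L p \<noteq> 0"
  shows "((\<lambda>p. norm (L p) powi k) has_derivative
     (\<lambda>b. of_int k * (L p \<bullet> L b) * norm (L p) powi (k - 2))) (at p)"
proof -
  have "((\<lambda>p. norm (L p)) has_derivative (\<lambda>b. L b \<bullet> sgn (L p))) (at p)"
    by (rule has_derivative_compose[OF bounded_linear_imp_has_derivative[OF assms(1)] has_derivative_norm[OF assms(2)]])
  from has_derivative_power_int[OF _ this]
  have "((\<lambda>p. norm (L p) powi k) has_derivative
      (\<lambda>b. (L b \<bullet> sgn (L p)) * (of_int k * norm (L p) powi (k - 1)))) (at p)"
    using assms(2) by simp
  moreover have "norm (L p) powi (k - 1) = norm (L p) powi (k - 2) * norm (L p)"
    using assms(2) power_int_add[of "norm (L p)" "k - 2" 1] by simp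
  then have "(L b \<bullet> sgn (L p)) * (of_int k * norm (L p) powi (k - 1)) =
      of_int k * (L p \<bullet> L b) * norm (L p) powi (k - 2)" for b
    using assms(2) by (simp add: sgn_div_norm inner_commute divide_inverse[symmetric])
  ultimately show ?thesis by simp
qed

text \<open>The second derivatives are carried along for their symmetry, from which the commuting of
  partial derivatives is read off later. Homogeneity of higher derivatives comes from applying the
  lemma again to \<open>f' b\<close>.\<close>

lemma homog_derivative:
  assumes "bounded_linear L" "homog L D k f"
  shows "\<exists>f' f''. (\<forall>b. homog L D (k - 1) (f' b)) \<and>
    (\<forall>p. L p \<noteq> 0 \<longrightarrow> (f has_derivative (\<lambda>b. f' b p)) (at p)) \<and>
    (\<forall>b p. L p \<noteq> 0 \<longrightarrow> (f' b has_derivative (\<lambda>c. f'' b c p)) (at p)) \<and>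
    (\<forall>b c p. f'' b c p = f'' c b p)"
  using assms(2)
proof induction
  case (const c)
  \<comment> \<open>The zero function has every degree; degree - 1 is obtained by writing it as 0
    times a power of the norm.\<close>
  have "homog L D (- 1) (\<lambda>p. 0 * norm (L p) powi (- 1))"
    by (rule homog_mult'[OF homog.const homog.power]) simp
  then show ?case by (intro exI[of _ "\<lambda>b p. 0"] exI[of _ "\<lambda>b c p. 0"]) auto
next
  case (lin l C)
  have "bounded_linear l" using lin(1) by (simp add: linear_conv_bounded_linear)
  then show ?case
    by (intro exI[of _ "\<lambda>b p. l b"] exI[of _ "\<lambda>b c p. 0"])
       (auto intro: homog.const bounded_linear_imp_has_derivative)
next
  case (power k)
  have lin: "linear L" using assms(1) by (rule bounded_linear.linear)
  let ?f' = "\<lambda>b p. of_int k * (L p \<bullet> L b) * norm (L p) powi (k - 2)"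
  let ?f'' = "\<lambda>b c p. of_int k * ((L c \<bullet> L b) * norm (L p) powi (k - 2)
      + (L p \<bullet> L b) * (of_int (k - 2) * (L p \<bullet> L c) * norm (L p) powi (k - 2 - 2)))"
  have "homog L D (k - 1) (?f' b)" for b
    by (rule homog_mult'[OF homog_cmult[OF homog_inner[OF lin]] homog.power]) simp
  moreover have "(?f' b has_derivative (\<lambda>c. ?f'' b c p)) (at p)" if "L p \<noteq> 0" for b p
  proof -
    have "((\<lambda>p. L p \<bullet> L b) has_derivative (\<lambda>c. L c \<bullet> L b)) (at p)"
      by (rule bounded_linear_imp_has_derivative
          [OF bounded_linear_compose[OF bounded_linear_inner_left assms(1)]])
    from has_derivative_mult_right[OF has_derivative_mult[OF this
        has_derivative_norm_powi[OF assms(1) that, of "k - 2"]], of "of_int k"]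
    show ?thesis
      by (simp only: mult.assoc) (simp add: add.commute)
  qed
  moreover have "?f'' b c p = ?f'' c b p" for b c p
    by (simp add: inner_commute[of "L c" "L b"] mult_ac)
  ultimately show ?case
    by (intro exI[of _ ?f'] exI[of _ ?f'']) (auto intro: has_derivative_norm_powi assms(1))
next
  case (add k f g)
  then obtain f' f'' g' g'' where f: "\<And>b. homog L D (k - 1) (f' b)"
      "\<And>p. L p \<noteq> 0 \<Longrightarrow> (f has_derivative (\<lambda>b. f' b p)) (at p)"
      "\<And>b p. L p \<noteq> 0 \<Longrightarrow> (f' b has_derivative (\<lambda>c. f'' b c p)) (at p)"
      "\<And>b c p. f'' b c p = f'' c b p"
    and g: "\<And>b. homog L D (k - 1) (g' b)"
      "\<And>p. L p \<noteq> 0 \<Longrightarrow> (g has_derivative (\<lambda>b. g' b p)) (at p)"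
      "\<And>b p. L p \<noteq> 0 \<Longrightarrow> (g' b has_derivative (\<lambda>c. g'' b c p)) (at p)"
      "\<And>b c p. g'' b c p = g'' c b p" by blast
  show ?case
    by (intro exI[of _ "\<lambda>b p. f' b p + g' b p"] exI[of _ "\<lambda>b c p. f'' b c p + g'' b c p"] conjI allI impI
        homog.add has_derivative_add f(1-3) g(1-3)) (auto simp: f(4) g(4))
next
  case (mult k f m g)
  then obtain f' f'' g' g'' where f: "\<And>b. homog L D (k - 1) (f' b)"
      "\<And>p. L p \<noteq> 0 \<Longrightarrow> (f has_derivative (\<lambda>b. f' b p)) (at p)"
      "\<And>b p. L p \<noteq> 0 \<Longrightarrow> (f' b has_derivative (\<lambda>c. f'' b c p)) (at p)"
      "\<And>b c p. f'' b c p = f'' c b p"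
    and g: "\<And>b. homog L D (m - 1) (g' b)"
      "\<And>p. L p \<noteq> 0 \<Longrightarrow> (g has_derivative (\<lambda>b. g' b p)) (at p)"
      "\<And>b p. L p \<noteq> 0 \<Longrightarrow> (g' b has_derivative (\<lambda>c. g'' b c p)) (at p)"
      "\<And>b c p. g'' b c p = g'' c b p" by blast
  have "homog L D (k + m - 1) (\<lambda>p. f p * g' b p + f' b p * g p)" for b
    by (intro homog.add homog_mult'[OF mult(1) g(1)] homog_mult'[OF f(1) mult(2)]) auto
  moreover have "((\<lambda>p. f p * g' b p + f' b p * g p) has_derivative
      (\<lambda>c. (f p * g'' b c p + f' c p * g' b p) + (f' b p * g' c p + f'' b c p * g p))) (at p)"
    if "L p \<noteq> 0" for b p
    by (intro has_derivative_add has_derivative_mult f(2,3) g(2,3) that)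
  ultimately show ?case
    by (intro exI[of _ "\<lambda>b p. f p * g' b p + f' b p * g p"]
        exI[of _ "\<lambda>b c p. (f p * g'' b c p + f' c p * g' b p) + (f' b p * g' c p + f'' b c p * g p)"]
        conjI allI impI has_derivative_mult f(2) g(2)) (auto simp: f(4) g(4))
qed

section \<open>Partial derivatives along lines and on open sets\<close>

lemma DERIV_line:
  assumes "(f has_derivative F) (at (p + t *\<^sub>R b))"
  shows "((\<lambda>t. f (p + t *\<^sub>R b)) has_real_derivative F b) (at t)"
proof -
  have "((\<lambda>t. p + t *\<^sub>R b) has_derivative (\<lambda>h. h *\<^sub>R b)) (at t)"
    by (auto intro!: derivative_eq_intros)
  from has_derivative_compose[OF this assms]
  show ?thesis
    by (rule has_derivative_imp_has_field_derivative)
       (simp add: linear_cmul[OF has_derivative_linear[OF assms]] mult.commute)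
qed

lemma partial_eqI:
  assumes "(f has_derivative F) (at p)"
  shows "partial b f p = F b"
  using DERIV_line[of f F p 0 b] assms unfolding partial_def by (intro DERIV_imp_deriv) simp

lemma has_derivative_partial:
  assumes "f differentiable (at p)"
  shows "(f has_derivative (\<lambda>b. partial b f p)) (at p)"
proof -
  obtain F where "(f has_derivative F) (at p)" using assms by (auto simp: differentiable_def)
  moreover from this have "F = (\<lambda>b. partial b f p)" by (simp add: partial_eqI fun_eq_iff)
  ultimately show ?thesis by simp
qed

text \<open>A partial derivative sees only the germ of a function. This transfers derivatives
  between the Green tensor and its closed form, whose agreement is known on an open set
  only.\<close>

lemma partial_cong_open:
  assumes "open S" "p \<in> S" "\<And>q. q \<in> S \<Longrightarrow> f q = g q"
  shows "partial b f p = partial b g p"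
  unfolding partial_def
proof (rule deriv_cong_ev)
  have "((\<lambda>t. p + t *\<^sub>R b) \<longlongrightarrow> p + 0 *\<^sub>R b) (nhds 0)"
    by (intro tendsto_intros filterlim_ident)
  then have "\<forall>\<^sub>F t in nhds 0. p + t *\<^sub>R b \<in> S"
    using assms(1,2) by (auto dest: topological_tendstoD)
  then show "\<forall>\<^sub>F t in nhds 0. f (p + t *\<^sub>R b) = g (p + t *\<^sub>R b)"
    by eventually_elim (rule assms(3))
qed simp

lemma foldr_partial_cong_open:
  assumes "open S" "\<And>q. q \<in> S \<Longrightarrow> f q = g q" "p \<in> S"
  shows "foldr partial bs f p = foldr partial bs g p"
  using assms(3)
proof (induction bs arbitrary: p)
  case (Cons b bs)
  then show ?case using partial_cong_open[OF assms(1), of p "foldr partial bs f" "foldr partial bs g"] by simp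
qed (use assms in simp)

section \<open>Symbols on pairs of points\<close>

definition sep :: "('a::euclidean_space \<times> real) \<times> ('a \<times> real) \<Rightarrow> 'a \<times> real" where
  "sep p = fst p - snd p"

definition sep_refl :: "('a::euclidean_space \<times> real) \<times> ('a \<times> real) \<Rightarrow> 'a \<times> real" where
  "sep_refl p = fst p - reflect (snd p)"

text \<open>Heights may be zero or negative here: the closed form extends across the boundary, so
  two-sided derivatives exist at points with x_n = 0 or y_n = 0.\<close>

definition regular :: "(('a::euclidean_space \<times> real) \<times> ('a \<times> real)) set" where
  "regular = {p. sep p \<noteq> 0 \<and> sep_refl p \<noteq> 0}"

definition quadrant :: "(('a::euclidean_space \<times> real) \<times> ('a \<times> real)) set" where
  "quadrant = {p. 0 \<le> snd (fst p) \<and> 0 \<le> snd (snd p)}"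

lemma bounded_linear_sep: "bounded_linear sep"
  unfolding sep_def[abs_def] by (intro bounded_linear_intros)

lemma bounded_linear_sep_refl:
  "bounded_linear (sep_refl :: ('a::euclidean_space \<times> real) \<times> ('a \<times> real) \<Rightarrow> 'a \<times> real)"
  unfolding linear_conv_bounded_linear[symmetric]
  by (rule linearI) (simp_all add: sep_refl_def reflect_def prod_eq_iff algebra_simps)

lemma open_regular: "open (regular :: (('a::euclidean_space \<times> real) \<times> ('a \<times> real)) set)"
proof -
  let ?s = "sep :: ('a \<times> real) \<times> ('a \<times> real) \<Rightarrow> 'a \<times> real"
  let ?r = "sep_refl :: ('a \<times> real) \<times> ('a \<times> real) \<Rightarrow> 'a \<times> real"
  have "continuous_on UNIV ?s" "continuous_on UNIV ?r"
    by (rule linear_continuous_on[OF bounded_linear_sep] linear_continuous_on[OF bounded_linear_sep_refl])+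
  then have "open (?s -` (- {0}))" "open (?r -` (- {0}))"
    by (auto intro!: open_vimage)
  then have "open (?s -` (- {0}) \<inter> ?r -` (- {0}))"
    by (rule open_Int)
  also have "?s -` (- {0}) \<inter> ?r -` (- {0}) = regular"
    by (auto simp: regular_def)
  finally show ?thesis .
qed

text \<open>The squares of the two norms differ by 4 * x_n * y_n.\<close>

lemma norm_sep_le:
  assumes "p \<in> quadrant"
  shows "norm (sep p) \<le> norm (sep_refl p)"
  using assms
  by (auto simp: quadrant_def sep_def sep_refl_def norm_prod_def power2_eq_square algebra_simps intro!: real_sqrt_le_mono)

text \<open>Denominators in |x - y| and in |z| are kept in separate summands, each of which is
  closed under differentiation. Agreement on the open set \<open>regular\<close> determines the
  derivatives there.\<close>

definition green_symbol :: "int \<Rightarrow> (('a::euclidean_space \<times> real) \<times> ('a \<times> real) \<Rightarrow> real) \<Rightarrow> bool" where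
  "green_symbol k f \<longleftrightarrow> (\<exists>A B. homog sep UNIV k A \<and> homog sep_refl quadrant k B \<and>
     (\<forall>p\<in>regular. f p = A p + B p))"

lemma green_symbol_derivative:
  assumes "green_symbol k f"
  shows "p \<in> regular \<Longrightarrow> (f has_derivative (\<lambda>b. partial b f p)) (at p)"
    and "green_symbol (k - 1) (partial b f)"
    and "p \<in> regular \<Longrightarrow> partial b (partial c f) p = partial c (partial b f) p"
proof -
  obtain A B where AB: "homog sep UNIV k A" "homog sep_refl quadrant k B"
    and f: "\<And>p. p \<in> regular \<Longrightarrow> f p = A p + B p"
    using assms unfolding green_symbol_def by blast
  obtain A' A'' where A: "\<And>b. homog sep UNIV (k - 1) (A' b)"
      "\<And>p. sep p \<noteq> 0 \<Longrightarrow> (A has_derivative (\<lambda>b. A' b p)) (at p)"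
      "\<And>b p. sep p \<noteq> 0 \<Longrightarrow> (A' b has_derivative (\<lambda>c. A'' b c p)) (at p)"
      "\<And>b c p. A'' b c p = A'' c b p"
    using homog_derivative[OF bounded_linear_sep AB(1)] by blast
  obtain B' B'' where B: "\<And>b. homog sep_refl quadrant (k - 1) (B' b)"
      "\<And>p. sep_refl p \<noteq> 0 \<Longrightarrow> (B has_derivative (\<lambda>b. B' b p)) (at p)"
      "\<And>b p. sep_refl p \<noteq> 0 \<Longrightarrow> (B' b has_derivative (\<lambda>c. B'' b c p)) (at p)"
      "\<And>b c p. B'' b c p = B'' c b p"
    using homog_derivative[OF bounded_linear_sep_refl AB(2)] by blast
  have d1: "(f has_derivative (\<lambda>b. A' b p + B' b p)) (at p)" if "p \<in> regular" for p
  proof (rule has_derivative_transform_within_open[OF _ open_regular that])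
    show "((\<lambda>p. A p + B p) has_derivative (\<lambda>b. A' b p + B' b p)) (at p)"
      using that by (intro has_derivative_add A(2) B(2)) (auto simp: regular_def)
  qed (simp add: f)
  have p1: "partial b f p = A' b p + B' b p" if "p \<in> regular" for b p
    by (rule partial_eqI[OF d1[OF that]])
  show "(f has_derivative (\<lambda>b. partial b f p)) (at p)" if "p \<in> regular"
    using d1[OF that] p1[OF that] by simp
  show "green_symbol (k - 1) (partial b f)"
    unfolding green_symbol_def using A(1)[of b] B(1)[of b] p1 by blast
  have p2: "partial b (partial c f) p = A'' c b p + B'' c b p" if "p \<in> regular" for b c p
  proof -
    have "partial b (partial c f) p = partial b (\<lambda>p. A' c p + B' c p) p"
      by (rule partial_cong_open[OF open_regular that p1])
    also have "\<dots> = A'' c b p + B'' c b p"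
      using that by (intro partial_eqI has_derivative_add A(3) B(3)) (auto simp: regular_def)
    finally show ?thesis .
  qed
  show "partial b (partial c f) p = partial c (partial b f) p" if "p \<in> regular"
    unfolding p2[OF that] by (simp add: A(4)[of b] B(4)[of b])
qed

text \<open>On \<open>quadrant\<close> one has |x - y| \<le> |z|, and a nonpositive degree turns
  this into |z|^k \<le> |x - y|^k.\<close>

lemma green_symbol_bound:
  assumes "green_symbol k f" "k \<le> 0"
  obtains C where "C \<ge> 0" "\<And>p. p \<in> regular \<Longrightarrow> p \<in> quadrant \<Longrightarrow> \<bar>f p\<bar> \<le> C * norm (sep p) powi k"
proof -
  obtain A B where AB: "homog sep UNIV k A" "homog sep_refl quadrant k B"
    and f: "\<And>p. p \<in> regular \<Longrightarrow> f p = A p + B p"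
    using assms unfolding green_symbol_def by blast
  obtain c where c: "c \<ge> 0" "\<And>p. sep p \<noteq> 0 \<Longrightarrow> \<bar>A p\<bar> \<le> c * norm (sep p) powi k"
    using homog_bound[OF AB(1)] by auto
  obtain d where d: "d \<ge> 0" "\<And>p. p \<in> quadrant \<Longrightarrow> sep_refl p \<noteq> 0 \<Longrightarrow> \<bar>B p\<bar> \<le> d * norm (sep_refl p) powi k"
    using homog_bound[OF AB(2)] by auto
  show ?thesis
  proof
    show "c + d \<ge> 0" using c d by simp
    fix p :: "('a \<times> real) \<times> ('a \<times> real)"
    assume p: "p \<in> regular" "p \<in> quadrant"
    have "norm (sep_refl p) powi k \<le> norm (sep p) powi k"
    proof (cases "k = 0")
      case False
      then show ?thesis
        using assms(2) p norm_sep_le[OF p(2)] by (intro power_int_antimono) (auto simp: regular_def)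
    qed simp
    then have "\<bar>B p\<bar> \<le> d * norm (sep p) powi k"
      using d p by (intro order_trans[OF d(2)] mult_left_mono) (auto simp: regular_def)
    moreover have "\<bar>A p\<bar> \<le> c * norm (sep p) powi k"
      using c p by (auto simp: regular_def)
    ultimately show "\<bar>f p\<bar> \<le> (c + d) * norm (sep p) powi k"
      unfolding f[OF p(1)] distrib_right by linarith
  qed
qed

lemma green_symbol_cong:
  assumes "green_symbol k f" "\<And>p. p \<in> regular \<Longrightarrow> g p = f p"
  shows "green_symbol k g"
  using assms unfolding green_symbol_def by (metis (no_types, lifting))

lemma green_symbol_add:
  assumes "green_symbol k f" "green_symbol k g"
  shows "green_symbol k (\<lambda>p. f p + g p)"
proof -
  obtain A B A' B' where "homog sep UNIV k A" "homog sep_refl quadrant k B"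
    "homog sep UNIV k A'" "homog sep_refl quadrant k B'"
    "\<And>p. p \<in> regular \<Longrightarrow> f p = A p + B p" "\<And>p. p \<in> regular \<Longrightarrow> g p = A' p + B' p"
    using assms unfolding green_symbol_def by blast
  then show ?thesis
    unfolding green_symbol_def
    by (intro exI[of _ "\<lambda>p. A p + A' p"] exI[of _ "\<lambda>p. B p + B' p"]) (auto intro: homog.add)
qed

lemma partial_add:
  assumes "f differentiable (at p)" "g differentiable (at p)"
  shows "partial b (\<lambda>p. f p + g p) p = partial b f p + partial b g p"
  by (rule partial_eqI[OF has_derivative_add[OF has_derivative_partial[OF assms(1)] has_derivative_partial[OF assms(2)]]])

lemma green_symbol_differentiable:
  "green_symbol k f \<Longrightarrow> p \<in> regular \<Longrightarrow> f differentiable (at p)"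
  using green_symbol_derivative(1) unfolding differentiable_def by blast

lemma divide_power_eq_powi: "(u::real) / r ^ n = u * r powi (- int n)"
  by (simp add: power_int_minus divide_inverse)

text \<open>Up to - 2 * kap n, the derivative in direction b of E(x - y) - E(z) as a function of the
  pair. For n = 2 this difference of logarithms is no symbol, but its derivative is.\<close>

definition riesz_gradient where
  "riesz_gradient b p = riesz (sep b) (sep p) - riesz (sep_refl b) (sep_refl p)"

lemma green_symbol_riesz_gradient:
  "green_symbol (1 - int DIM('a \<times> real))
     (\<lambda>p. c * riesz_gradient b (p :: ('a::euclidean_space \<times> real) \<times> ('a \<times> real)))"
proof -
  have "homog L D (1 - int DIM('a \<times> real)) (\<lambda>p. a * riesz (L b) (L p))"
    if "bounded_linear L" for L :: "('a \<times> real) \<times> ('a \<times> real) \<Rightarrow> 'a \<times> real" and D a b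
    unfolding riesz_def divide_power_eq_powi
    by (intro homog_cmult homog_mult'[OF homog_inner[OF bounded_linear.linear[OF that]] homog.power]) simp
  from this[OF bounded_linear_sep, of UNIV c] this[OF bounded_linear_sep_refl, of quadrant "- c"]
  show ?thesis
    unfolding green_symbol_def riesz_gradient_def
    by (intro exI[of _ "\<lambda>p. c * riesz (sep b) (sep p)"] exI[of _ "\<lambda>p. - c * riesz (sep_refl b) (sep_refl p)"])
       (auto simp: algebra_simps)
qed

lemma partial_riesz_linear:
  assumes "bounded_linear L" "L p \<noteq> (0 :: 'w::euclidean_space)"
  shows "partial b (\<lambda>p. riesz (L c) (L p)) p =
    (L b \<bullet> L c) / norm (L p) ^ DIM('w) - real DIM('w) * (L p \<bullet> L b) * (L p \<bullet> L c) / norm (L p) ^ (DIM('w) + 2)"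
proof -
  interpret bounded_linear L by fact
  show ?thesis
    using DERIV_riesz_line[OF assms(2), of "L c" "L b"]
    unfolding partial_def add scaleR by (rule DERIV_imp_deriv)
qed

text \<open>Symmetry of the Hessian of E, read off from the explicit second derivatives:
  \<open>green_symbol_derivative\<close> gives symmetry only for derivatives of a symbol, and E is
  none for n = 2.\<close>

lemma partial_riesz_gradient_commute:
  assumes "p \<in> regular"
  shows "partial b (\<lambda>p. s * riesz_gradient c p) p = partial c (\<lambda>p. s * riesz_gradient b p) p"
proof -
  have eq: "partial b (\<lambda>p. s * riesz_gradient c p) p =
      s * (partial b (\<lambda>p. riesz (sep c) (sep p)) p - partial b (\<lambda>p. riesz (sep_refl c) (sep_refl p)) p)" for b c
  proof (rule partial_eqI)
    have d: "(\<lambda>p. riesz (L c) (L p)) differentiable (at p)"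
      if L: "bounded_linear L" and "L p \<noteq> 0" for L :: "_ \<Rightarrow> 'a \<times> real"
    proof -
      have "homog L UNIV (1 - int DIM('a \<times> real)) (\<lambda>p. riesz (L c) (L p))"
        unfolding riesz_def divide_power_eq_powi
        by (intro homog_mult'[OF homog_inner[OF bounded_linear.linear[OF L]] homog.power]) simp
      from homog_derivative[OF L this] show ?thesis
        using that unfolding differentiable_def by blast
    qed
    show "((\<lambda>p. s * riesz_gradient c p) has_derivative (\<lambda>b.
        s * (partial b (\<lambda>p. riesz (sep c) (sep p)) p - partial b (\<lambda>p. riesz (sep_refl c) (sep_refl p)) p))) (at p)"
      unfolding riesz_gradient_def using assms
      by (intro has_derivative_mult_right has_derivative_diff has_derivative_partial d
          bounded_linear_sep bounded_linear_sep_refl) (auto simp: regular_def)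
  qed
  have "sep p \<noteq> 0" "sep_refl p \<noteq> 0" using assms by (auto simp: regular_def)
  then show ?thesis
    unfolding eq
    by (simp add: partial_riesz_linear bounded_linear_sep bounded_linear_sep_refl inner_commute[of "sep b" "sep c"]
        inner_commute[of "sep_refl b" "sep_refl c"] mult_ac del: DIM_prod)
qed

section \<open>The closed form as a symbol\<close>

definition green_map ::
  "'a::euclidean_space \<times> real \<Rightarrow> 'a \<times> real \<Rightarrow> ('a \<times> real) \<times> ('a \<times> real) \<Rightarrow> real" where
  "green_map i j p = green_explicit i j (fst p) (snd p)"

text \<open>The closed form without E: rational in the components and the two norms, hence
  homogeneous of degree 2 - n in every dimension.\<close>

definition green_rational ::
  "'a::euclidean_space \<times> real \<Rightarrow> 'a \<times> real \<Rightarrow> ('a \<times> real) \<times> ('a \<times> real) \<Rightarrow> real" where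
  "green_rational i j p = green_map i j p - (i \<bullet> j) / 2 * (fund_sol (sep p) - fund_sol (sep_refl p))"

lemma green_symbol_rational:
  fixes i j :: "'a::euclidean_space \<times> real"
  shows "green_symbol (2 - int DIM('a \<times> real)) (green_rational i j)"
proof -
  define n where "n = DIM('a \<times> real)"
  define k where "k = kap n"
  have lin: "linear sep" "linear sep_refl"
    by (rule bounded_linear.linear, rule bounded_linear_sep bounded_linear_sep_refl)+
  have s: "homog sep UNIV 1 (\<lambda>p. sep p \<bullet> u)" for u :: "'a \<times> real"
    by (rule homog_inner[OF lin(1)])
  have z: "homog sep_refl quadrant 1 (\<lambda>p. sep_refl p \<bullet> u)" for u :: "'a \<times> real"
    by (rule homog_inner[OF lin(2)])
  \<comment> \<open>On \<open>quadrant\<close> the components of x - y also have degree one relative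
    to z. This admits the mixed term with numerator w_i w_j and denominator |z|^n.\<close>
  have w: "homog sep_refl quadrant 1 (\<lambda>p. sep p \<bullet> u)" for u :: "'a \<times> real"
  proof (rule homog.lin)
    show "linear (\<lambda>p. sep p \<bullet> u)"
      using linear_compose[OF lin(1), of "\<lambda>x. x \<bullet> u"]
      by (simp add: o_def bounded_linear_inner_left bounded_linear.linear)
    show "\<bar>sep p \<bullet> u\<bar> \<le> norm u * norm (sep_refl p)" if "p \<in> quadrant" for p
      using Cauchy_Schwarz_ineq2[of "sep p" u] mult_left_mono[OF norm_sep_le[OF that], of "norm u"]
      by (simp add: mult.commute)
  qed
  have le: "\<bar>snd (fst p) + snd (snd p)\<bar> \<le> norm (sep_refl p)" for p :: "('a \<times> real) \<times> ('a \<times> real)"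
  proof -
    have "sep_refl p = (fst (fst p) - fst (snd p), snd (fst p) + snd (snd p))"
      by (simp add: sep_refl_def prod_eq_iff)
    then show ?thesis
      using norm_snd_le[of "snd (fst p) + snd (snd p)" "fst (fst p) - fst (snd p)"] by simp
  qed
  \<comment> \<open>Both heights are nonnegative on \<open>quadrant\<close>, so each is at most
    their sum, the last component of z.\<close>
  have xn: "homog sep_refl quadrant 1 (\<lambda>p::('a \<times> real) \<times> ('a \<times> real). snd (fst p))"
    and yn: "homog sep_refl quadrant 1 (\<lambda>p::('a \<times> real) \<times> ('a \<times> real). snd (snd p))"
  proof -
    have "\<bar>snd (fst p)\<bar> \<le> 1 * norm (sep_refl p)" "\<bar>snd (snd p)\<bar> \<le> 1 * norm (sep_refl p)"
      if "p \<in> quadrant" for p :: "('a \<times> real) \<times> ('a \<times> real)"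
      using le[of p] that by (auto simp: quadrant_def)
    then show "homog sep_refl quadrant 1 (\<lambda>p::('a \<times> real) \<times> ('a \<times> real). snd (fst p))"
      "homog sep_refl quadrant 1 (\<lambda>p::('a \<times> real) \<times> ('a \<times> real). snd (snd p))"
      by (intro homog.lin[where C = 1]; simp add: linear_iff)+
  qed
  have "homog sep UNIV (2 - int n) (\<lambda>p. k * (sep p \<bullet> i) * (sep p \<bullet> j) * norm (sep p) powi (- int n))"
    by (rule homog_mult'[OF homog_mult'[OF homog_cmult[OF s] s] homog.power]) auto
  moreover have "homog sep_refl quadrant (2 - int n) (\<lambda>p.
      (- k) * (sep p \<bullet> i) * (sep p \<bullet> j) * norm (sep_refl p) powi (- int n)
      + ((- 2 * k * (i \<bullet> j)) * snd (fst p) * snd (snd p) * norm (sep_refl p) powi (- int n)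
      + (2 * k * real n * (1 - 2 * snd j)) * snd (fst p) * snd (snd p) * (sep_refl p \<bullet> i) * (sep_refl p \<bullet> j)
          * norm (sep_refl p) powi (- int (n + 2))))" (is "homog _ _ _ ?B")
    by (intro homog.add homog_mult'[OF homog_mult'[OF homog_cmult[OF w] w] homog.power]
        homog_mult'[OF homog_mult'[OF homog_cmult[OF xn] yn] homog.power]
        homog_mult'[OF homog_mult'[OF homog_mult'[OF homog_mult'[OF homog_cmult[OF xn] yn] z] z] homog.power]) auto
  moreover have "green_rational i j p = k * (sep p \<bullet> i) * (sep p \<bullet> j) * norm (sep p) powi (- int n) + ?B p" for p
    unfolding green_rational_def green_map_def green_explicit_def Let_def n_def[symmetric] k_def[symmetric]
      sep_def[symmetric] sep_refl_def[symmetric] divide_power_eq_powi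
    by (simp add: algebra_simps)
  ultimately show ?thesis
    unfolding green_symbol_def n_def[symmetric] by blast
qed

lemma green_map_split:
  "green_map i j p = (i \<bullet> j) / 2 * (fund_sol (sep p) - fund_sol (sep_refl p)) + green_rational i j p"
  by (simp add: green_rational_def)

lemma green_map_derivative:
  fixes i j :: "'a::euclidean_space \<times> real"
  assumes "p \<in> regular"
  shows "(green_map i j has_derivative (\<lambda>b. partial b (green_map i j) p)) (at p)"
    and "partial b (green_map i j) p =
      - kap DIM('a \<times> real) * (i \<bullet> j) * riesz_gradient b p + partial b (green_rational i j) p"
proof -
  let ?k = "kap DIM('a \<times> real)"
  have "sep p \<noteq> 0" "sep_refl p \<noteq> 0" using assms by (auto simp: regular_def)
  then have *: "(green_map i j has_derivative (\<lambda>b. (i \<bullet> j) / 2 *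
      (- 2 * ?k * riesz (sep b) (sep p) - (- 2 * ?k * riesz (sep_refl b) (sep_refl p))) + partial b (green_rational i j) p)) (at p)"
    unfolding green_map_split[abs_def]
    by (intro has_derivative_add has_derivative_mult_right has_derivative_diff
        green_symbol_derivative(1)[OF green_symbol_rational assms]
        has_derivative_compose[OF bounded_linear_imp_has_derivative[OF bounded_linear_sep] has_derivative_fund_sol]
        has_derivative_compose[OF bounded_linear_imp_has_derivative[OF bounded_linear_sep_refl] has_derivative_fund_sol])
  then show "(green_map i j has_derivative (\<lambda>b. partial b (green_map i j) p)) (at p)"
    by (intro has_derivative_partial) (auto simp: differentiable_def)
  show "partial b (green_map i j) p = - ?k * (i \<bullet> j) * riesz_gradient b p + partial b (green_rational i j) p"
    unfolding partial_eqI[OF *] riesz_gradient_def by (simp add: algebra_simps)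
qed

text \<open>The first derivative replaces E by its gradient, so the degree 1 - n is right for n = 2
  as well.\<close>

lemma green_symbol_partial_green:
  fixes i j :: "'a::euclidean_space \<times> real"
  shows "green_symbol (1 - int DIM('a \<times> real)) (partial b (green_map i j))"
proof -
  have "green_symbol (1 - int DIM('a \<times> real)) (partial b (green_rational i j))"
    using green_symbol_derivative(2)[OF green_symbol_rational, of b i j] by simp
  from green_symbol_add[OF green_symbol_riesz_gradient this]
  show ?thesis by (rule green_symbol_cong) (rule green_map_derivative(2))
qed

lemma partial_green_commute:
  assumes "p \<in> regular"
  shows "partial b (partial c (green_map i j)) p = partial c (partial b (green_map i j)) p"
proof -
  let ?k = "kap DIM('a \<times> real)"
  have eq: "partial b (partial c (green_map i j)) p =
      partial b (\<lambda>p. - ?k * (i \<bullet> j) * riesz_gradient c p) p + partial b (partial c (green_rational i j)) p" for b c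
  proof -
    have "partial b (partial c (green_map i j)) p =
        partial b (\<lambda>p. - ?k * (i \<bullet> j) * riesz_gradient c p + partial c (green_rational i j) p) p"
      by (rule partial_cong_open[OF open_regular assms green_map_derivative(2)])
    also have "\<dots> = partial b (\<lambda>p. - ?k * (i \<bullet> j) * riesz_gradient c p) p + partial b (partial c (green_rational i j)) p"
      by (intro partial_add green_symbol_differentiable[OF green_symbol_riesz_gradient assms]
          green_symbol_differentiable[OF green_symbol_derivative(2)[OF green_symbol_rational] assms])
    finally show ?thesis .
  qed
  show ?thesis
    unfolding eq using partial_riesz_gradient_commute[OF assms, of b "- ?k * (i \<bullet> j)" c]
      green_symbol_derivative(3)[OF green_symbol_rational assms, of b c i j] by simp
qed

lemma foldr_partial_green_symbol:
  fixes i j :: "'a::euclidean_space \<times> real"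
  assumes "ds \<noteq> []"
  shows "green_symbol (2 - int DIM('a \<times> real) - int (length ds)) (foldr partial ds (green_map i j))"
  using assms
proof (induction ds)
  case (Cons d ds)
  show ?case
  proof (cases "ds = []")
    case True
    then show ?thesis using green_symbol_partial_green[of d i j] by simp
  next
    case False
    from green_symbol_derivative(2)[OF Cons.IH[OF this], of d] show ?thesis
      by (simp add: algebra_simps)
  qed
qed simp

text \<open>Every nonempty list gives a symbol. The empty list, that is the tensor itself, is
  covered by the separate treatment of E.\<close>

lemma foldr_partial_green_derivative:
  assumes "p \<in> regular"
  shows "(foldr partial ds (green_map i j) has_derivative (\<lambda>b. partial b (foldr partial ds (green_map i j)) p)) (at p)"
    and "partial b (partial c (foldr partial ds (green_map i j))) p = partial c (partial b (foldr partial ds (green_map i j))) p"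
proof (atomize(full), cases "ds = []")
  case True
  then show "(foldr partial ds (green_map i j) has_derivative (\<lambda>b. partial b (foldr partial ds (green_map i j)) p)) (at p) \<and>
      partial b (partial c (foldr partial ds (green_map i j))) p = partial c (partial b (foldr partial ds (green_map i j))) p"
    using green_map_derivative(1)[OF assms] partial_green_commute[OF assms] by simp
next
  case False
  then show "(foldr partial ds (green_map i j) has_derivative (\<lambda>b. partial b (foldr partial ds (green_map i j)) p)) (at p) \<and>
      partial b (partial c (foldr partial ds (green_map i j))) p = partial c (partial b (foldr partial ds (green_map i j))) p"
    using green_symbol_derivative(1,3)[OF foldr_partial_green_symbol assms] by blast
qed

text \<open>There are finitely many i, j and lists of m basis directions, so the individual
  constants can be summed to one that depends on m and the dimension alone.\<close>

lemma foldr_partial_green_bound: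
  fixes m :: nat
  assumes "m > 0"
  obtains C where "C \<ge> 0"
    "\<And>i j ds p. i \<in> Basis \<Longrightarrow> j \<in> Basis \<Longrightarrow> set ds \<subseteq> Basis \<Longrightarrow> length ds = m \<Longrightarrow>
      p \<in> regular \<Longrightarrow> p \<in> quadrant \<Longrightarrow>
      \<bar>foldr partial ds (green_map i (j :: 'a::euclidean_space \<times> real)) p\<bar>
        \<le> C / norm (sep p) ^ (DIM('a \<times> real) - 2 + m)"
proof -
  let ?n = "DIM('a \<times> real)"
  define T where "T = (Basis :: ('a \<times> real) set) \<times> (Basis :: ('a \<times> real) set) \<times>
      {ds :: (('a \<times> real) \<times> ('a \<times> real)) list. set ds \<subseteq> Basis \<and> length ds = m}"
  have fin: "finite T" unfolding T_def by (intro finite_cartesian_product finite_lists_length_eq) auto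
  have "\<exists>C\<ge>0. \<forall>p\<in>regular \<inter> quadrant. \<bar>foldr partial ds (green_map i j) p\<bar> \<le> C / norm (sep p) ^ (?n - 2 + m)"
    if "(i, j, ds) \<in> T" for i j :: "'a \<times> real" and ds
  proof -
    have "ds \<noteq> []" and l: "length ds = m" using that assms by (auto simp: T_def)
    have n2: "?n \<ge> 2" by (rule DIM_prod_real_ge_2)
    have e: "2 - int ?n - int (length ds) = - int (?n - 2 + m)" using l n2 by linarith
    have "2 - int ?n - int (length ds) \<le> 0" using n2 by linarith
    from green_symbol_bound[OF foldr_partial_green_symbol[OF \<open>ds \<noteq> []\<close>] this]
    obtain C where "C \<ge> 0" "\<And>p. p \<in> regular \<Longrightarrow> p \<in> quadrant \<Longrightarrow>
        \<bar>foldr partial ds (green_map i j) p\<bar> \<le> C * norm (sep p) powi (2 - int ?n - int (length ds))"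
      by blast
    then show ?thesis unfolding e divide_power_eq_powi by auto
  qed
  then have "\<forall>t\<in>T. \<exists>C. C \<ge> 0 \<and> (\<forall>p\<in>regular \<inter> quadrant.
      \<bar>foldr partial (snd (snd t)) (green_map (fst t) (fst (snd t))) p\<bar> \<le> C / norm (sep p) ^ (?n - 2 + m))"
    by (metis prod.collapse)
  from bchoice[OF this] obtain Cf where Cf': "\<forall>t\<in>T. Cf t \<ge> 0 \<and> (\<forall>p\<in>regular \<inter> quadrant.
      \<bar>foldr partial (snd (snd t)) (green_map (fst t) (fst (snd t))) p\<bar> \<le> Cf t / norm (sep p) ^ (?n - 2 + m))"
    by blast
  have Cf: "t \<in> T \<Longrightarrow> Cf t \<ge> 0"
    "(i, j, ds) \<in> T \<Longrightarrow> p \<in> regular \<inter> quadrant \<Longrightarrow>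
      \<bar>foldr partial ds (green_map i j) p\<bar> \<le> Cf (i, j, ds) / norm (sep p) ^ (?n - 2 + m)" for t i j p and ds :: "(('a \<times> real) \<times> ('a \<times> real)) list"
    using Cf' by force+
  show ?thesis
  proof
    show "sum Cf T \<ge> 0" using Cf(1) by (intro sum_nonneg)
    fix i j :: "'a \<times> real" and ds :: "(('a \<times> real) \<times> ('a \<times> real)) list"
      and p :: "('a \<times> real) \<times> ('a \<times> real)"
    assume a: "i \<in> Basis" "j \<in> Basis" "set ds \<subseteq> Basis" "length ds = m" "p \<in> regular" "p \<in> quadrant"
    then have t: "(i, j, ds) \<in> T" by (simp add: T_def)
    have "\<bar>foldr partial ds (green_map i j) p\<bar> \<le> Cf (i, j, ds) / norm (sep p) ^ (?n - 2 + m)"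
      using Cf(2)[OF t] a by blast
    also have "\<dots> \<le> sum Cf T / norm (sep p) ^ (?n - 2 + m)"
      using Cf(1) by (intro divide_right_mono member_le_sum[OF t _ fin]) auto
    finally show "\<bar>foldr partial ds (green_map i j) p\<bar> \<le> sum Cf T / norm (sep p) ^ (?n - 2 + m)" .
  qed
qed

section \<open>Boundary behaviour\<close>

text \<open>The line through p in direction b stays in the hyperplane l = 0, where f vanishes near
  p.\<close>

lemma partial_vanish:
  assumes "open S" "p \<in> S" "linear l" "l p = (0::real)" "l b = 0"
    and "\<And>q. q \<in> S \<Longrightarrow> l q = 0 \<Longrightarrow> f q = 0"
  shows "partial b f p = 0"
proof -
  \<comment> \<open>Agrees with f on S and is zero on the whole hyperplane, also where the line has
    left S.\<close>
  let ?g = "\<lambda>q. if l q = 0 then 0 else f q"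
  have "partial b f p = partial b ?g p"
    by (rule partial_cong_open[OF assms(1,2)]) (simp add: assms(6))
  also have "\<dots> = 0"
    using assms(3-5) by (simp add: partial_def linear_add linear_cmul)
  finally show ?thesis .
qed

lemma foldr_partial_vanish:
  assumes "open S" "linear l" "p \<in> S" "l p = (0::real)" "\<And>d. d \<in> set ds \<Longrightarrow> l d = 0"
    and "\<And>q. q \<in> S \<Longrightarrow> l q = 0 \<Longrightarrow> f q = 0"
  shows "foldr partial ds f p = 0"
  using assms(3-5)
proof (induction ds arbitrary: p)
  case (Cons d ds)
  have "partial d (foldr partial ds f) p = 0"
    by (rule partial_vanish[OF assms(1) Cons.prems(1) assms(2)]) (use Cons in auto)
  then show ?case by simp
qed (use assms(6) in simp)

lemma linear_fst_height: "linear (\<lambda>p::('a::euclidean_space \<times> real) \<times> ('a \<times> real). snd (fst p))"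
  and linear_snd_height: "linear (\<lambda>p::('a::euclidean_space \<times> real) \<times> ('a \<times> real). snd (snd p))"
  by (simp_all add: linear_iff)

lemma green_map_boundary:
  assumes "snd (fst p) = 0 \<or> snd (snd p) = 0"
  shows "green_map i j p = 0"
proof -
  have "norm (fst p - snd p) = norm (fst p - reflect (snd p))"
    using assms by (auto simp: norm_prod_def)
  then show ?thesis
    using assms by (auto simp: green_map_def green_explicit_def Let_def fund_sol_radial simp del: DIM_prod)
qed

lemma DERIV_inverse_norm_power_line:
  fixes x b :: "'v::euclidean_space"
  assumes "x \<noteq> 0"
  shows "((\<lambda>t. 1 / norm (x + t *\<^sub>R b) ^ n) has_real_derivative - real n * (x \<bullet> b) / norm x ^ (n + 2)) (at 0)"
proof (cases n)
  case (Suc m)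
  have N: "((\<lambda>t. norm (x + t *\<^sub>R b)) has_real_derivative (x \<bullet> b) / norm x) (at 0)"
    using DERIV_norm_line[of x 0 b] assms by simp
  have "((\<lambda>t. 1 / norm (x + t *\<^sub>R b) ^ n) has_real_derivative
      - (real n * ((x \<bullet> b) / norm x) * norm x ^ (n - 1)) / (norm x ^ n * norm x ^ n)) (at 0)"
    using assms by (auto intro!: derivative_eq_intros N[THEN DERIV_cong])
  then show ?thesis
    by (rule DERIV_cong) (use assms in \<open>simp add: Suc field_simps power2_eq_square\<close>)
qed simp

text \<open>For j = n the y_n-derivatives cancel in pairs at y_n = 0: the difference of fundamental
  solutions against the term with x_n * y_n * (i \<bullet> j), and the term in w_i w_n against the
  one in z_i z_n. This is the source of the extra factor y_n in the estimate for G_in.\<close>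

lemma partial_green_map_normal:
  fixes p :: "('a::euclidean_space \<times> real) \<times> ('a \<times> real)"
  assumes "p \<in> regular" "snd (snd p) = 0"
  shows "partial (0, e_n) (green_map i e_n) p = 0"
proof -
  define n where "n = DIM('a \<times> real)"
  define k where "k = kap n"
  define z where "z = fst p - snd p"
  define a where "a = snd (fst p)"
  let ?e = "e_n :: 'a \<times> real"
  have refl: "fst p - reflect (snd p) = z" using assms(2) by (simp add: z_def prod_eq_iff)
  have z0: "z \<noteq> 0" using assms(1) by (simp add: regular_def sep_def z_def)
  have sz: "snd z = a" using assms(2) by (simp add: z_def a_def)
  have Em: "((\<lambda>t. fund_sol (z + t *\<^sub>R (- ?e))) has_real_derivative 2 * k * a / norm z ^ n) (at 0)"
    using DERIV_fund_sol_line[of z 0 "- ?e"] z0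
    by (simp add: riesz_def inner_e_n sz k_def n_def del: DIM_prod)
  have Ep: "((\<lambda>t. fund_sol (z + t *\<^sub>R ?e)) has_real_derivative - 2 * k * a / norm z ^ n) (at 0)"
    using DERIV_fund_sol_line[of z 0 ?e] z0
    by (simp add: riesz_def inner_e_n sz k_def n_def del: DIM_prod)
  have Nm: "((\<lambda>t. 1 / norm (z + t *\<^sub>R (- ?e)) ^ n) has_real_derivative real n * a / norm z ^ (n + 2)) (at 0)"
    using DERIV_inverse_norm_power_line[OF z0, of "- ?e" n] by (simp add: inner_e_n sz)
  have Np: "((\<lambda>t. 1 / norm (z + t *\<^sub>R ?e) ^ m) has_real_derivative - real m * a / norm z ^ (m + 2)) (at 0)" for m
    using DERIV_inverse_norm_power_line[OF z0, of ?e m] by (simp add: inner_e_n sz)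
  \<comment> \<open>Raising y by t turns x - y into z - t e_n and \<open>x - reflect y\<close> into
    z + t e_n, where z is their common value at t = 0.\<close>
  have line: "green_map i e_n (p + t *\<^sub>R (0, e_n)) =
      snd i / 2 * (fund_sol (z + t *\<^sub>R (- ?e)) - fund_sol (z + t *\<^sub>R ?e))
      + k * (z \<bullet> i - t * snd i) * (a - t) * (1 / norm (z + t *\<^sub>R (- ?e)) ^ n - 1 / norm (z + t *\<^sub>R ?e) ^ n)
      - 2 * k * (a * t) * snd i * (1 / norm (z + t *\<^sub>R ?e) ^ n)
      + 2 * k * real n * (- 1) * (a * t) * (z \<bullet> i + t * snd i) * (a + t) * (1 / norm (z + t *\<^sub>R ?e) ^ (n + 2))" for t
  proof -
    have 1: "fst (p + t *\<^sub>R (0, e_n)) - snd (p + t *\<^sub>R (0, e_n)) = z + t *\<^sub>R (- ?e)"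
      by (simp add: z_def)
    have 2: "fst (p + t *\<^sub>R (0, e_n)) - reflect (snd (p + t *\<^sub>R (0, e_n))) = z + t *\<^sub>R ?e"
      using assms(2) by (simp add: z_def prod_eq_iff)
    have 3: "snd (fst (p + t *\<^sub>R (0, e_n))) * snd (snd (p + t *\<^sub>R (0, e_n))) = a * t"
      using assms(2) by (simp add: a_def)
    have ei: "?e \<bullet> i = snd i" by (simp add: inner_commute[of ?e] inner_e_n)
    have 4: "(z + t *\<^sub>R (- ?e)) \<bullet> i = z \<bullet> i - t * snd i" "snd (z + t *\<^sub>R (- ?e)) = a - t"
      "(z + t *\<^sub>R ?e) \<bullet> i = z \<bullet> i + t * snd i" "snd (z + t *\<^sub>R ?e) = a + t" "1 - 2 * snd ?e = - 1"
      by (simp_all add: inner_add_left inner_diff_left ei sz)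
    show ?thesis
      unfolding green_map_def green_explicit_def Let_def 1 2 3 n_def[symmetric] k_def[symmetric] 4 inner_e_n
      by (simp only: times_divide_eq_right mult_1_right)
  qed
  have "((\<lambda>t. green_map i e_n (p + t *\<^sub>R (0, e_n))) has_real_derivative
      snd i / 2 * (2 * k * a / norm z ^ n - - 2 * k * a / norm z ^ n)
      + k * (z \<bullet> i) * a * (real n * a / norm z ^ (n + 2) - - real n * a / norm z ^ (n + 2))
      - 2 * k * a * snd i * (1 / norm z ^ n)
      + 2 * k * real n * (- 1) * a * (z \<bullet> i) * a * (1 / norm z ^ (n + 2))) (at 0)"
  proof -
    \<comment> \<open>Terms with a factor t contribute only the value of the other factors at 0, and
      g1 0 = g2 0 removes the derivative of what stands in front of their difference.\<close>
    have gen: "((\<lambda>t. c * (f1 t - f2 t) + k * (u - t * v) * (a - t) * (g1 t - g2 t)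
        - 2 * k * (a * t) * v * g2 t + l * (a * t) * (u + t * v) * (a + t) * g3 t) has_real_derivative
        c * (F1 - F2) + k * u * a * (G1 - G2) - 2 * k * a * v * g2 0 + l * a * u * a * g3 0) (at 0)"
      if "(f1 has_real_derivative F1) (at 0)" "(f2 has_real_derivative F2) (at 0)"
        "(g1 has_real_derivative G1) (at 0)" "(g2 has_real_derivative G2) (at 0)"
        "(g3 has_real_derivative G3) (at 0)" "g1 0 = g2 0"
      for f1 f2 g1 g2 g3 :: "real \<Rightarrow> real" and F1 F2 G1 G2 G3 c l u v
      by (rule DERIV_cong, (rule that(1-5) DERIV_const DERIV_ident DERIV_add DERIV_diff DERIV_mult)+)
         (simp add: that(6))
    show ?thesis
      unfolding line using gen[OF Em Ep Nm Np[of n] Np[of "n + 2"], of "snd i / 2" "z \<bullet> i" "snd i" "2 * k * real n * (- 1)"]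
      by (simp only: scaleR_zero_left add_0_right simp_thms)
  qed
  also have "snd i / 2 * (2 * k * a / norm z ^ n - - 2 * k * a / norm z ^ n)
      + k * (z \<bullet> i) * a * (real n * a / norm z ^ (n + 2) - - real n * a / norm z ^ (n + 2))
      - 2 * k * a * snd i * (1 / norm z ^ n)
      + 2 * k * real n * (- 1) * a * (z \<bullet> i) * a * (1 / norm z ^ (n + 2)) = 0"
    by (simp add: algebra_simps)
  finally show ?thesis unfolding partial_def by (rule DERIV_imp_deriv)
qed

text \<open>By symmetry of second derivatives the normal derivative can be moved inwards past each
  tangential one. Innermost it vanishes on y_n = 0, and tangential derivatives preserve
  this.\<close>

lemma foldr_partial_green_normal:
  fixes p :: "('a::euclidean_space \<times> real) \<times> ('a \<times> real)"
  assumes "p \<in> regular" "snd (snd p) = 0" "\<And>d. d \<in> set ds \<Longrightarrow> snd (snd d) = 0"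
  shows "partial (0, e_n) (foldr partial ds (green_map i e_n)) p = 0"
  using assms
proof (induction ds arbitrary: p)
  case (Cons d ds)
  have "partial (0, e_n) (foldr partial (d # ds) (green_map i e_n)) p
      = partial d (partial (0, e_n) (foldr partial ds (green_map i e_n))) p"
    using foldr_partial_green_derivative(2)[OF Cons.prems(1), of "(0, e_n)" d ds i e_n] by simp
  also have "\<dots> = 0"
    by (rule partial_vanish[OF open_regular Cons.prems(1) linear_snd_height]) (use Cons in auto)
  finally show ?case .
qed (simp add: partial_green_map_normal)

section \<open>Lowering the heights of two points\<close>

definition move :: "('a::euclidean_space \<times> real) \<times> ('a \<times> real) \<Rightarrow> real \<Rightarrow> real \<Rightarrow> ('a \<times> real) \<times> ('a \<times> real)" where
  "move p s t = ((fst (fst p), s), (fst (snd p), t))"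

lemma move_self: "move p (snd (fst p)) (snd (snd p)) = p"
  by (simp add: move_def)

text \<open>Let a and b be the old heights and v the tangential part. As |(v, s - t)| = |(v, t -
  s)|, |z| exceeds the new distance by at most (a + b) - (s - t) and by at most (a + b) - (t - s).
  If one height is kept, it cancels in one of these and at most twice the small height remains, so
  at most |z| / 4; if both are small, either expression is at most 3 |z| / 8.\<close>

lemma move_sep:
  assumes p: "p \<in> quadrant" "sep_refl p \<noteq> 0"
    and st: "0 \<le> s" "s \<le> snd (fst p)" "0 \<le> t" "t \<le> snd (snd p)"
    and "s = snd (fst p) \<or> snd (fst p) \<le> norm (sep_refl p) / 8"
    and "t = snd (snd p) \<or> snd (snd p) \<le> norm (sep_refl p) / 8"
    and "snd (fst p) \<le> norm (sep_refl p) / 8 \<or> snd (snd p) \<le> norm (sep_refl p) / 8"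
  shows "norm (sep_refl p) / 2 \<le> norm (sep (move p s t))" "move p s t \<in> regular" "move p s t \<in> quadrant"
proof -
  let ?a = "snd (fst p)" and ?b = "snd (snd p)" and ?v = "fst (fst p) - fst (snd p)"
  let ?r = "norm (sep_refl p)"
  have z: "sep_refl p = (?v, ?a + ?b)" by (simp add: sep_refl_def prod_eq_iff)
  have w: "sep (move p s t) = (?v, s - t)" by (simp add: sep_def move_def)
  have tri: "norm (v, u) \<le> norm (v, u') + \<bar>u - u'\<bar>" for v :: 'a and u u' :: real
    using norm_triangle_ineq[of "(v, u')" "(0, u - u')"] by (simp add: norm_Pair)
  have "norm (?v, t - s) = norm (?v, s - t)" by (simp add: norm_Pair power2_commute)
  then have "norm (?v, ?a + ?b) \<le> norm (?v, s - t) + \<bar>?a + ?b - (s - t)\<bar>"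
    "norm (?v, ?a + ?b) \<le> norm (?v, s - t) + \<bar>?a + ?b - (t - s)\<bar>"
    using tri[of ?v "?a + ?b" "s - t"] tri[of ?v "?a + ?b" "t - s"] by simp_all
  then have "?r \<le> norm (sep (move p s t)) + ((?a + ?b) - (s - t))"
    "?r \<le> norm (sep (move p s t)) + ((?a + ?b) - (t - s))"
    unfolding z w using st by simp_all
  moreover have "?r \<ge> 0" by simp
  ultimately show half: "?r / 2 \<le> norm (sep (move p s t))"
    using assms(7-9) st by linarith
  show q: "move p s t \<in> quadrant" using st by (simp add: quadrant_def move_def)
  have "?r > 0" using p by simp
  then have "norm (sep (move p s t)) > 0" using half by linarith
  moreover from this have "norm (sep_refl (move p s t)) > 0" using norm_sep_le[OF q] by linarith
  ultimately show "move p s t \<in> regular" by (simp add: regular_def)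
qed

lemma abs_le_of_derivative_bound:
  fixes f :: "real \<Rightarrow> real"
  assumes "f 0 = 0" "T \<ge> 0"
    and der: "\<And>t. 0 \<le> t \<Longrightarrow> t \<le> T \<Longrightarrow> (f has_real_derivative f' t) (at t)"
    and bnd: "\<And>t. 0 \<le> t \<Longrightarrow> t \<le> T \<Longrightarrow> \<bar>f' t\<bar> \<le> B"
  shows "\<bar>f T\<bar> \<le> T * B"
proof -
  have "norm (f T - f 0) \<le> B * norm (T - 0)"
    by (rule field_differentiable_bound[where S = "{0..T}" and f' = f'])
       (use assms in \<open>auto intro: has_field_derivative_at_within\<close>)
  then show ?thesis using assms by (simp add: mult.commute)
qed

lemma DERIV_move:
  assumes "(f has_derivative (\<lambda>b. partial b f (move p s t))) (at (move p s t))"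
  shows "((\<lambda>s. f (move p s t)) has_real_derivative partial (e_n, 0) f (move p s t)) (at s)"
    and "((\<lambda>t. f (move p s t)) has_real_derivative partial (0, e_n) f (move p s t)) (at t)"
proof -
  have 1: "move p 0 t + s *\<^sub>R (e_n, 0) = move p s t" for s by (simp add: move_def e_n_def)
  have 2: "move p s 0 + t *\<^sub>R (0, e_n) = move p s t" for t by (simp add: move_def e_n_def)
  show "((\<lambda>s. f (move p s t)) has_real_derivative partial (e_n, 0) f (move p s t)) (at s)"
    using DERIV_line[of f _ "move p 0 t" s "(e_n, 0)"] assms unfolding 1 by blast
  show "((\<lambda>t. f (move p s t)) has_real_derivative partial (0, e_n) f (move p s t)) (at t)"
    using DERIV_line[of f _ "move p s 0" t "(0, e_n)"] assms unfolding 2 by blast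
qed

section \<open>Smoothness of the Green tensor\<close>

lemma half_space_regular:
  assumes "x \<in> half_space" "y \<in> half_space" "x \<noteq> y"
  shows "(x, y) \<in> regular" "(x, y) \<in> quadrant"
  using assms by (auto simp: half_space_def regular_def quadrant_def sep_def sep_refl_def prod_eq_iff)

lemma open_half_space_pairs:
  "open {(x, y). x \<in> half_space \<and> y \<in> half_space \<and> x \<noteq> (y :: 'a::euclidean_space \<times> real)}"
proof -
  have "open {p. 0 < snd (fst p) \<and> 0 < snd (snd p) \<and> fst p \<noteq> (snd p :: 'a \<times> real)}"
    by (intro open_Collect_conj open_Collect_less open_Collect_neq continuous_intros)
  also have "{p. 0 < snd (fst p) \<and> 0 < snd (snd p) \<and> fst p \<noteq> (snd p :: 'a \<times> real)}
      = {(x, y). x \<in> half_space \<and> y \<in> half_space \<and> x \<noteq> y}"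
    by (auto simp: half_space_def)
  finally show ?thesis .
qed

lemma foldr_partial_green_eq:
  assumes "i \<in> Basis" "j \<in> Basis" "x \<in> half_space" "y \<in> half_space" "x \<noteq> y"
  shows "foldr partial ds (\<lambda>(x, y). green i j x y) (x, y) = foldr partial ds (green_map i j) (x, y)"
  by (rule foldr_partial_cong_open[OF open_half_space_pairs])
     (use assms in \<open>auto simp: green_map_def green_eq_explicit\<close>)

lemma green_smooth_on:
  fixes i j :: "'a::euclidean_space \<times> real"
  assumes "i \<in> Basis" "j \<in> Basis"
  shows "smooth_on {(x, y). x \<in> half_space \<and> y \<in> half_space \<and> x \<noteq> y} (\<lambda>(x, y). green i j x y)"
  unfolding smooth_on_def
proof (intro allI impI differentiable_at_imp_differentiable_on)
  fix bs :: "(('a \<times> real) \<times> ('a \<times> real)) list" and p :: "('a \<times> real) \<times> ('a \<times> real)"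
  let ?S = "{(x, y :: 'a \<times> real). x \<in> half_space \<and> y \<in> half_space \<and> x \<noteq> y}"
  assume "p \<in> ?S"
  then have p: "p \<in> regular" using half_space_regular(1)[of "fst p" "snd p"] by (cases p) auto
  have "(foldr partial bs (\<lambda>(x, y). green i j x y) has_derivative
      (\<lambda>b. partial b (foldr partial bs (green_map i j)) p)) (at p)"
  proof (rule has_derivative_transform_within_open[OF foldr_partial_green_derivative(1)[OF p] open_half_space_pairs \<open>p \<in> ?S\<close>])
    fix q assume "q \<in> ?S"
    then show "foldr partial bs (green_map i j) q = foldr partial bs (\<lambda>(x, y). green i j x y) q"
      using foldr_partial_green_eq[OF assms, of "fst q" "snd q"] by (cases q) auto
  qed
  then show "foldr partial bs (\<lambda>(x, y). green i j x y) differentiable (at p)"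
    by (auto simp: differentiable_def)
qed

section \<open>Multi-indices as lists of directions\<close>

definition multi_list :: "('v::euclidean_space \<Rightarrow> nat) \<Rightarrow> 'v list" where
  "multi_list \<alpha> = concat (map (\<lambda>b. replicate (\<alpha> b) b) basis_enum)"

lemma foldr_replicate: "foldr f (replicate n b) = (f b ^^ n)"
  by (induction n) (auto simp: fun_eq_iff)

lemma multi_deriv_eq_foldr: "multi_deriv \<alpha> f = foldr partial (multi_list \<alpha>) f"
proof -
  have "foldr (\<lambda>b. partial b ^^ \<alpha> b) bs f = foldr partial (concat (map (\<lambda>b. replicate (\<alpha> b) b) bs)) f" for bs
    by (induction bs)
       (simp_all only: list.map concat.simps foldr_append foldr.simps o_apply id_apply foldr_replicate)
  then show ?thesis by (simp only: multi_deriv_def multi_list_def)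
qed

lemma set_multi_list: "set (multi_list \<alpha>) = {b \<in> Basis. \<alpha> b \<noteq> 0}"
  unfolding multi_list_def set_concat set_map basis_enum(1) image_image by auto

lemma length_multi_list: "length (multi_list \<alpha>) = multi_order \<alpha>"
  unfolding multi_list_def length_concat map_map o_def length_replicate
    multi_order_def sum_list_distinct_conv_sum_set[OF basis_enum(2)] basis_enum(1) ..

text \<open>\<open>foldr\<close> applies the last entries first, so the y-directions stand at the
  end in order to be differentiated first, as in \<open>green_deriv\<close>.\<close>

definition pair_list :: "('v::euclidean_space \<Rightarrow> nat) \<Rightarrow> ('v \<Rightarrow> nat) \<Rightarrow> ('v \<times> 'v) list" where
  "pair_list \<alpha> \<beta> = map (\<lambda>b. (b, 0)) (multi_list \<alpha>) @ map (\<lambda>b. (0, b)) (multi_list \<beta>)"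

lemma foldr_partial_fst:
  "foldr partial (map (\<lambda>b. (b, 0)) bs) g (x, y) = foldr partial bs (\<lambda>x. g (x, y)) x"
  for x :: "'v::euclidean_space" and y :: "'w::euclidean_space"
proof (induction bs arbitrary: x)
  case (Cons b bs)
  then show ?case by (simp add: partial_def)
qed simp

lemma foldr_partial_snd:
  "foldr partial (map (\<lambda>b. (0, b)) bs) g (x, y) = foldr partial bs (\<lambda>y. g (x, y)) y"
  for x :: "'v::euclidean_space" and y :: "'w::euclidean_space"
proof (induction bs arbitrary: y)
  case (Cons b bs)
  then show ?case by (simp add: partial_def)
qed simp

lemma green_deriv_eq_foldr:
  "green_deriv \<alpha> \<beta> i j x y = foldr partial (pair_list \<alpha> \<beta>) (\<lambda>(x, y). green i j x y) (x, y)"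
  by (simp add: green_deriv_def multi_deriv_eq_foldr pair_list_def foldr_partial_fst foldr_partial_snd)

lemma pair_list_Basis: "set (pair_list \<alpha> \<beta>) \<subseteq> Basis"
  for \<alpha> \<beta> :: "'v::euclidean_space \<Rightarrow> nat"
  by (auto simp: pair_list_def set_multi_list Basis_prod_def[where 'a = 'v and 'b = 'v])

lemma length_pair_list: "length (pair_list \<alpha> \<beta>) = multi_order \<alpha> + multi_order \<beta>"
  by (simp add: pair_list_def length_multi_list)

text \<open>Directions in y have first component 0 and directions in x second component 0, so each
  multi-index governs its own half of the list.\<close>

lemma pair_list_tangential:
  fixes \<alpha> \<beta> :: "'a::euclidean_space \<times> real \<Rightarrow> nat"
  assumes "d \<in> set (pair_list \<alpha> \<beta>)"
  shows "\<alpha> e_n = 0 \<Longrightarrow> snd (fst d) = 0" "\<beta> e_n = 0 \<Longrightarrow> snd (snd d) = 0"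
proof -
  have *: "snd b = 0" if "b \<in> Basis" "\<gamma> b \<noteq> 0" "\<gamma> e_n = 0" for \<gamma> :: "_ \<Rightarrow> nat" and b :: "'a \<times> real"
    using that Basis_prod_real_cases[OF that(1)] by auto
  show "\<alpha> e_n = 0 \<Longrightarrow> snd (fst d) = 0" "\<beta> e_n = 0 \<Longrightarrow> snd (snd d) = 0"
    using assms * unfolding pair_list_def set_append set_map set_multi_list by fastforce+
qed

section \<open>Decay estimates\<close>

text \<open>The factor 2^(e + 3) in H pays for replacing a distance by r / 2 in powers up to e + 3,
  since at most three derivatives are added, one in x_n and two in y_n. A ratio a / r or b / r of at
  least 1 / 8 is inserted as 8 times itself, which is at least 1; a smaller one is gained from the
  mean value theorem. Each ratio thus costs a factor of at most 8, hence 8, 64 and 512.\<close>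

lemma green_map_estimates:
  fixes i j :: "'a::euclidean_space \<times> real" and p :: "('a \<times> real) \<times> ('a \<times> real)"
  defines "a \<equiv> snd (fst p)" and "b \<equiv> snd (snd p)"
    and "w \<equiv> norm (sep p)" and "r \<equiv> norm (sep_refl p)"
  assumes ij: "i \<in> Basis" "j \<in> Basis" and ds: "set ds \<subseteq> Basis" "length ds = m" and "m > 0"
    and p: "p \<in> regular" "p \<in> quadrant" and "C \<ge> 0"
    and C: "\<And>k ds q. k \<le> 3 \<Longrightarrow> set ds \<subseteq> Basis \<Longrightarrow> length ds = m + k \<Longrightarrow> q \<in> regular \<Longrightarrow> q \<in> quadrant \<Longrightarrow>
      \<bar>foldr partial ds (green_map i j) q\<bar> \<le> C / norm (sep q) ^ (e + k)"
  defines "H \<equiv> C * 2 ^ (e + 3) / w ^ e"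
  shows "\<bar>foldr partial ds (green_map i j) p\<bar> \<le> H"
    and "(\<And>d. d \<in> set ds \<Longrightarrow> snd (fst d) = 0) \<Longrightarrow>
      \<bar>foldr partial ds (green_map i j) p\<bar> \<le> 8 * (a / r) * H"
    and "(\<And>d. d \<in> set ds \<Longrightarrow> snd (fst d) = 0 \<and> snd (snd d) = 0) \<Longrightarrow>
      \<bar>foldr partial ds (green_map i j) p\<bar> \<le> 64 * (a / r) * (b / r) * H"
    and "(\<And>d. d \<in> set ds \<Longrightarrow> snd (fst d) = 0 \<and> snd (snd d) = 0) \<Longrightarrow> j = e_n \<Longrightarrow>
      \<bar>foldr partial ds (green_map i j) p\<bar> \<le> 512 * (a / r) * (b / r)\<^sup>2 * H"
proof -
  let ?g = "\<lambda>ds. foldr partial ds (green_map i j)"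
  let ?x = "(e_n, 0) :: ('a \<times> real) \<times> ('a \<times> real)" and ?y = "(0, e_n) :: ('a \<times> real) \<times> ('a \<times> real)"
  define M where "M = C * 2 ^ (e + 3)"
  define A B where "A = a / r" and "B = b / r"
  have M: "M \<ge> 0" using \<open>C \<ge> 0\<close> by (simp add: M_def)
  have w: "w > 0" and r: "r > 0" and wr: "w \<le> r"
    using p norm_sep_le[OF p(2)] by (auto simp: w_def r_def regular_def)
  have a: "a \<ge> 0" and b: "b \<ge> 0" using p(2) by (auto simp: a_def b_def quadrant_def)
  have AB: "A \<ge> 0" "B \<ge> 0" using a b r by (simp_all add: A_def B_def)
  have H: "H = M / w ^ e" by (simp add: H_def M_def)
  have H0: "H \<ge> 0" using M w by (simp add: H)
  have xy: "?x \<in> Basis" "?y \<in> Basis"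
    using e_n_Basis[where 'a='a] by (simp_all add: Basis_prod_def[where 'a="'a \<times> real" and 'b="'a \<times> real"])
  have pm: "move p a b = p" by (simp add: a_def b_def move_self)
  have F0: "\<bar>?g ds p\<bar> \<le> H"
  proof -
    have "\<bar>?g ds p\<bar> \<le> C / w ^ e" using C[of 0 ds p] ds p by (simp add: w_def)
    also have "\<dots> \<le> H"
      unfolding H M_def using \<open>C \<ge> 0\<close> w by (intro divide_right_mono) (auto intro: mult_left_mono[of 1 _ C, simplified])
    finally show ?thesis .
  qed
  \<comment> \<open>A height is lowered only when its ratio is below 1 / 8. The case of two large
    ratios is excluded because x and y may then be close to each other.\<close>
  have region: "r / 2 \<le> norm (sep (move p s t))" "move p s t \<in> regular" "move p s t \<in> quadrant"
    if "0 \<le> s" "s \<le> a" "0 \<le> t" "t \<le> b" "s = a \<or> A < 1 / 8" "t = b \<or> B < 1 / 8" "A < 1 / 8 \<or> B < 1 / 8" for s t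
  proof -
    have "A < 1 / 8 \<Longrightarrow> a \<le> r / 8" "B < 1 / 8 \<Longrightarrow> b \<le> r / 8"
      using r by (auto simp: A_def B_def field_simps)
    then show "r / 2 \<le> norm (sep (move p s t))" "move p s t \<in> regular" "move p s t \<in> quadrant"
      using that p move_sep[of p s t] unfolding a_def b_def r_def regular_def by blast+
  qed
  \<comment> \<open>At the displaced points the distance is at least r / 2, so derivatives are
    bounded in terms of r instead of w, each additional one gaining a factor 1 / r.\<close>
  have D: "\<bar>?g ds' (move p s t)\<bar> \<le> M / r ^ (e + k)"
    if "k \<le> 3" "set ds' \<subseteq> Basis" "length ds' = m + k"
      and st: "0 \<le> s" "s \<le> a" "0 \<le> t" "t \<le> b" "s = a \<or> A < 1 / 8" "t = b \<or> B < 1 / 8" "A < 1 / 8 \<or> B < 1 / 8"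
    for k ds' s t
  proof -
    have "\<bar>?g ds' (move p s t)\<bar> \<le> C / norm (sep (move p s t)) ^ (e + k)"
      using that(1-3) region[OF st] by (intro C)
    also have "\<dots> \<le> C / (r / 2) ^ (e + k)"
      using \<open>C \<ge> 0\<close> r region(1)[OF st] by (intro divide_left_mono power_mono mult_pos_pos zero_less_power) auto
    also have "\<dots> = C * 2 ^ (e + k) / r ^ (e + k)" by (simp add: power_divide)
    also have "\<dots> \<le> M / r ^ (e + k)"
      unfolding M_def using \<open>C \<ge> 0\<close> r that(1) by (intro divide_right_mono mult_left_mono power_increasing) auto
    finally show ?thesis .
  qed
  have y1: "\<bar>?g ds' (move p s t)\<bar> \<le> t * (M / r ^ (e + Suc k))"
    if k: "k \<le> 2" "set ds' \<subseteq> Basis" "length ds' = m + k"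
      and s: "0 \<le> s" "s \<le> a" "s = a \<or> A < 1 / 8" and t: "0 \<le> t" "t \<le> b" and B: "B < 1 / 8"
      and zero: "?g ds' (move p s 0) = 0" for k ds' s t
  proof (rule abs_le_of_derivative_bound[where f = "\<lambda>t. ?g ds' (move p s t)" and f' = "\<lambda>t. partial ?y (?g ds') (move p s t)"])
    show "((\<lambda>t. ?g ds' (move p s t)) has_real_derivative partial ?y (?g ds') (move p s u)) (at u)"
      if "0 \<le> u" "u \<le> t" for u
      using that s t B by (intro DERIV_move(2) foldr_partial_green_derivative(1) region(2)) auto
    show "\<bar>partial ?y (?g ds') (move p s u)\<bar> \<le> M / r ^ (e + Suc k)" if "0 \<le> u" "u \<le> t" for u
      using D[of "Suc k" "?y # ds'" s u] that s t B k xy by simp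
  qed (use zero t in auto)
  \<comment> \<open>For j = n the function and its first y_n-derivative vanish at y_n = 0:
    \<open>y1\<close> bounds the derivative, and a second use of the mean value theorem bounds the
    function.\<close>
  have y2: "\<bar>?g ds' (move p s b)\<bar> \<le> b * (b * (M / r ^ (e + Suc (Suc k))))"
    if k: "k \<le> 1" "set ds' \<subseteq> Basis" "length ds' = m + k"
      and s: "0 \<le> s" "s \<le> a" "s = a \<or> A < 1 / 8" and B: "B < 1 / 8"
      and tan: "\<And>d. d \<in> set ds' \<Longrightarrow> snd (snd d) = 0" and j: "j = e_n" for k ds' s
  proof (rule abs_le_of_derivative_bound[where f = "\<lambda>t. ?g ds' (move p s t)" and f' = "\<lambda>t. partial ?y (?g ds') (move p s t)"])
    show "?g ds' (move p s 0) = 0"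
      by (rule foldr_partial_vanish[OF open_regular linear_snd_height region(2)])
         (use s b B tan in \<open>auto simp: move_def green_map_boundary\<close>)
    show "((\<lambda>t. ?g ds' (move p s t)) has_real_derivative partial ?y (?g ds') (move p s u)) (at u)"
      if "0 \<le> u" "u \<le> b" for u
      using that s B by (intro DERIV_move(2) foldr_partial_green_derivative(1) region(2)) auto
    show "\<bar>partial ?y (?g ds') (move p s u)\<bar> \<le> b * (M / r ^ (e + Suc (Suc k)))" if u: "0 \<le> u" "u \<le> b" for u
    proof -
      have "partial ?y (?g ds') (move p s 0) = 0"
        unfolding j by (rule foldr_partial_green_normal[OF region(2)])
          (use s b B tan in \<open>auto simp: move_def\<close>)
      then have "\<bar>partial ?y (?g ds') (move p s u)\<bar> \<le> u * (M / r ^ (e + Suc (Suc k)))"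
        using y1[of "Suc k" "?y # ds'" s u] k s u B xy by simp
      also have "\<dots> \<le> b * (M / r ^ (e + Suc (Suc k)))"
        using u M r by (intro mult_right_mono) auto
      finally show ?thesis .
    qed
  qed (use b in auto)
  \<comment> \<open>The bound N on the x_n-derivative is left open so that \<open>D\<close>,
    \<open>y1\<close> or \<open>y2\<close> can supply it.\<close>
  have x1: "\<bar>?g ds p\<bar> \<le> a * N"
    if A: "A < 1 / 8" and tan: "\<And>d. d \<in> set ds \<Longrightarrow> snd (fst d) = 0"
      and bnd: "\<And>s. 0 \<le> s \<Longrightarrow> s \<le> a \<Longrightarrow> \<bar>?g (?x # ds) (move p s b)\<bar> \<le> N" for N
  proof -
    have "\<bar>?g ds (move p a b)\<bar> \<le> a * N"
    proof (rule abs_le_of_derivative_bound[where f = "\<lambda>s. ?g ds (move p s b)" and f' = "\<lambda>s. partial ?x (?g ds) (move p s b)"])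
      show "?g ds (move p 0 b) = 0"
        by (rule foldr_partial_vanish[OF open_regular linear_fst_height region(2)])
           (use a b A tan in \<open>auto simp: move_def green_map_boundary\<close>)
      show "((\<lambda>s. ?g ds (move p s b)) has_real_derivative partial ?x (?g ds) (move p s b)) (at s)"
        if "0 \<le> s" "s \<le> a" for s
        using that b A by (intro DERIV_move(1) foldr_partial_green_derivative(1) region(2)) auto
    qed (use a bnd in auto)
    then show ?thesis by (simp add: pm)
  qed
  \<comment> \<open>Once the ratios have used up the extra powers of 1 / r, the remaining r^e is
    replaced by the smaller w^e.\<close>
  have scale: "M / r ^ e \<le> H"
    unfolding H using M w wr by (intro divide_left_mono power_mono mult_pos_pos zero_less_power) (auto intro: less_le_trans[OF w])
  have Fx: "\<bar>?g ds p\<bar> \<le> A * H" if A: "A < 1 / 8" and tan: "\<And>d. d \<in> set ds \<Longrightarrow> snd (fst d) = 0"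
  proof -
    have "\<bar>?g ds p\<bar> \<le> a * (M / r ^ (e + 1))"
      using D[of 1 "?x # ds"] A b ds xy by (intro x1[OF A tan]) auto
    also have "\<dots> = A * (M / r ^ e)" by (simp add: A_def)
    also have "\<dots> \<le> A * H" by (rule mult_left_mono[OF scale AB(1)])
    finally show ?thesis .
  qed
  have Fy: "\<bar>?g ds p\<bar> \<le> B * H" if B: "B < 1 / 8" and tan: "\<And>d. d \<in> set ds \<Longrightarrow> snd (snd d) = 0"
  proof -
    have "?g ds (move p a 0) = 0"
      by (rule foldr_partial_vanish[OF open_regular linear_snd_height region(2)])
         (use a b B tan in \<open>auto simp: move_def green_map_boundary\<close>)
    then have "\<bar>?g ds (move p a b)\<bar> \<le> b * (M / r ^ (e + Suc 0))"
      using ds a b B by (intro y1) auto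
    also have "\<dots> = B * (M / r ^ e)" by (simp add: B_def)
    also have "\<dots> \<le> B * H" by (rule mult_left_mono[OF scale AB(2)])
    finally show ?thesis by (simp add: pm)
  qed
  have Fxy: "\<bar>?g ds p\<bar> \<le> A * B * H" if A: "A < 1 / 8" and B: "B < 1 / 8"
    and tan: "\<And>d. d \<in> set ds \<Longrightarrow> snd (fst d) = 0 \<and> snd (snd d) = 0"
  proof -
    have "\<bar>?g ds p\<bar> \<le> a * (b * (M / r ^ (e + Suc 1)))"
    proof (rule x1[OF A])
      fix s assume s: "0 \<le> s" "s \<le> a"
      \<comment> \<open>The x_n-direction is tangential to y_n = 0, so the zero boundary value there
        survives the additional derivative.\<close>
      have "?g (?x # ds) (move p s 0) = 0"
        by (rule foldr_partial_vanish[OF open_regular linear_snd_height region(2)])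
           (use s b A B tan in \<open>auto simp: move_def green_map_boundary\<close>)
      then show "\<bar>?g (?x # ds) (move p s b)\<bar> \<le> b * (M / r ^ (e + Suc 1))"
        using ds s b A B xy by (intro y1) auto
    qed (use tan in auto)
    also have "\<dots> = A * B * (M / r ^ e)" by (simp add: A_def B_def)
    also have "\<dots> \<le> A * B * H" using AB by (intro mult_left_mono[OF scale]) auto
    finally show ?thesis .
  qed
  have Fyy: "\<bar>?g ds p\<bar> \<le> B\<^sup>2 * H" if B: "B < 1 / 8" and j: "j = e_n"
    and tan: "\<And>d. d \<in> set ds \<Longrightarrow> snd (snd d) = 0"
  proof -
    have "\<bar>?g ds (move p a b)\<bar> \<le> b * (b * (M / r ^ (e + Suc (Suc 0))))"
      using ds a b B tan j by (intro y2) auto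
    also have "\<dots> = B\<^sup>2 * (M / r ^ e)" by (simp add: B_def power2_eq_square)
    also have "\<dots> \<le> B\<^sup>2 * H" by (intro mult_left_mono[OF scale]) auto
    finally show ?thesis by (simp add: pm)
  qed
  have Fxyy: "\<bar>?g ds p\<bar> \<le> A * B\<^sup>2 * H" if A: "A < 1 / 8" and B: "B < 1 / 8" and j: "j = e_n"
    and tan: "\<And>d. d \<in> set ds \<Longrightarrow> snd (fst d) = 0 \<and> snd (snd d) = 0"
  proof -
    have "\<bar>?g ds p\<bar> \<le> a * (b * (b * (M / r ^ (e + Suc (Suc 1)))))"
    proof (rule x1[OF A])
      fix s assume s: "0 \<le> s" "s \<le> a"
      show "\<bar>?g (?x # ds) (move p s b)\<bar> \<le> b * (b * (M / r ^ (e + Suc (Suc 1))))"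
        by (rule y2) (use ds s A B xy tan j in auto)
    qed (use tan in auto)
    also have "\<dots> = A * B\<^sup>2 * (M / r ^ e)" by (simp add: A_def B_def power2_eq_square)
    also have "\<dots> \<le> A * B\<^sup>2 * H" using AB by (intro mult_left_mono[OF scale]) auto
    finally show ?thesis .
  qed
  have up: "u * v \<le> 8 * t * u * v" if "1 / 8 \<le> t" "0 \<le> u * v" for t u v :: real
    using mult_right_mono[of 1 "8 * t" "u * v"] that by (simp add: mult.assoc)
  show "\<bar>?g ds p\<bar> \<le> H" by (rule F0)
  show "\<bar>?g ds p\<bar> \<le> 8 * (a / r) * H" if "\<And>d. d \<in> set ds \<Longrightarrow> snd (fst d) = 0"
  proof (cases "A < 1 / 8")
    case True
    then show ?thesis using Fx[OF True that] mult_nonneg_nonneg[OF AB(1) H0] unfolding A_def[symmetric] by linarith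
  next
    case False
    then show ?thesis using F0 up[of A 1 H] H0 unfolding A_def[symmetric] by simp
  qed
  have two: "\<bar>?g ds p\<bar> \<le> 64 * A * B * H"
    if tan: "\<And>d. d \<in> set ds \<Longrightarrow> snd (fst d) = 0 \<and> snd (snd d) = 0"
  proof -
    have nn: "0 \<le> A * H" "0 \<le> B * H" "0 \<le> A * B * H" using AB H0 by auto
    consider "A < 1 / 8" "B < 1 / 8" | "A < 1 / 8" "1 / 8 \<le> B" | "1 / 8 \<le> A" "B < 1 / 8" | "1 / 8 \<le> A" "1 / 8 \<le> B"
      by linarith
    then show ?thesis
    proof cases
      case 1
      then show ?thesis using Fxy[OF 1 tan] nn by simp
    next
      case 2
      then show ?thesis using Fx[OF 2(1)] tan up[OF 2(2) nn(1)] nn by (simp add: mult_ac)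
    next
      case 3
      then show ?thesis using Fy[OF 3(2)] tan up[OF 3(1) nn(2)] nn by (simp add: mult_ac)
    next
      case 4
      have "\<bar>?g ds p\<bar> \<le> 8 * A * 1 * H" using F0 up[OF 4(1), of 1 H] H0 by simp
      also have "\<dots> \<le> 8 * (8 * B * A * H)" using up[OF 4(2) nn(1)] by (simp add: mult_ac)
      finally show ?thesis by (simp add: mult_ac)
    qed
  qed
  then show "\<bar>?g ds p\<bar> \<le> 64 * (a / r) * (b / r) * H"
    if "\<And>d. d \<in> set ds \<Longrightarrow> snd (fst d) = 0 \<and> snd (snd d) = 0"
    using that unfolding A_def B_def by blast
  show "\<bar>?g ds p\<bar> \<le> 512 * (a / r) * (b / r)\<^sup>2 * H"
    if tan: "\<And>d. d \<in> set ds \<Longrightarrow> snd (fst d) = 0 \<and> snd (snd d) = 0" and j: "j = e_n"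
  proof -
    have nn: "0 \<le> B\<^sup>2 * H" "0 \<le> A * B * H" "0 \<le> A * B\<^sup>2 * H" using AB H0 by auto
    have "\<bar>?g ds p\<bar> \<le> 512 * A * B\<^sup>2 * H"
    proof (cases "B < 1 / 8")
      case True
      show ?thesis
      proof (cases "A < 1 / 8")
        case A: True
        then show ?thesis using Fxyy[OF A True j tan] nn by simp
      next
        case False
        then have "B\<^sup>2 * H \<le> 8 * A * B\<^sup>2 * H" using nn by (intro up) auto
        then show ?thesis using Fyy[OF True j] tan nn by simp
      qed
    next
      case False
      \<comment> \<open>For B \<ge> 1 / 8 the estimate of first order in B is enough, the second
        factor B being inserted at the price of 8.\<close>
      then have "A * B * H \<le> 8 * B * (A * B) * H" using nn by (intro up) auto
      then show ?thesis using two[OF tan] by (simp add: power2_eq_square mult_ac)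
    qed
    then show ?thesis unfolding A_def B_def .
  qed
qed

text \<open>Smoothness is part of the conclusion because \<open>partial\<close> rests on
  \<open>deriv\<close>, whose value means nothing where no derivative exists, and because it makes
  the order of differentiation in \<open>multi_deriv\<close> immaterial. The constant is chosen
  before the points, indices and multi-indices, so it depends on m and the dimension alone.\<close>

theorem theorem2p5:
  fixes m :: nat
  assumes "m > 0"
  shows "(\<forall>i\<in>Basis. \<forall>j\<in>Basis.
            smooth_on {(x, y). x \<in> half_space \<and> y \<in> half_space \<and> x \<noteq> y}
              (\<lambda>(x, y). green i j x (y :: 'a::euclidean_space \<times> real))) \<and>
         (\<exists>C :: real.
            \<forall>x\<in>half_space. \<forall>y\<in>half_space. \<forall>i\<in>Basis. \<forall>j\<in>Basis.
            \<forall>\<alpha> \<beta> :: 'a \<times> real \<Rightarrow> nat.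
              x \<noteq> y \<and> multi_order \<alpha> + multi_order \<beta> = m \<longrightarrow>
              (let n = DIM('a \<times> real); z = x - reflect y; x\<^sub>n = x \<bullet> e_n; y\<^sub>n = y \<bullet> e_n in
                 \<bar>green_deriv \<alpha> \<beta> i j x y\<bar> \<le> C / norm (x - y) ^ (n - 2 + m) \<and>
                 (\<alpha> e_n = 0 \<and> \<beta> e_n = 0 \<longrightarrow>
                    \<bar>green_deriv \<alpha> \<beta> i j x y\<bar>
                      \<le> C * x\<^sub>n * y\<^sub>n / (norm (x - y) ^ (n - 2 + m) * norm z ^ 2) \<and>
                    \<bar>green_deriv \<alpha> \<beta> i e_n x y\<bar>
                      \<le> C * x\<^sub>n * y\<^sub>n ^ 2 / (norm (x - y) ^ (n - 2 + m) * norm z ^ 3)) \<and>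
                 (\<alpha> e_n = 0 \<longrightarrow>
                    \<bar>green_deriv \<alpha> \<beta> i j x y\<bar>
                      \<le> C * x\<^sub>n / (norm (x - y) ^ (n - 2 + m) * norm z))))"
proof (intro conjI ballI green_smooth_on)
  let ?n = "DIM('a \<times> real)"
  define e where "e = ?n - 2 + m"
  have "\<forall>k. \<exists>C\<ge>0. \<forall>i\<in>Basis. \<forall>j\<in>Basis. \<forall>ds q. set ds \<subseteq> Basis \<and> length ds = m + k \<and> q \<in> regular \<and> q \<in> quadrant \<longrightarrow>
      \<bar>foldr partial ds (green_map i (j :: 'a \<times> real)) q\<bar> \<le> C / norm (sep q) ^ (e + k)"
  proof
    fix k
    have "m + k > 0" using assms by simp
    from foldr_partial_green_bound[OF this] obtain C where "C \<ge> 0"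
      "\<And>i j ds p. i \<in> Basis \<Longrightarrow> j \<in> Basis \<Longrightarrow> set ds \<subseteq> Basis \<Longrightarrow> length ds = m + k \<Longrightarrow>
        p \<in> regular \<Longrightarrow> p \<in> quadrant \<Longrightarrow>
        \<bar>foldr partial ds (green_map i (j :: 'a \<times> real)) p\<bar> \<le> C / norm (sep p) ^ (?n - 2 + (m + k))"
      by blast
    then show "\<exists>C\<ge>0. \<forall>i\<in>Basis. \<forall>j\<in>Basis. \<forall>ds q. set ds \<subseteq> Basis \<and> length ds = m + k \<and> q \<in> regular \<and> q \<in> quadrant \<longrightarrow>
        \<bar>foldr partial ds (green_map i (j :: 'a \<times> real)) q\<bar> \<le> C / norm (sep q) ^ (e + k)"
      unfolding e_def add.assoc by blast
  qed
  then obtain Cf where Cf: "\<And>k. Cf k \<ge> 0"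
    "\<And>k i j ds q. i \<in> Basis \<Longrightarrow> j \<in> Basis \<Longrightarrow> set ds \<subseteq> Basis \<Longrightarrow> length ds = m + k \<Longrightarrow> q \<in> regular \<Longrightarrow> q \<in> quadrant \<Longrightarrow>
      \<bar>foldr partial ds (green_map i (j :: 'a \<times> real)) q\<bar> \<le> Cf k / norm (sep q) ^ (e + k)"
    by metis
  \<comment> \<open>At most three derivatives are added to the m given ones, so the four constants
    for k = 0, ..., 3 are summed.\<close>
  define C where "C = (\<Sum>k\<le>3. Cf k)"
  have C0: "C \<ge> 0" unfolding C_def by (intro sum_nonneg Cf(1))
  have C: "\<bar>foldr partial ds (green_map i j) q\<bar> \<le> C / norm (sep q) ^ (e + k)"
    if "i \<in> Basis" "j \<in> Basis" "k \<le> 3" "set ds \<subseteq> Basis" "length ds = m + k" "q \<in> regular" "q \<in> quadrant"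
    for i j :: "'a \<times> real" and k ds q
  proof -
    have "Cf k \<le> C" unfolding C_def using that(3) Cf(1) by (intro member_le_sum) auto
    then show ?thesis
      using Cf(2)[OF that(1,2,4-7)] by (meson divide_right_mono norm_ge_zero order_trans zero_le_power)
  qed
  \<comment> \<open>The estimates carry the factors 1, 8, 64 and 512; the largest serves for all of
    them.\<close>
  define K where "K = 512 * (C * 2 ^ (e + 3))"
  have K: "K \<ge> 0" using C0 by (simp add: K_def)
  show "\<exists>C :: real. \<forall>x\<in>half_space. \<forall>y\<in>half_space. \<forall>i\<in>Basis. \<forall>j\<in>Basis.
            \<forall>\<alpha> \<beta> :: 'a \<times> real \<Rightarrow> nat.
              x \<noteq> y \<and> multi_order \<alpha> + multi_order \<beta> = m \<longrightarrow>
              (let n = DIM('a \<times> real); z = x - reflect y; x\<^sub>n = x \<bullet> e_n; y\<^sub>n = y \<bullet> e_n in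
                 \<bar>green_deriv \<alpha> \<beta> i j x y\<bar> \<le> C / norm (x - y) ^ (n - 2 + m) \<and>
                 (\<alpha> e_n = 0 \<and> \<beta> e_n = 0 \<longrightarrow>
                    \<bar>green_deriv \<alpha> \<beta> i j x y\<bar>
                      \<le> C * x\<^sub>n * y\<^sub>n / (norm (x - y) ^ (n - 2 + m) * norm z ^ 2) \<and>
                    \<bar>green_deriv \<alpha> \<beta> i e_n x y\<bar>
                      \<le> C * x\<^sub>n * y\<^sub>n ^ 2 / (norm (x - y) ^ (n - 2 + m) * norm z ^ 3)) \<and>
                 (\<alpha> e_n = 0 \<longrightarrow>
                    \<bar>green_deriv \<alpha> \<beta> i j x y\<bar>
                      \<le> C * x\<^sub>n / (norm (x - y) ^ (n - 2 + m) * norm z)))"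
  proof (intro exI[of _ K] ballI allI impI)
    fix x y i j :: "'a \<times> real" and \<alpha> \<beta> :: "'a \<times> real \<Rightarrow> nat"
    assume xy: "x \<in> half_space" "y \<in> half_space" and ij: "i \<in> Basis" "j \<in> Basis"
      and "x \<noteq> y \<and> multi_order \<alpha> + multi_order \<beta> = m"
    then have ne: "x \<noteq> y" and ord: "multi_order \<alpha> + multi_order \<beta> = m" by auto
    define w r a b where "w = norm (x - y)" and "r = norm (x - reflect y)" and "a = snd x" and "b = snd y"
    define ds where "ds = pair_list \<alpha> \<beta>"
    have ab: "a > 0" "b > 0" using xy by (auto simp: half_space_def a_def b_def)
    have gd: "green_deriv \<alpha> \<beta> i j x y = foldr partial ds (green_map i j) (x, y)" if "j \<in> Basis" for j
      unfolding green_deriv_eq_foldr ds_def by (rule foldr_partial_green_eq[OF ij(1) that xy ne])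
    have ds: "set ds \<subseteq> Basis" "length ds = m"
      unfolding ds_def by (rule pair_list_Basis) (simp add: length_pair_list ord)
    have tx: "snd (fst d) = 0" if "\<alpha> e_n = 0" "d \<in> set ds" for d
      using pair_list_tangential(1) that unfolding ds_def by blast
    have ty: "snd (snd d) = 0" if "\<beta> e_n = 0" "d \<in> set ds" for d
      using pair_list_tangential(2) that unfolding ds_def by blast
    define H where "H = C * 2 ^ (e + 3) / w ^ e"
    have H: "H \<ge> 0" using C0 by (simp add: H_def w_def)
    have est: "\<bar>foldr partial ds (green_map i j) (x, y)\<bar> \<le> H"
      "\<alpha> e_n = 0 \<Longrightarrow> \<bar>foldr partial ds (green_map i j) (x, y)\<bar> \<le> 8 * (a / r) * H"
      "\<alpha> e_n = 0 \<Longrightarrow> \<beta> e_n = 0 \<Longrightarrow> \<bar>foldr partial ds (green_map i j) (x, y)\<bar> \<le> 64 * (a / r) * (b / r) * H"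
      "\<alpha> e_n = 0 \<Longrightarrow> \<beta> e_n = 0 \<Longrightarrow> j = e_n \<Longrightarrow>
        \<bar>foldr partial ds (green_map i j) (x, y)\<bar> \<le> 512 * (a / r) * (b / r)\<^sup>2 * H"
      if j: "j \<in> Basis" for j
    proof -
      have c: "\<And>k ds q. k \<le> 3 \<Longrightarrow> set ds \<subseteq> Basis \<Longrightarrow> length ds = m + k \<Longrightarrow> q \<in> regular \<Longrightarrow> q \<in> quadrant \<Longrightarrow>
          \<bar>foldr partial ds (green_map i j) q\<bar> \<le> C / norm (sep q) ^ (e + k)"
        by (rule C[OF ij(1) j])
      note g = green_map_estimates[OF ij(1) j ds assms half_space_regular[OF xy ne] C0 c,
          unfolded sep_def sep_refl_def fst_conv snd_conv, folded w_def r_def a_def b_def, folded H_def]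
      show "\<bar>foldr partial ds (green_map i j) (x, y)\<bar> \<le> H" by (rule g(1)) assumption+
      show "\<bar>foldr partial ds (green_map i j) (x, y)\<bar> \<le> 8 * (a / r) * H" if "\<alpha> e_n = 0"
        by (rule g(2)) (assumption | rule tx[OF that])+
      show "\<bar>foldr partial ds (green_map i j) (x, y)\<bar> \<le> 64 * (a / r) * (b / r) * H"
        if "\<alpha> e_n = 0" "\<beta> e_n = 0"
        by (rule g(3)) (assumption | rule conjI tx[OF that(1)] ty[OF that(2)])+
      show "\<bar>foldr partial ds (green_map i j) (x, y)\<bar> \<le> 512 * (a / r) * (b / r)\<^sup>2 * H"
        if "\<alpha> e_n = 0" "\<beta> e_n = 0" "j = e_n"
        by (rule g(4)) (assumption | rule conjI tx[OF that(1)] ty[OF that(2)] that(3))+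
    qed
    have nn: "0 \<le> a / r * H" "0 \<le> a / r * (b / r) * H" using ab H by (auto simp: r_def)
    have K1: "512 * H = K / w ^ e" "512 * (a / r) * H = K * a / (w ^ e * r)"
      "512 * (a / r) * (b / r) * H = K * a * b / (w ^ e * r ^ 2)"
      "512 * (a / r) * (b / r)\<^sup>2 * H = K * a * b ^ 2 / (w ^ e * r ^ 3)"
      by (simp_all add: H_def K_def power2_eq_square power3_eq_cube mult_ac)
    show "let n = DIM('a \<times> real); z = x - reflect y; x\<^sub>n = x \<bullet> e_n; y\<^sub>n = y \<bullet> e_n in
                 \<bar>green_deriv \<alpha> \<beta> i j x y\<bar> \<le> K / norm (x - y) ^ (n - 2 + m) \<and>
                 (\<alpha> e_n = 0 \<and> \<beta> e_n = 0 \<longrightarrow>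
                    \<bar>green_deriv \<alpha> \<beta> i j x y\<bar>
                      \<le> K * x\<^sub>n * y\<^sub>n / (norm (x - y) ^ (n - 2 + m) * norm z ^ 2) \<and>
                    \<bar>green_deriv \<alpha> \<beta> i e_n x y\<bar>
                      \<le> K * x\<^sub>n * y\<^sub>n ^ 2 / (norm (x - y) ^ (n - 2 + m) * norm z ^ 3)) \<and>
                 (\<alpha> e_n = 0 \<longrightarrow>
                    \<bar>green_deriv \<alpha> \<beta> i j x y\<bar>
                      \<le> K * x\<^sub>n / (norm (x - y) ^ (n - 2 + m) * norm z))"
      unfolding Let_def inner_e_n e_def[symmetric] w_def[symmetric] r_def[symmetric] a_def[symmetric] b_def[symmetric]
        gd[OF ij(2)] gd[OF e_n_Basis] K1[symmetric]
    proof (intro conjI impI)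
      show "\<bar>foldr partial ds (green_map i j) (x, y)\<bar> \<le> 512 * H"
        using est(1)[OF ij(2)] H by linarith
      show "\<bar>foldr partial ds (green_map i j) (x, y)\<bar> \<le> 512 * (a / r) * H" if "\<alpha> e_n = 0"
        using est(2)[OF ij(2) that] nn(1) unfolding mult.assoc by linarith
      show "\<bar>foldr partial ds (green_map i j) (x, y)\<bar> \<le> 512 * (a / r) * (b / r) * H" if "\<alpha> e_n = 0 \<and> \<beta> e_n = 0"
        using est(3)[OF ij(2) conjunct1[OF that] conjunct2[OF that]] nn(2) unfolding mult.assoc by linarith
      show "\<bar>foldr partial ds (green_map i e_n) (x, y)\<bar> \<le> 512 * (a / r) * (b / r)\<^sup>2 * H" if "\<alpha> e_n = 0 \<and> \<beta> e_n = 0"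
        by (rule est(4)[OF e_n_Basis conjunct1[OF that] conjunct2[OF that] refl])
    qed
  qed
qed

end
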